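(* Let $\Bbbk$ be a field and let $f = (1, f_1, f_2, \dots)$ be a finite sequence of natural numbers. Then the following conditions are equivalent: (1) There exists a squarefree monomial ideal $I$ in some polynomial ring $S = \Bbbk[x_1,\dots,x_n]$ whose minimal free resolution (that is, the minimal free resolution of $S/I$ over $S$) is a DGA, such that $\beta^S_i(S/I) = f_i$ for all $i$ (where $f_0 = 1$). (2) $f$ is the $f$-vector of a simplicial complex $\Delta$ which is a cone.
   Context: $S = \Bbbk[x_1,\dots,x_n]$ carries the fine $\mathbb{Z}^n$-grading. $\beta_i^S(S/I) = \dim_\Bbbk \operatorname{Tor}_i^S(S/I,\Bbbk)$ is the $i$-th total Betti number. Entries beyond the length of the sequence $f$ are understood to be $0$. The $f$-vector of a simplicial complex $\Delta$ is indexed so that $f_i$ is the number of faces of $\Delta$ with exactly $i$ vertices; in particular $f_0 = 1$ counts the empty face. A simplicial complex $\Delta$ is a cone if it has a vertex $v$ (the apex) such that $W \cup \{v\} \in \Delta$ for every $W \in \Delta$. Let $\mathbb{F}$ be the minimal $\mathbb{Z}^n$-graded free resolution of $S/I$ with $\mathbb{F}_0=S$ and differential $\partial$, identified with $\bigoplus_i \mathbb{F}_i$; $|a|$ denotes the homological degree of $a\in\mathbb{F}$. That the minimal free resolution is a DGA means that $\mathbb{F}$ admits a DGA structure: an $S$-linear map $* : \mathbb{F} \otimes_S \mathbb{F} \to \mathbb{F}$ respecting the $\mathbb{Z}^n$-grading, such that for all (homogeneous) $a,b,c\in\mathbb{F}$: (1) $*$ extends the usual multiplication on $\mathbb{F}_0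 = S$; (2) $\partial(a*b) = \partial(a)*b + (-1)^{|a|} a*\partial(b)$; (3) $|a*b| = |a|+|b|$; (4) $a*b = (-1)^{|a||b|} b*a$; (5) $(a*b)*c = a*(b*c)$.
   Formalization: The ideal I in (1) is required to be nonzero, because I = 0 has the DGA resolution S with Betti sequence (1,0,0,…), which is not the f-vector of a cone (the complex {∅} has no vertex); for every other f this condition is automatic. *)

theory Defs
  imports Main "HOL-Library.Poly_Mapping"
begin

section \<open>Polynomial rings and squarefree monomial ideals\<close>

text \<open>
  The number of variables is quantified inside the statement, so \<open>\<Bbbk>[x\<^sub>1,\<dots>,x\<^sub>n]\<close> is the
  subring \<open>polyring n\<close> of the ring of polynomials in variables indexed by \<^typ>\<open>nat\<close>; the variables
  are numbered \<open>0,\<dots>,n-1\<close>.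
\<close>

type_synonym 'k mpoly = "(nat \<Rightarrow>\<^sub>0 nat) \<Rightarrow>\<^sub>0 'k"

definition polyring :: "nat \<Rightarrow> 'k::zero mpoly set" where
  "polyring n = {p. \<forall>m\<in>Poly_Mapping.keys p. Poly_Mapping.keys m \<subseteq> {..<n}}"

definition ideal_generated :: "nat \<Rightarrow> 'k::field mpoly set \<Rightarrow> 'k mpoly set" where
  "ideal_generated n G =
     {\<Sum>g\<in>A. c g * g | A c. finite A \<and> A \<subseteq> G \<and> (\<forall>g\<in>A. c g \<in> polyring n)}"

definition squarefree_monomials :: "nat \<Rightarrow> 'k::field mpoly set" where
  "squarefree_monomials n =
     {Poly_Mapping.single m 1 | m. Poly_Mapping.keys m \<subseteq> {..<n} \<and> (\<forall>i. poly_mapping.lookup m i \<le> 1)}"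

definition squarefree_monomial_ideal :: "nat \<Rightarrow> 'k::field mpoly set \<Rightarrow> bool" where
  "squarefree_monomial_ideal n I \<longleftrightarrow> (\<exists>G \<subseteq> squarefree_monomials n. I = ideal_generated n G)"


section \<open>Free resolutions of \<open>S/I\<close>\<close>

text \<open>
  A complex of free modules over \<open>S = polyring n\<close> is given with chosen bases. All the basis elements
  of \<open>\<bbbF> = \<Oplus>\<^sub>i \<bbbF>\<^sub>i\<close> form one set \<open>basis\<close>, and \<open>hdeg\<close> is the homological degree.
  An element of \<open>\<bbbF>\<close> is its finitely supported family of coordinates. \<open>gen0\<close> is the basis element
  that spans \<open>\<bbbF>\<^sub>0 = S\<close>. Only the values of \<open>bdry\<close> on \<open>\<bbbF>\<close> matter.
\<close>

type_synonym ('b, 'k) fvec = "'b \<Rightarrow>\<^sub>0 'k mpoly"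

record (overloaded) ('b, 'k) free_complex =
  basis :: "'b set"
  hdeg :: "'b \<Rightarrow> nat"
  gen0 :: 'b
  bdry :: "('b, 'k::zero) fvec \<Rightarrow> ('b, 'k) fvec"

definition smult :: "'k::field mpoly \<Rightarrow> ('b, 'k) fvec \<Rightarrow> ('b, 'k) fvec" where
  "smult p v = Poly_Mapping.map (\<lambda>q. p * q) v"

definition elems :: "nat \<Rightarrow> ('b, 'k::field, 'z) free_complex_scheme \<Rightarrow> ('b, 'k) fvec set" where
  "elems n F =
     {v. Poly_Mapping.keys v \<subseteq> basis F \<and> (\<forall>b. poly_mapping.lookup v b \<in> polyring n)}"

definition component ::
  "nat \<Rightarrow> ('b, 'k::field, 'z) free_complex_scheme \<Rightarrow> nat \<Rightarrow> ('b, 'k) fvec set" where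
  "component n F i = {v \<in> elems n F. \<forall>b\<in>Poly_Mapping.keys v. hdeg F b = i}"

definition linear_bdry :: "nat \<Rightarrow> ('b, 'k::field, 'z) free_complex_scheme \<Rightarrow> bool" where
  "linear_bdry n F \<longleftrightarrow>
     (\<forall>v\<in>elems n F. \<forall>w\<in>elems n F. bdry F (v + w) = bdry F v + bdry F w) \<and>
     (\<forall>p\<in>polyring n. \<forall>v\<in>elems n F. bdry F (smult p v) = smult p (bdry F v))"

text \<open>
  The last clause says that the image of \<open>\<bbbF>\<^sub>1\<close> in \<open>\<bbbF>\<^sub>0 = S\<close> is \<open>I\<close>, that is, that the
  cokernel is \<open>S/I\<close>.
\<close>

definition free_resolution ::
  "nat \<Rightarrow> 'k::field mpoly set \<Rightarrow> ('b, 'k, 'z) free_complex_scheme \<Rightarrow> bool" where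
  "free_resolution n I F \<longleftrightarrow>
     {b \<in> basis F. hdeg F b = 0} = {gen0 F} \<and>
     linear_bdry n F \<and>
     (\<forall>v\<in>component n F 0. bdry F v = 0) \<and>
     (\<forall>i. \<forall>v\<in>component n F (Suc i). bdry F v \<in> component n F i) \<and>
     (\<forall>i. {v \<in> component n F (Suc i). bdry F v = 0} = bdry F ` component n F (Suc (Suc i))) \<and>
     bdry F ` component n F 1 = Poly_Mapping.single (gen0 F) ` I"


section \<open>\<open>Tor\<^sub>i(S/I, \<Bbbk>)\<close> and Betti numbers\<close>

text \<open>
  \<open>\<bbbF> \<otimes>\<^sub>S \<Bbbk>\<close> is the \<open>\<Bbbk>\<close>-vector space with the same basis as \<open>\<bbbF>\<close>. Its differential
  \<open>\<partial> \<otimes> \<Bbbk>\<close> is obtained by lifting coordinates to constant polynomials, applying \<open>\<partial>\<close>, and taking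
  the constant terms of the coordinates of the result.
\<close>

definition tensor_component ::
  "('b, 'k::field, 'z) free_complex_scheme \<Rightarrow> nat \<Rightarrow> ('b \<Rightarrow>\<^sub>0 'k) set" where
  "tensor_component F i = {v. Poly_Mapping.keys v \<subseteq> {b \<in> basis F. hdeg F b = i}}"

definition tensor_bdry ::
  "('b, 'k::field, 'z) free_complex_scheme \<Rightarrow> ('b \<Rightarrow>\<^sub>0 'k) \<Rightarrow> ('b \<Rightarrow>\<^sub>0 'k)" where
  "tensor_bdry F v =
     Poly_Mapping.map (\<lambda>p. poly_mapping.lookup p 0)
       (bdry F (Poly_Mapping.map (Poly_Mapping.single 0) v))"

definition tor_cycles :: "('b, 'k::field, 'z) free_complex_scheme \<Rightarrow> nat \<Rightarrow> ('b \<Rightarrow>\<^sub>0 'k) set" where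
  "tor_cycles F i = {v \<in> tensor_component F i. tensor_bdry F v = 0}"

definition tor_boundaries :: "('b, 'k::field, 'z) free_complex_scheme \<Rightarrow> nat \<Rightarrow> ('b \<Rightarrow>\<^sub>0 'k) set" where
  "tor_boundaries F i = tensor_bdry F ` tensor_component F (Suc i)"

text \<open>
  \<open>basis_modulo Z B X\<close>: the cosets of the elements of the finite set \<open>X\<close> are pairwise distinct and form
  a basis of the quotient space \<open>Z/B\<close>.
\<close>

definition basis_modulo ::
  "('b \<Rightarrow>\<^sub>0 'k::field) set \<Rightarrow> ('b \<Rightarrow>\<^sub>0 'k) set \<Rightarrow> ('b \<Rightarrow>\<^sub>0 'k) set \<Rightarrow> bool" where
  "basis_modulo Z B X \<longleftrightarrow> finite X \<and> X \<subseteq> Z \<and>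
     (\<forall>z\<in>Z. \<exists>!c. (\<forall>x. x \<notin> X \<longrightarrow> c x = 0) \<and> z - (\<Sum>x\<in>X. Poly_Mapping.map (\<lambda>t. c x * t) x) \<in> B)"

definition quotient_dim :: "('b \<Rightarrow>\<^sub>0 'k::field) set \<Rightarrow> ('b \<Rightarrow>\<^sub>0 'k) set \<Rightarrow> nat" where
  "quotient_dim Z B = (THE d. \<exists>X. basis_modulo Z B X \<and> card X = d)"

text \<open>
  \<open>Tor\<close> does not depend on the free resolution of \<open>S/I\<close> from which it is computed, so any one may be
  chosen. Since \<open>S\<close> is noetherian, there is one with a countable basis and \<open>\<bbbF>\<^sub>0 = S\<close>, and
  the spaces \<open>Tor\<close> are finite-dimensional.
\<close>

definition betti :: "nat \<Rightarrow> 'k::field mpoly set \<Rightarrow> nat \<Rightarrow> nat" where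
  "betti n I i =
     (let F = (SOME F :: (nat, 'k) free_complex. free_resolution n I F)
      in quotient_dim (tor_cycles F i) (tor_boundaries F i))"


section \<open>Minimal graded resolutions and DGA structures\<close>

text \<open>
  \<open>mdeg\<close> is the degree of the basis elements in \<open>\<int>\<^sup>n\<close>; a vector in \<open>\<int>\<^sup>n\<close> is a function on
  \<^typ>\<open>nat\<close> that vanishes from \<open>n\<close> on.
\<close>

record (overloaded) ('b, 'k) graded_free_complex = "('b, 'k::zero) free_complex" +
  mdeg :: "'b \<Rightarrow> nat \<Rightarrow> int"

definition homogeneous ::
  "nat \<Rightarrow> ('b, 'k::field, 'z) graded_free_complex_scheme \<Rightarrow> (nat \<Rightarrow> int) \<Rightarrow> ('b, 'k) fvec set" where
  "homogeneous n F a =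
     {v \<in> elems n F. \<forall>b\<in>Poly_Mapping.keys v. \<forall>m\<in>Poly_Mapping.keys (poly_mapping.lookup v b).
        \<forall>j. int (poly_mapping.lookup m j) + mdeg F b j = a j}"

definition graded_free_resolution ::
  "nat \<Rightarrow> 'k::field mpoly set \<Rightarrow> ('b, 'k, 'z) graded_free_complex_scheme \<Rightarrow> bool" where
  "graded_free_resolution n I F \<longleftrightarrow>
     free_resolution n I F \<and>
     (\<forall>b\<in>basis F. \<forall>j\<ge>n. mdeg F b j = 0) \<and>
     (\<forall>j. mdeg F (gen0 F) j = 0) \<and>
     (\<forall>a. \<forall>v\<in>homogeneous n F a. bdry F v \<in> homogeneous n F a)"

text \<open>Minimality means \<open>\<partial>(\<bbbF>) \<subseteq> \<mm>\<bbbF>\<close> for the ideal \<open>\<mm>\<close> generated by the variables.\<close>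

definition minimal_graded_free_resolution ::
  "nat \<Rightarrow> 'k::field mpoly set \<Rightarrow> ('b, 'k, 'z) graded_free_complex_scheme \<Rightarrow> bool" where
  "minimal_graded_free_resolution n I F \<longleftrightarrow>
     graded_free_resolution n I F \<and>
     (\<forall>v\<in>elems n F. \<forall>b. poly_mapping.lookup (poly_mapping.lookup (bdry F v) b) 0 = 0)"

text \<open>
  An \<open>S\<close>-linear map on \<open>\<bbbF> \<otimes>\<^sub>S \<bbbF>\<close> is given as an \<open>S\<close>-bilinear map on \<open>\<bbbF> \<times> \<bbbF>\<close>.
\<close>

definition bilinear_mult ::
  "nat \<Rightarrow> ('b, 'k::field, 'z) free_complex_scheme \<Rightarrow>
   (('b, 'k) fvec \<Rightarrow> ('b, 'k) fvec \<Rightarrow> ('b, 'k) fvec) \<Rightarrow> bool" where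
  "bilinear_mult n F mul \<longleftrightarrow>
     (\<forall>a\<in>elems n F. \<forall>b\<in>elems n F. mul a b \<in> elems n F) \<and>
     (\<forall>a\<in>elems n F. \<forall>b\<in>elems n F. \<forall>c\<in>elems n F.
        mul (a + b) c = mul a c + mul b c \<and> mul c (a + b) = mul c a + mul c b) \<and>
     (\<forall>p\<in>polyring n. \<forall>a\<in>elems n F. \<forall>b\<in>elems n F.
        mul (smult p a) b = smult p (mul a b) \<and> mul a (smult p b) = smult p (mul a b))"

definition dga_structure ::
  "nat \<Rightarrow> ('b, 'k::field, 'z) graded_free_complex_scheme \<Rightarrow>
   (('b, 'k) fvec \<Rightarrow> ('b, 'k) fvec \<Rightarrow> ('b, 'k) fvec) \<Rightarrow> bool" where
  "dga_structure n F mul \<longleftrightarrow>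
     bilinear_mult n F mul \<and>
     (\<forall>d e. \<forall>a\<in>homogeneous n F d. \<forall>b\<in>homogeneous n F e.
        mul a b \<in> homogeneous n F (\<lambda>j. d j + e j)) \<and>
     (\<forall>p\<in>polyring n. \<forall>q\<in>polyring n.
        mul (Poly_Mapping.single (gen0 F) p) (Poly_Mapping.single (gen0 F) q)
          = Poly_Mapping.single (gen0 F) (p * q)) \<and>
     (\<forall>i j. \<forall>a\<in>component n F i. \<forall>b\<in>component n F j.
        bdry F (mul a b) = mul (bdry F a) b + smult ((- 1) ^ i) (mul a (bdry F b)) \<and>
        mul a b \<in> component n F (i + j) \<and>
        mul a b = smult ((- 1) ^ (i * j)) (mul b a)) \<and>
     (\<forall>a\<in>elems n F. \<forall>b\<in>elems n F. \<forall>c\<in>elems n F. mul (mul a b) c = mul a (mul b c))"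

text \<open>
  The minimal graded free resolution is unique up to isomorphism, and a DGA structure can be
  transported along isomorphisms, so it does not matter which one is used.
\<close>

definition minimal_resolution_is_DGA :: "nat \<Rightarrow> 'k::field mpoly set \<Rightarrow> bool" where
  "minimal_resolution_is_DGA n I \<longleftrightarrow>
     (\<exists>F :: (nat, 'k) graded_free_complex.
        minimal_graded_free_resolution n I F \<and> (\<exists>mul. dga_structure n F mul))"


section \<open>Simplicial complexes\<close>

definition simplicial_complex :: "'v set set \<Rightarrow> bool" where
  "simplicial_complex \<Delta> \<longleftrightarrow>
     finite \<Delta> \<and> (\<forall>W\<in>\<Delta>. finite W) \<and> {} \<in> \<Delta> \<and> (\<forall>W\<in>\<Delta>. \<forall>U \<subseteq> W. U \<in> \<Delta>)"

definition f_vector :: "'v set set \<Rightarrow> nat \<Rightarrow> nat" where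
  "f_vector \<Delta> i = card {W \<in> \<Delta>. card W = i}"

text \<open>\<open>{v} \<in> \<Delta>\<close> says that \<open>v\<close> is a vertex, so \<open>{{}}\<close> is not a cone, and \<open>(1)\<close> is
  not the f-vector of a cone. But \<open>(1)\<close> is the Betti sequence of \<open>S/0\<close>, whose resolution \<open>S\<close> is
  a DGA. The equivalence therefore concerns nonzero ideals.\<close>

definition is_cone :: "'v set set \<Rightarrow> bool" where
  "is_cone \<Delta> \<longleftrightarrow> (\<exists>v. {v} \<in> \<Delta> \<and> (\<forall>W\<in>\<Delta>. W \<union> {v} \<in> \<Delta>))"

end

theory Submission
  imports Defs Complex_Main "HOL-Library.Nat_Bijection"
begin

text \<open>
  Let \<open>\<bbbF>\<close> be a minimal resolution of a squarefree monomial ideal that carries a DGA structure. Its basis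
  elements have squarefree degrees (\<open>mdeg_squarefree\<close>). Setting all variables to \<open>1\<close> turns \<open>\<bbbF>\<close> into a
  graded-commutative differential algebra over the field, with the same basis, and the degrees survive
  as a filtration by subsets \<open>A\<close> of the variables. Since the degrees are squarefree, the product of the parts of
  \<open>A\<close> and \<open>A'\<close> lies in the part of \<open>A \<union> A'\<close>: each part is a subalgebra. It is also exact in positive
  degree (\<open>dehom_d_exact\<close>), and by minimality the differential strictly lowers the filtration. From this
  alone (locale \<open>filtered_dga\<close>) it follows that the algebra is generated in degree one: for a basis element
  \<open>g\<close> and an element \<open>v\<close> of degree one below \<open>g\<close> with \<open>d v = 1\<close>, the element \<open>g - v \<bullet> d g\<close> is a
  cycle, thus \<open>g = v \<bullet> d g + d h\<close> with \<open>d g\<close> and \<open>d h\<close> strictly below \<open>g\<close>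
  (\<open>generated_in_degree_1\<close>). The generators have square zero, so the algebra is a quotient of an exterior
  algebra. Choose generators \<open>v\<^sub>0, v\<^sub>1, \<dots>\<close> with \<open>d v\<^sub>0 = 1\<close> and \<open>d v\<^sub>i = 0\<close> otherwise. The standard
  monomials for a monomial order form a basis and a simplicial complex, and applying \<open>d\<close> to a relation shows
  that this complex is a cone with apex \<open>0\<close> (\<open>standard_complex_apex\<close>). Its f-vector counts the basis elements of
  \<open>\<bbbF>\<close>. These numbers are the Betti numbers, because a minimal resolution is a retract, modulo the variables,
  of every other resolution (\<open>quotient_dim_tor\<close>).

  Conversely, let \<open>\<Delta>\<close> be a cone with apex \<open>p\<close>. The vertices are labelled by squarefree monomials such that
  the label of \<open>p\<close> divides the least common multiple of the labels of a set of other vertices exactly if this set is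
  not a face. The simplicial resolution supported on \<open>\<Delta>\<close> is then a minimal resolution of the ideal of the
  labels. Its product is induced by the exterior algebra on the vertices with the simplicial boundary, that is,
  by the Taylor resolution. The automorphism \<open>e\<^sub>i \<mapsto> e\<^sub>i + e\<^sub>p\<close> for the vertices \<open>i \<noteq> p\<close>
  carries the simplicial boundary to the contraction with \<open>p\<close>, which preserves the ideal of nonfaces of the
  cone. So the preimage of that ideal is a differential ideal, and the functions on the faces represent
  the quotient (\<open>boundary_normal_form\<close>, \<open>star_assoc\<close>). The choice of the labels is exactly what makes the
  product compatible with the degrees (\<open>admissible_normal_form\<close>). Exactness holds because in every degree
  that occurs, multiplication by \<open>e\<^sub>i\<close>, for a vertex \<open>i\<close> whose label divides that degree, is a
  contracting homotopy (\<open>boundary_exact\<close>).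
\<close>

section \<open>Polynomials, free modules and linear maps\<close>

abbreviation "single \<equiv> Poly_Mapping.single"
abbreviation "keys \<equiv> Poly_Mapping.keys"
abbreviation "lookup \<equiv> poly_mapping.lookup"

lemma poly_mapping_sum_singles:
  "finite A \<Longrightarrow> keys v \<subseteq> A \<Longrightarrow>
    v = (\<Sum>b\<in>A. single b (lookup v b))"
  by (rule poly_mapping_eqI)
    (auto simp: lookup_sum lookup_single when_def in_keys_iff cong: if_cong)

lemma poly_mapping_add_induct [case_names zero add]:
  fixes v :: "'a \<Rightarrow>\<^sub>0 'b::comm_monoid_add"
  assumes "P 0" "\<And>b p v. P v \<Longrightarrow> P (single b p + v)"
  shows "P v"
proof -
  have "P (\<Sum>b\<in>A. single b (lookup v b))" if "finite A" for A
    using that by (induction A rule: finite_induct) (auto simp: assms)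
  from this[OF finite_keys[of v]] show ?thesis
    by (simp flip: poly_mapping_sum_singles)
qed

lemma lookup_single_times_add:
  fixes p :: "(nat \<Rightarrow>\<^sub>0 nat) \<Rightarrow>\<^sub>0 'k::comm_semiring_1"
  shows "lookup (single m c * p) (m + k) = c * lookup p k"
  by (induction p rule: poly_mapping_add_induct)
    (auto simp: distrib_left lookup_add mult_single lookup_single when_def)

lemma lookup_single_times_zero:
  fixes p :: "(nat \<Rightarrow>\<^sub>0 nat) \<Rightarrow>\<^sub>0 'k::comm_semiring_1"
  assumes "\<And>k. l \<noteq> m + k"
  shows "lookup (single m c * p) l = 0"
proof (induction p rule: poly_mapping_add_induct)
  case (add b p v)
  moreover have "m + b \<noteq> l" using assms[of b] by metis
  ultimately show ?case
    by (simp add: distrib_left lookup_add mult_single lookup_single when_def)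
qed auto

lemma monomial_add_eq_0_iff [simp]:
  "(m::nat \<Rightarrow>\<^sub>0 nat) + k = 0 \<longleftrightarrow> m = 0 \<and> k = 0"
  by (auto simp: poly_mapping_eq_iff fun_eq_iff plus_poly_mapping.rep_eq)

text \<open>Taking constant terms is multiplicative because a product of two monomials is \<open>1\<close> only if
  both are.\<close>

lemma lookup_times_0:
  fixes p q :: "(nat \<Rightarrow>\<^sub>0 nat) \<Rightarrow>\<^sub>0 'k::comm_semiring_1"
  shows "lookup (p * q) 0 = lookup p 0 * lookup q 0"
proof (induction p rule: poly_mapping_add_induct)
  case (add b c p)
  have "lookup (single b c * q) 0 =
      lookup (single b c) 0 * lookup q 0"
  proof (cases "b = 0")
    case True
    then show ?thesis using lookup_single_times_add[of 0 c q 0] by simp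
  next
    case False
    then show ?thesis by (subst lookup_single_times_zero) (auto simp: lookup_single)
  qed
  with add show ?case by (simp add: distrib_right lookup_add)
qed auto

subsection \<open>The subring \<open>polyring n\<close>\<close>

lemma polyring_0 [simp]: "0 \<in> polyring n"
  and polyring_1 [simp]: "(1 :: 'k::field mpoly) \<in> polyring n"
  by (auto simp: polyring_def)

lemma polyring_single [simp]: "keys m \<subseteq> {..<n} \<Longrightarrow> single m c \<in> polyring n"
  by (auto simp: polyring_def)

lemma polyring_add [simp]:
  fixes p q :: "'k::field mpoly"
  assumes "p \<in> polyring n" "q \<in> polyring n" shows "p + q \<in> polyring n"
  using assms keys_add[of p q] unfolding polyring_def by blast

lemma polyring_uminus [simp]: "(p :: 'k::field mpoly) \<in> polyring n \<Longrightarrow> - p \<in> polyring n"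
  unfolding polyring_def by simp

lemma keys_monomial_add:
  "keys ((m::nat \<Rightarrow>\<^sub>0 nat) + k) = keys m \<union> keys k"
  by (auto simp: in_keys_iff lookup_add)

lemma polyring_mult [simp]:
  fixes p q :: "'k::field mpoly"
  assumes "p \<in> polyring n" "q \<in> polyring n" shows "p * q \<in> polyring n"
  using assms keys_mult[of p q] unfolding polyring_def by (fastforce simp: keys_monomial_add)

lemma polyring_sum [simp]:
  fixes p :: "'a \<Rightarrow> 'k::field mpoly"
  shows "(\<And>x. x \<in> A \<Longrightarrow> p x \<in> polyring n) \<Longrightarrow> sum p A \<in> polyring n"
  by (induction A rule: infinite_finite_induct) auto

lemma polyring_neg_one_power [simp]: "(- 1 :: 'k::field mpoly) ^ i \<in> polyring n"
  by (induction i) auto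

lemma single_0_power:
  "single (0 :: nat \<Rightarrow>\<^sub>0 nat) ((c::'k::comm_ring_1) ^ i) = single 0 c ^ i"
  by (induction i) (simp_all, metis add_0 mult_single)

lemma neg_one_power_eq_single:
  "(- 1 :: 'k::field mpoly) ^ i = single 0 ((- 1) ^ i)"
  by (simp add: single_0_power single_uminus)

subsection \<open>Scalar multiplication\<close>

lemma lookup_smult [simp]: "lookup (smult p v) b = p * lookup v b"
  by (auto simp: smult_def map.rep_eq when_def)

lemma smult_add_right: "smult p (v + w) = smult p v + smult p w"
  and smult_add_left: "smult (p + q) v = smult p v + smult q v"
  and smult_diff_right: "smult p (v - w) = smult p v - smult p w"
  by (auto intro!: poly_mapping_eqI simp: lookup_add lookup_minus algebra_simps)

lemma smult_smult: "smult p (smult q v) = smult (p * q) v"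
  by (auto intro!: poly_mapping_eqI simp: algebra_simps)

lemma smult_simps [simp]: "smult 0 v = 0" "smult p 0 = 0" "smult 1 v = v"
  by (auto intro!: poly_mapping_eqI)

lemma smult_single [simp]:
  "smult p (single b q) = single b (p * q)"
  by (auto intro!: poly_mapping_eqI simp: lookup_single when_def)

lemma smult_sum: "smult p (sum g A) = (\<Sum>a\<in>A. smult p (g a))"
  by (induction A rule: infinite_finite_induct) (auto simp: smult_add_right)

lemma keys_smult: "keys (smult p v) \<subseteq> keys v"
  by (auto simp: in_keys_iff)

definition scale :: "'k::field \<Rightarrow> ('b \<Rightarrow>\<^sub>0 'k) \<Rightarrow> ('b \<Rightarrow>\<^sub>0 'k)" where
  "scale c v = Poly_Mapping.map (\<lambda>t. c * t) v"

lemma lookup_scale [simp]: "lookup (scale c v) b = c * lookup v b"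
  by (auto simp: scale_def map.rep_eq when_def)

lemma vector_space_scale: "vector_space scale"
  by standard (auto intro!: poly_mapping_eqI simp: lookup_add algebra_simps)

interpretation PM: vector_space "scale :: 'k::field \<Rightarrow> ('b \<Rightarrow>\<^sub>0 'k) \<Rightarrow> ('b \<Rightarrow>\<^sub>0 'k)"
  by (rule vector_space_scale)

lemma scale_single [simp]: "scale c (single b t) = single b (c * t)"
  by (auto intro!: poly_mapping_eqI simp: lookup_single when_def)

subsection \<open>Elements and components of a complex of free modules\<close>

lemma elems_0 [simp]: "0 \<in> elems n F"
  by (auto simp: elems_def)

lemma elems_single [simp]: "b \<in> basis F \<Longrightarrow> p \<in> polyring n \<Longrightarrow> single b p \<in> elems n F"
  by (auto simp: elems_def lookup_single when_def)

lemma elems_add [simp]: "v \<in> elems n F \<Longrightarrow> w \<in> elems n F \<Longrightarrow> v + w \<in> elems n F"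
  using keys_add[of v w] unfolding elems_def by (auto simp: lookup_add)

lemma elems_smult [simp]: "p \<in> polyring n \<Longrightarrow> v \<in> elems n F \<Longrightarrow> smult p v \<in> elems n F"
  using keys_smult[of p v] unfolding elems_def by auto

lemma elems_uminus [simp]: "v \<in> elems n F \<Longrightarrow> - v \<in> elems n F"
  unfolding elems_def by auto

lemma elems_diff [simp]: "v \<in> elems n F \<Longrightarrow> w \<in> elems n F \<Longrightarrow> v - w \<in> elems n F"
  using elems_add[of v n F "- w"] by simp

lemma elems_sum [simp]: "(\<And>x. x \<in> A \<Longrightarrow> g x \<in> elems n F) \<Longrightarrow> sum g A \<in> elems n F"
  by (induction A rule: infinite_finite_induct) auto

lemma elems_lookup: "v \<in> elems n F \<Longrightarrow> lookup v b \<in> polyring n"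
  by (auto simp: elems_def)

lemma elems_keys: "v \<in> elems n F \<Longrightarrow> b \<in> keys v \<Longrightarrow> b \<in> basis F"
  by (auto simp: elems_def)

lemma component_elems: "v \<in> component n F i \<Longrightarrow> v \<in> elems n F"
  by (auto simp: component_def)

lemma component_keys:
  "v \<in> component n F i \<Longrightarrow> b \<in> keys v \<Longrightarrow> b \<in> basis F \<and> hdeg F b = i"
  by (auto simp: component_def elems_def)

lemma component_iff:
  "v \<in> component n F i \<longleftrightarrow>
    (\<forall>b\<in>keys v. b \<in> basis F \<and> hdeg F b = i) \<and> (\<forall>b. lookup v b \<in> polyring n)"
  unfolding component_def elems_def subset_iff mem_Collect_eq by blast

lemma component_0 [simp]: "0 \<in> component n F i"
  by (auto simp: component_def)

lemma component_single [simp]: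
  "b \<in> basis F \<Longrightarrow> hdeg F b = i \<Longrightarrow> p \<in> polyring n \<Longrightarrow> single b p \<in> component n F i"
  by (auto simp: component_def split: if_splits)

lemma component_add [simp]:
  "v \<in> component n F i \<Longrightarrow> w \<in> component n F i \<Longrightarrow> v + w \<in> component n F i"
  using keys_add[of v w] unfolding component_def by auto

lemma component_smult [simp]:
  "p \<in> polyring n \<Longrightarrow> v \<in> component n F i \<Longrightarrow> smult p v \<in> component n F i"
  using keys_smult[of p v] unfolding component_def by auto

lemma component_uminus [simp]: "v \<in> component n F i \<Longrightarrow> - v \<in> component n F i"
  unfolding component_def by auto

lemma component_diff [simp]:
  "v \<in> component n F i \<Longrightarrow> w \<in> component n F i \<Longrightarrow> v - w \<in> component n F i"
  using component_add[of v n F i "- w"] by simp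

lemma component_sum [simp]:
  "(\<And>x. x \<in> A \<Longrightarrow> g x \<in> component n F i) \<Longrightarrow> sum g A \<in> component n F i"
  by (induction A rule: infinite_finite_induct) auto

lemma free_expansion:
  "v = (\<Sum>b\<in>keys v. smult (lookup v b) (single b 1))"
  by (simp flip: poly_mapping_sum_singles)

subsection \<open>Linear maps\<close>

definition linear_on :: "nat \<Rightarrow> ('b, 'k::field) fvec set \<Rightarrow> (('b, 'k) fvec \<Rightarrow> ('c, 'k) fvec) \<Rightarrow> bool" where
  "linear_on n M L \<longleftrightarrow> (\<forall>v\<in>M. \<forall>w\<in>M. L (v + w) = L v + L w) \<and>
    (\<forall>p\<in>polyring n. \<forall>v\<in>M. L (smult p v) = smult p (L v))"

lemma linear_bdry_iff: "linear_bdry n F \<longleftrightarrow> linear_on n (elems n F) (bdry F)"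
  by (simp only: linear_bdry_def linear_on_def)

lemma linear_on_add: "linear_on n M L \<Longrightarrow> v \<in> M \<Longrightarrow> w \<in> M \<Longrightarrow> L (v + w) = L v + L w"
  and linear_on_smult: "linear_on n M L \<Longrightarrow> p \<in> polyring n \<Longrightarrow> v \<in> M \<Longrightarrow> L (smult p v) = smult p (L v)"
  unfolding linear_on_def by blast+

lemma linear_on_0:
  assumes "linear_on n M L" "0 \<in> M" shows "L 0 = 0"
proof -
  have "L (0 + 0) = L 0 + L 0" by (rule linear_on_add[OF assms assms(2)])
  then have "L 0 + 0 = L 0 + L 0" by (simp only: add_0_right)
  then show ?thesis by (metis add_left_cancel)
qed

lemma linear_on_elems_diff:
  assumes "linear_on n (elems n F) L" "v \<in> elems n F" "w \<in> elems n F"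
  shows "L (v - w) = L v - L w"
  using linear_on_add[OF assms(1), of "v - w" w] assms by simp

lemma linear_on_elems_sum:
  assumes "linear_on n (elems n F) L" "\<And>x. x \<in> A \<Longrightarrow> g x \<in> elems n F"
  shows "L (sum g A) = (\<Sum>x\<in>A. L (g x))"
  using assms(2)
proof (induction A rule: infinite_finite_induct)
  case (insert x A)
  then have "L (g x + sum g A) = L (g x) + L (sum g A)"
    by (intro linear_on_add[OF assms(1)] elems_sum) auto
  with insert show ?case by simp
qed (auto simp: linear_on_0[OF assms(1)])

lemma linear_on_expansion:
  assumes L: "linear_on n (elems n F) L" and v: "v \<in> elems n F"
  shows "L v = (\<Sum>b\<in>keys v. smult (lookup v b) (L (single b 1)))"
proof -
  have e: "single b 1 \<in> elems n F" if "b \<in> keys v" for b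
    using elems_keys[OF v that] by simp
  have "L v = L (\<Sum>b\<in>keys v. smult (lookup v b) (single b 1))"
    by (simp only: free_expansion[symmetric])
  also have "\<dots> = (\<Sum>b\<in>keys v. L (smult (lookup v b) (single b 1)))"
    using v e by (intro linear_on_elems_sum[OF L] elems_smult elems_lookup[OF v])
  also have "\<dots> = (\<Sum>b\<in>keys v. smult (lookup v b) (L (single b 1)))"
    using v e by (intro sum.cong refl linear_on_smult[OF L] elems_lookup[OF v])
  finally show ?thesis .
qed

definition free_ext :: "('b \<Rightarrow> ('c, 'k::field) fvec) \<Rightarrow> ('b, 'k) fvec \<Rightarrow> ('c, 'k) fvec" where
  "free_ext \<phi> v = (\<Sum>b\<in>keys v. smult (lookup v b) (\<phi> b))"

lemma free_ext_superset:
  "finite A \<Longrightarrow> keys v \<subseteq> A \<Longrightarrow> free_ext \<phi> v = (\<Sum>b\<in>A. smult (lookup v b) (\<phi> b))"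
  unfolding free_ext_def by (rule sum.mono_neutral_left) (auto simp: in_keys_iff)

lemma free_ext_add: "free_ext \<phi> (v + w) = free_ext \<phi> v + free_ext \<phi> w"
proof -
  let ?A = "keys v \<union> keys w"
  have "free_ext \<phi> (v + w) = (\<Sum>b\<in>?A. smult (lookup (v + w) b) (\<phi> b))"
    by (rule free_ext_superset) (simp_all add: keys_add)
  also have "\<dots> = free_ext \<phi> v + free_ext \<phi> w"
    by (subst (1 2) free_ext_superset[of ?A]) (auto simp: lookup_add smult_add_left sum.distrib)
  finally show ?thesis .
qed

lemma free_ext_smult: "free_ext \<phi> (smult p v) = smult p (free_ext \<phi> v)"
  by (subst free_ext_superset[of "keys v"])
    (auto simp: keys_smult free_ext_def smult_sum smult_smult)

lemma linear_on_free_ext: "linear_on n M (free_ext \<phi>)"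
  by (auto simp: linear_on_def free_ext_add free_ext_smult)

lemma free_ext_single [simp]: "free_ext \<phi> (single b p) = smult p (\<phi> b)"
  by (auto simp: free_ext_def)

lemma free_ext_0 [simp]: "free_ext \<phi> 0 = 0"
  by (simp add: free_ext_def)

lemma free_ext_cong:
  "(\<And>b. b \<in> keys v \<Longrightarrow> \<phi> b = \<psi> b) \<Longrightarrow> free_ext \<phi> v = free_ext \<psi> v"
  by (auto simp: free_ext_def)

lemma linear_on_compose:
  assumes "linear_on n (elems n F) L" "linear_on n (elems n G) K"
    "\<And>v. v \<in> elems n F \<Longrightarrow> L v \<in> elems n G"
  shows "linear_on n (elems n F) (\<lambda>v. K (L v))"
  using assms by (auto simp: linear_on_def)

lemma linear_on_lincomb:
  assumes "linear_on n M L" "linear_on n M K"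
  shows "linear_on n M (\<lambda>v. L v - K v)" "linear_on n M (\<lambda>v. L v + K v)"
  using assms by (auto simp: linear_on_def smult_diff_right smult_add_right)

lemma linear_on_eq_component:
  assumes L: "linear_on n (elems n F) L" and K: "linear_on n (elems n F) K"
    and v: "v \<in> component n F i"
    and eq: "\<And>b. b \<in> basis F \<Longrightarrow> hdeg F b = i \<Longrightarrow> L (single b 1) = K (single b 1)"
  shows "L v = K v"
  unfolding linear_on_expansion[OF L component_elems[OF v]] linear_on_expansion[OF K component_elems[OF v]]
  using component_keys[OF v] eq by (intro sum.cong) auto

lemma free_ext_component:
  assumes "v \<in> component n F i"
    and "\<And>b. b \<in> basis F \<Longrightarrow> hdeg F b = i \<Longrightarrow> \<phi> b \<in> component n G j"
  shows "free_ext \<phi> v \<in> component n G j"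
  unfolding free_ext_def using component_keys[OF assms(1)] assms
  by (intro component_sum component_smult elems_lookup[OF component_elems]) auto

lemma free_ext_elems:
  assumes "v \<in> elems n F" "\<And>b. b \<in> basis F \<Longrightarrow> \<phi> b \<in> elems n G"
  shows "free_ext \<phi> v \<in> elems n G"
  unfolding free_ext_def using elems_keys[OF assms(1)] assms
  by (intro elems_sum elems_smult elems_lookup) auto

section \<open>Comparison of free resolutions\<close>

context
  fixes n I and F :: "('b, 'k::field, 'z) free_complex_scheme"
  assumes res: "free_resolution n I F"
begin

lemma resolution_linear: "linear_on n (elems n F) (bdry F)"
  using res by (simp add: free_resolution_def linear_bdry_iff)

lemma resolution_degree_0: "b \<in> basis F \<and> hdeg F b = 0 \<longleftrightarrow> b = gen0 F"
proof -
  from res have "{b \<in> basis F. hdeg F b = 0} = {gen0 F}"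
    unfolding free_resolution_def by (elim conjE)
  from arg_cong[OF this, of "\<lambda>A. b \<in> A"] show ?thesis by simp
qed

lemma resolution_gen0: "gen0 F \<in> basis F" "hdeg F (gen0 F) = 0"
  using resolution_degree_0 by blast+

lemma resolution_bdry_0: "v \<in> component n F 0 \<Longrightarrow> bdry F v = 0"
proof -
  from res have "\<forall>v\<in>component n F 0. bdry F v = 0"
    unfolding free_resolution_def by (elim conjE)
  then show "v \<in> component n F 0 \<Longrightarrow> bdry F v = 0" by blast
qed

lemma resolution_bdry_component: "v \<in> component n F (Suc i) \<Longrightarrow> bdry F v \<in> component n F i"
proof -
  from res have "\<forall>i. \<forall>v\<in>component n F (Suc i). bdry F v \<in> component n F i"
    unfolding free_resolution_def by (elim conjE)
  then show "v \<in> component n F (Suc i) \<Longrightarrow> bdry F v \<in> component n F i" by blast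
qed

lemma resolution_cycles:
  "{v \<in> component n F (Suc i). bdry F v = 0} = bdry F ` component n F (Suc (Suc i))"
proof -
  from res have "\<forall>i. {v \<in> component n F (Suc i). bdry F v = 0} = bdry F ` component n F (Suc (Suc i))"
    unfolding free_resolution_def by (elim conjE)
  then show ?thesis by (rule spec)
qed

lemma resolution_exact:
  "v \<in> component n F (Suc i) \<Longrightarrow> bdry F v = 0 \<Longrightarrow> \<exists>w\<in>component n F (Suc (Suc i)). bdry F w = v"
  using resolution_cycles[of i] by (metis (mono_tags, lifting) imageE mem_Collect_eq)

lemma resolution_image: "bdry F ` component n F 1 = single (gen0 F) ` I"
  using res unfolding free_resolution_def by (elim conjE)

lemma resolution_bdry_zero: "bdry F 0 = 0"
  by (rule resolution_bdry_0) simp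

lemma resolution_bdry_component': "v \<in> component n F i \<Longrightarrow> bdry F v \<in> component n F (i - 1)"
  by (cases i) (simp_all add: resolution_bdry_0 resolution_bdry_component)

lemma resolution_bdry_elems:
  assumes v: "v \<in> elems n F" shows "bdry F v \<in> elems n F"
proof -
  have "bdry F (single b 1) \<in> elems n F" if "b \<in> keys v" for b
    by (rule component_elems, rule resolution_bdry_component'[of _ "hdeg F b"])
      (simp add: elems_keys[OF v that])
  then show ?thesis
    unfolding linear_on_expansion[OF resolution_linear v]
    by (intro elems_sum elems_smult elems_lookup[OF v])
qed

lemma resolution_bdry_bdry:
  assumes v: "v \<in> component n F i" shows "bdry F (bdry F v) = 0"
proof -
  consider "i = 0" | "i = 1" | j where "i = Suc (Suc j)"
    by (metis One_nat_def old.nat.exhaust)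
  then show ?thesis
  proof cases
    case 1
    with v show ?thesis by (metis resolution_bdry_0 resolution_bdry_zero)
  next
    case 2
    then show ?thesis using v resolution_bdry_0 resolution_bdry_component by (metis One_nat_def)
  next
    case 3
    with v show ?thesis
      using resolution_cycles[of j] by (metis (mono_tags, lifting) image_eqI mem_Collect_eq)
  qed
qed

end

text \<open>Maps constructed by recursion on the degree satisfy their equation in one degree at a time; the linear
  extension of \<open>h\<close> to a component sees only the values of \<open>h\<close> in that degree.\<close>

lemma bdry_free_ext:
  fixes F :: "('b, 'k::field, 'z) free_complex_scheme" and G :: "('c, 'k, 'y) free_complex_scheme"
  assumes G: "free_resolution n J G" and K: "linear_on n (elems n F) K" and v: "v \<in> component n F i"
    and h: "\<And>b. b \<in> basis F \<Longrightarrow> hdeg F b = i \<Longrightarrow>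
      h b \<in> elems n G \<and> bdry G (h b) = K (single b 1)"
  shows "bdry G (free_ext h v) = K v"
proof -
  define g where "g b = (if b \<in> basis F \<and> hdeg F b = i then h b else 0)" for b
  have g: "free_ext g w \<in> elems n G" if "w \<in> elems n F" for w
    using that h by (intro free_ext_elems[OF that]) (auto simp: g_def)
  have "bdry G (free_ext g v) = K v"
    by (rule linear_on_eq_component[OF linear_on_compose[OF linear_on_free_ext resolution_linear[OF G] g] K v])
      (use h in \<open>auto simp: g_def\<close>)
  moreover have "free_ext g v = free_ext h v"
    by (rule free_ext_cong) (use component_keys[OF v] in \<open>auto simp: g_def\<close>)
  ultimately show ?thesis by simp
qed

lemma linear_on_free_ext_bdry:
  assumes "free_resolution n I F"
  shows "linear_on n (elems n F) (\<lambda>v. free_ext h (bdry F v))"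
  using linear_on_compose[OF resolution_linear[OF assms] linear_on_free_ext resolution_bdry_elems[OF assms]] .

text \<open>The usual comparison map, built degree by degree. The images of the basis elements of degree
  \<open>i\<close> are the values of the \<open>i\<close>-th of a sequence of functions defined by recursion.\<close>

lemma comparison_map_exists:
  fixes F :: "('b, 'k::field, 'z) free_complex_scheme" and G :: "('c, 'k, 'y) free_complex_scheme"
  assumes F: "free_resolution n I F" and G: "free_resolution n I G"
  obtains \<phi> where "\<And>b. b \<in> basis F \<Longrightarrow> \<phi> b \<in> component n G (hdeg F b)"
    "\<phi> (gen0 F) = single (gen0 G) 1"
    "\<And>i v. v \<in> component n F i \<Longrightarrow> bdry G (free_ext \<phi> v) = free_ext \<phi> (bdry F v)"
proof -
  define \<Phi> where "\<Phi> = rec_nat (\<lambda>b. single (gen0 G) (1 :: 'k mpoly))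
    (\<lambda>i \<phi> b. SOME w. w \<in> component n G (Suc i) \<and> bdry G w = free_ext \<phi> (bdry F (single b 1)))"
  have \<Phi>0: "\<Phi> 0 = (\<lambda>b. single (gen0 G) 1)"
    and \<Phi>S: "\<Phi> (Suc i) b = (SOME w. w \<in> component n G (Suc i) \<and>
        bdry G w = free_ext (\<Phi> i) (bdry F (single b 1)))" for i b
    by (simp_all add: \<Phi>_def)
  have step: "\<Phi> i b \<in> component n G i \<and>
      bdry G (\<Phi> i b) = free_ext (\<Phi> (i - 1)) (bdry F (single b 1))"
    if "b \<in> basis F" "hdeg F b = i" for i b
    using that
  proof (induction i arbitrary: b)
    case 0
    then show ?case
      using resolution_gen0[OF G] by (simp add: \<Phi>0 resolution_bdry_0[OF F] resolution_bdry_0[OF G])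
  next
    case (Suc i)
    let ?w = "bdry F (single b 1)"
    have e: "single b 1 \<in> component n F (Suc i)" using Suc.prems by simp
    have w: "?w \<in> component n F i" by (rule resolution_bdry_component[OF F e])
    have "free_ext (\<Phi> i) ?w \<in> bdry G ` component n G (Suc i)"
    proof (cases i)
      case 0
      have "?w \<in> bdry F ` component n F 1" using e 0 by auto
      then obtain p where p: "p \<in> I" "?w = single (gen0 F) p"
        using resolution_image[OF F] by auto
      then have "free_ext (\<Phi> i) ?w = single (gen0 G) p" by (simp add: 0 \<Phi>0)
      with p resolution_image[OF G] 0 show ?thesis by auto
    next
      case (Suc j)
      have c: "free_ext (\<Phi> i) ?w \<in> component n G i"
        by (rule free_ext_component[OF w]) (use Suc.IH in blast)
      have "bdry G (free_ext (\<Phi> i) ?w) = free_ext (\<Phi> (i - 1)) (bdry F ?w)"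
        by (rule bdry_free_ext[OF G linear_on_free_ext_bdry[OF F] w])
          (use Suc.IH in \<open>blast intro: component_elems\<close>)
      then have "bdry G (free_ext (\<Phi> i) ?w) = 0"
        using resolution_bdry_bdry[OF F e] by simp
      with c Suc resolution_exact[OF G, of "free_ext (\<Phi> i) ?w" j] show ?thesis by force
    qed
    then have "\<exists>w. w \<in> component n G (Suc i) \<and> bdry G w = free_ext (\<Phi> i) ?w" by auto
    from someI_ex[OF this] show ?case by (simp add: \<Phi>S)
  qed
  define \<phi> where "\<phi> b = \<Phi> (hdeg F b) b" for b
  have \<phi>: "free_ext \<phi> v = free_ext (\<Phi> i) v" if "v \<in> component n F i" for v i
    by (rule free_ext_cong) (use component_keys[OF that] in \<open>auto simp: \<phi>_def\<close>)
  have \<phi>c: "\<phi> b \<in> component n G (hdeg F b)" if "b \<in> basis F" for b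
    using step[OF that refl] by (simp add: \<phi>_def)
  have "bdry G (free_ext \<phi> v) = free_ext \<phi> (bdry F v)" if v: "v \<in> component n F i" for v i
  proof -
    have "bdry G (free_ext (\<Phi> i) v) = free_ext (\<Phi> (i - 1)) (bdry F v)"
      by (rule bdry_free_ext[OF G linear_on_free_ext_bdry[OF F] v])
        (use step in \<open>blast intro: component_elems\<close>)
    then show ?thesis
      using \<phi>[OF v] \<phi>[OF resolution_bdry_component'[OF F v]] by simp
  qed
  moreover have "\<phi> (gen0 F) = single (gen0 G) 1"
    by (simp add: \<phi>_def resolution_gen0[OF F] \<Phi>0)
  ultimately show ?thesis using \<phi>c that by blast
qed

text \<open>The homotopy \<open>\<eta>\<close> is built degree by degree: by the equation one degree lower, \<open>u b - \<eta> (\<partial> b)\<close> is a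
  cycle, and \<open>\<eta> b\<close> is an element that it bounds.\<close>

lemma null_homotopy_exists:
  fixes F :: "('b, 'k::field, 'z) free_complex_scheme" and G :: "('c, 'k, 'y) free_complex_scheme"
  assumes F: "free_resolution n I F" and G: "free_resolution n J G"
    and u: "linear_on n (elems n F) u"
    and uc: "\<And>i v. v \<in> component n F i \<Longrightarrow> u v \<in> component n G i"
    and ub: "\<And>i v. v \<in> component n F i \<Longrightarrow> bdry G (u v) = u (bdry F v)"
    and u0: "\<And>v. v \<in> component n F 0 \<Longrightarrow> u v = 0"
  obtains \<eta> where "\<And>b. b \<in> basis F \<Longrightarrow> \<eta> b \<in> component n G (Suc (hdeg F b))"
    "\<And>i v. v \<in> component n F i \<Longrightarrow> u v = bdry G (free_ext \<eta> v) + free_ext \<eta> (bdry F v)"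
proof -
  define H where "H = rec_nat (\<lambda>b. 0)
    (\<lambda>i h b. SOME w. w \<in> component n G (Suc (Suc i)) \<and>
      bdry G w = u (single b 1) - free_ext h (bdry F (single b 1)))"
  have H0: "H 0 = (\<lambda>b. 0)"
    and HS: "H (Suc i) b = (SOME w. w \<in> component n G (Suc (Suc i)) \<and>
      bdry G w = u (single b 1) - free_ext (H i) (bdry F (single b 1)))" for i b
    by (simp_all add: H_def)
  have lin: "linear_on n (elems n F) (\<lambda>v. u v - free_ext h (bdry F v))" for h :: "'b \<Rightarrow> ('c, 'k) fvec"
    by (intro linear_on_lincomb u linear_on_free_ext_bdry[OF F])
  have step: "H i b \<in> component n G (Suc i) \<and>
      bdry G (H i b) = u (single b 1) - free_ext (H (i - 1)) (bdry F (single b 1))"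
    if "b \<in> basis F" "hdeg F b = i" for i b
    using that
  proof (induction i arbitrary: b)
    case 0
    then show ?case
      by (simp add: H0 resolution_bdry_0[OF F] resolution_bdry_zero[OF G] u0)
  next
    case (Suc i)
    let ?e = "single b (1 :: 'k mpoly)"
    let ?w = "bdry F ?e"
    have e: "?e \<in> component n F (Suc i)" using Suc.prems by simp
    have w: "?w \<in> component n F i" by (rule resolution_bdry_component[OF F e])
    have c: "free_ext (H i) ?w \<in> component n G (Suc i)"
      by (rule free_ext_component[OF w]) (use Suc.IH in blast)
    have "bdry G (free_ext (H i) ?w) = u ?w - free_ext (H (i - 1)) (bdry F ?w)"
      by (rule bdry_free_ext[OF G lin w]) (use Suc.IH in \<open>blast intro: component_elems\<close>)
    then have "bdry G (u ?e - free_ext (H i) ?w) = 0"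
      using linear_on_elems_diff[OF resolution_linear[OF G] component_elems[OF uc[OF e]] component_elems[OF c]]
        ub[OF e] resolution_bdry_bdry[OF F e] by simp
    then have "\<exists>y. y \<in> component n G (Suc (Suc i)) \<and> bdry G y = u ?e - free_ext (H i) ?w"
      using resolution_exact[OF G component_diff[OF uc[OF e] c]] by blast
    from someI_ex[OF this] show ?case by (simp add: HS)
  qed
  define \<eta> where "\<eta> b = H (hdeg F b) b" for b
  have \<eta>: "free_ext \<eta> v = free_ext (H i) v" if "v \<in> component n F i" for v i
    by (rule free_ext_cong) (use component_keys[OF that] in \<open>auto simp: \<eta>_def\<close>)
  show ?thesis
  proof
    show "\<eta> b \<in> component n G (Suc (hdeg F b))" if "b \<in> basis F" for b
      using step[OF that refl] by (simp add: \<eta>_def)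
    show "u v = bdry G (free_ext \<eta> v) + free_ext \<eta> (bdry F v)" if v: "v \<in> component n F i" for v i
    proof -
      have "bdry G (free_ext (H i) v) = u v - free_ext (H (i - 1)) (bdry F v)"
        by (rule bdry_free_ext[OF G lin v]) (use step in \<open>blast intro: component_elems\<close>)
      then show ?thesis
        using \<eta>[OF v] \<eta>[OF resolution_bdry_component'[OF F v]] by simp
    qed
  qed
qed

section \<open>Tor from a minimal resolution\<close>

text \<open>\<open>reduce\<close> is the projection \<open>\<bbbF> \<longrightarrow> \<bbbF> \<otimes> \<Bbbk>\<close>, and \<open>lift_const\<close> is a section of it.\<close>

definition reduce :: "('b, 'k::field) fvec \<Rightarrow> ('b \<Rightarrow>\<^sub>0 'k)" where
  "reduce v = Poly_Mapping.map (\<lambda>p. lookup p 0) v"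

definition lift_const :: "('b \<Rightarrow>\<^sub>0 'k::field) \<Rightarrow> ('b, 'k) fvec" where
  "lift_const x = Poly_Mapping.map (single 0) x"

lemma lookup_reduce [simp]:
  "lookup (reduce v) b = lookup (lookup v b) 0"
  by (auto simp: reduce_def map.rep_eq when_def)

lemma lookup_lift_const [simp]:
  "lookup (lift_const x) b = single 0 (lookup x b)"
  by (auto simp: lift_const_def map.rep_eq when_def)

lemma tensor_bdry_eq: "tensor_bdry F x = reduce (bdry F (lift_const x))"
  by (simp add: tensor_bdry_def reduce_def lift_const_def)

lemma reduce_lift_const [simp]: "reduce (lift_const x) = x"
  by (rule poly_mapping_eqI) simp

lemma reduce_add: "reduce (v + w) = reduce v + reduce w"
  and reduce_diff: "reduce (v - w) = reduce v - reduce w"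
  and reduce_smult: "reduce (smult p v) = scale (lookup p 0) (reduce v)"
  by (auto intro!: poly_mapping_eqI simp: lookup_add lookup_minus lookup_times_0)

lemma reduce_0 [simp]: "reduce 0 = 0"
  by (rule poly_mapping_eqI) simp

lemma reduce_single [simp]: "reduce (single b p) = single b (lookup p 0)"
  by (auto intro!: poly_mapping_eqI simp: lookup_single when_def)

lemma reduce_sum: "reduce (sum g A) = (\<Sum>a\<in>A. reduce (g a))"
  by (induction A rule: infinite_finite_induct) (auto simp: reduce_add)

lemma lift_const_add: "lift_const (x + y) = lift_const x + lift_const y"
  and lift_const_scale: "lift_const (scale c x) = smult (single 0 c) (lift_const x)"
  by (auto intro!: poly_mapping_eqI simp: lookup_add single_add mult_single)

lemma keys_lift_const [simp]: "keys (lift_const x) = keys x"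
  by (auto simp: in_keys_iff) (metis lookup_single_eq lookup_zero)

lemma keys_reduce: "keys (reduce v) \<subseteq> keys v"
  by (auto simp: in_keys_iff)

lemma lift_const_component: "x \<in> tensor_component F i \<Longrightarrow> lift_const x \<in> component n F i"
  by (auto simp: tensor_component_def component_iff)

lemma reduce_component:
  assumes "v \<in> component n F i" shows "reduce v \<in> tensor_component F i"
  using keys_reduce[of v] component_keys[OF assms] by (auto simp: tensor_component_def)

lemma reduce_linear:
  assumes L: "linear_on n (elems n F) L" and v: "v \<in> elems n F"
  shows "reduce (L v) = (\<Sum>b\<in>keys v.
    scale (lookup (lookup v b) 0) (reduce (L (single b 1))))"
  by (subst linear_on_expansion[OF L v]) (simp add: reduce_sum reduce_smult)

text \<open>A linear map preserves \<open>\<mm>\<bbbF>\<close>, so it is well defined modulo the variables.\<close>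

lemma reduce_linear_cong:
  assumes L: "linear_on n (elems n F) L" and v: "v \<in> elems n F" and w: "w \<in> elems n F"
    and eq: "reduce v = reduce w"
  shows "reduce (L v) = reduce (L w)"
proof -
  have "reduce (v - w) = 0" using eq by (simp add: reduce_diff)
  then have "lookup (lookup (v - w) b) 0 = 0" for b
    by (metis lookup_reduce lookup_zero)
  then have "reduce (L (v - w)) = 0"
    using v w by (simp add: reduce_linear[OF L])
  then show ?thesis
    using linear_on_elems_diff[OF L v w] by (simp add: reduce_diff)
qed

lemma reduce_linear_eq_0:
  assumes L: "linear_on n (elems n F) L" and v: "v \<in> elems n F" and eq: "reduce v = 0"
  shows "reduce (L v) = 0"
  using reduce_linear_cong[OF L v elems_0] eq by (simp add: linear_on_0[OF L])

lemma ex1_implies_eq: "\<exists>!x. P x \<Longrightarrow> P x \<Longrightarrow> P y \<Longrightarrow> x = y"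
  by blast

text \<open>The coordinate vectors of the elements of \<open>Y\<close> with respect to \<open>X\<close> are linearly independent: a relation
  between them would express \<open>0\<close> in two ways by \<open>Y\<close> modulo \<open>B\<close>.\<close>

lemma basis_modulo_card_le:
  assumes X: "basis_modulo Z B X" and Y: "basis_modulo Z B Y"
    and B: "PM.subspace B" and Z: "PM.subspace Z"
  shows "card Y \<le> card X"
proof -
  note X' = X[unfolded basis_modulo_def scale_def[symmetric]]
  note Y' = Y[unfolded basis_modulo_def scale_def[symmetric]]
  have fin: "finite X" "finite Y" and sub: "X \<subseteq> Z" "Y \<subseteq> Z"
    by (rule conjunct1[OF X'] conjunct1[OF Y'] conjunct1[OF conjunct2[OF X']] conjunct1[OF conjunct2[OF Y']])+
  have exX: "\<exists>!c. (\<forall>x. x \<notin> X \<longrightarrow> c x = 0) \<and> z - (\<Sum>x\<in>X. scale (c x) x) \<in> B" if "z \<in> Z" for z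
    using X' that by (elim conjE) (rule bspec)
  have exY: "\<exists>!c. (\<forall>x. x \<notin> Y \<longrightarrow> c x = 0) \<and> z - (\<Sum>x\<in>Y. scale (c x) x) \<in> B" if "z \<in> Z" for z
    using Y' that by (elim conjE) (rule bspec)
  define c where "c z = (SOME c. (\<forall>x. x \<notin> X \<longrightarrow> c x = 0) \<and> z - (\<Sum>x\<in>X. scale (c x) x) \<in> B)" for z
  have c: "z - (\<Sum>x\<in>X. scale (c z x) x) \<in> B" if "z \<in> Z" for z
    using someI_ex[OF ex1_implies_ex[OF exX[OF that]]] unfolding c_def[symmetric] by (rule conjunct2)
  define C where "C z = (\<Sum>x\<in>X. single x (c z x))" for z
  have C: "lookup (C z) x = c z x" if "x \<in> X" for x z
    using that fin by (simp add: C_def lookup_sum lookup_single when_def)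
  have rel: "d y = 0" if d: "(\<Sum>y\<in>Y. scale (d y) (C y)) = 0" and y: "y \<in> Y" for d y
  proof -
    define d' where "d' y = (if y \<in> Y then d y else 0)" for y
    have z: "(\<Sum>y\<in>Y. d y * c y x) = 0" if "x \<in> X" for x
      using arg_cong[OF d, of "\<lambda>v. lookup v x"] that by (simp add: lookup_sum C)
    have "(\<Sum>y\<in>Y. scale (d y) (y - (\<Sum>x\<in>X. scale (c y x) x))) \<in> B"
      using c sub by (intro PM.subspace_sum[OF B] PM.subspace_scale[OF B]) auto
    moreover have "(\<Sum>y\<in>Y. scale (d y) (\<Sum>x\<in>X. scale (c y x) x)) = 0"
    proof (rule poly_mapping_eqI)
      fix k
      have "(\<Sum>y\<in>Y. d y * (\<Sum>x\<in>X. c y x * lookup x k))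
        = (\<Sum>x\<in>X. (\<Sum>y\<in>Y. d y * c y x) * lookup x k)"
        unfolding sum_distrib_left sum_distrib_right
        by (subst sum.swap) (simp add: mult.assoc)
      then show "lookup (\<Sum>y\<in>Y. scale (d y) (\<Sum>x\<in>X. scale (c y x) x)) k
          = lookup 0 k"
        by (simp add: lookup_sum z)
    qed
    ultimately have "(\<Sum>y\<in>Y. scale (d y) y) \<in> B"
      by (simp add: PM.scale_right_diff_distrib sum_subtractf)
    then have "0 - (\<Sum>y\<in>Y. scale (d' y) y) \<in> B"
      using PM.subspace_neg[OF B] by (simp add: d'_def)
    moreover have "0 - (\<Sum>y\<in>Y. scale 0 y) \<in> B"
      using PM.subspace_0[OF B] by simp
    ultimately have "d' = (\<lambda>_. 0)"
      by (intro ex1_implies_eq[OF exY[OF PM.subspace_0[OF Z]]]) (simp_all add: d'_def)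
    from fun_cong[OF this, of y] show ?thesis using y by (simp add: d'_def)
  qed
  have inj: "inj_on C Y"
  proof (rule inj_onI, rule ccontr)
    fix y y' assume y: "y \<in> Y" "y' \<in> Y" "C y = C y'" "y \<noteq> y'"
    let ?d = "\<lambda>t. if t = y then 1 else if t = y' then - 1 else 0 :: 'b"
    have "(\<Sum>t\<in>Y. scale (?d t) (C t)) = (\<Sum>t\<in>{y, y'}. scale (?d t) (C t))"
      using fin y by (intro sum.mono_neutral_right) auto
    also have "\<dots> = 0" using y by simp
    finally have "?d y = 0" by (rule rel) (rule y)
    then show False by simp
  qed
  have "PM.independent (C ` Y)"
  proof (rule ccontr)
    assume "\<not> PM.independent (C ` Y)"
    then obtain u where u: "\<exists>v\<in>C ` Y. u v \<noteq> 0" "(\<Sum>v\<in>C ` Y. scale (u v) v) = 0"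
      unfolding not_not PM.dependent_finite[OF finite_imageI[OF fin(2)]] by (elim exE conjE)
    from u(2) have "(\<Sum>y\<in>Y. scale (u (C y)) (C y)) = 0"
      by (simp add: sum.reindex[OF inj])
    then have "u (C y) = 0" if "y \<in> Y" for y using rel[of "\<lambda>y. u (C y)"] that by simp
    with u(1) show False by blast
  qed
  moreover have "C ` Y \<subseteq> PM.span ((\<lambda>x. single x 1) ` X)"
  proof
    fix v assume "v \<in> C ` Y"
    then obtain y where "v = (\<Sum>x\<in>X. scale (c y x) (single x 1))"
      by (auto simp: C_def)
    moreover have "(\<Sum>x\<in>X. scale (c y x) (single x 1)) \<in> PM.span ((\<lambda>x. single x 1) ` X)"
      by (intro PM.span_sum PM.span_scale PM.span_base imageI)
    ultimately show "v \<in> PM.span ((\<lambda>x. single x 1) ` X)" by simp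
  qed
  ultimately have "card (C ` Y) \<le> card ((\<lambda>x. single x (1::'b)) ` X)"
    using PM.independent_span_bound[OF finite_imageI[OF fin(1)]] by blast
  then show ?thesis
    using card_image[OF inj] card_image_le[OF fin(1)] by (metis le_trans)
qed

lemma quotient_dim_eqI:
  assumes "basis_modulo Z B X" "PM.subspace B" "PM.subspace Z"
  shows "quotient_dim Z B = card X"
  unfolding quotient_dim_def
proof (rule the_equality)
  show "\<exists>Y. basis_modulo Z B Y \<and> card Y = card X" by (rule exI[of _ X]) (simp add: assms(1))
  fix d assume "\<exists>Y. basis_modulo Z B Y \<and> card Y = d"
  then obtain Y where Y: "basis_modulo Z B Y" "card Y = d" by (elim exE conjE)
  show "d = card X"
    using basis_modulo_card_le[OF assms(1) Y(1) assms(2,3)] basis_modulo_card_le[OF Y(1) assms(1) assms(2,3)] Y(2)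
    by linarith
qed

definition minimal_complex :: "nat \<Rightarrow> ('b, 'k::field, 'z) free_complex_scheme \<Rightarrow> bool" where
  "minimal_complex n F \<longleftrightarrow> (\<forall>v\<in>elems n F. reduce (bdry F v) = 0)"

lemma subspace_tor:
  assumes G: "free_resolution n I G"
  shows "PM.subspace (tor_cycles G i)" "PM.subspace (tor_boundaries G i)"
proof -
  have el: "lift_const x \<in> elems n G" if "x \<in> tensor_component G j" for x j
    using component_elems[OF lift_const_component[OF that]] .
  note lin = resolution_linear[OF G]
  have add: "tensor_bdry G (x + y) = tensor_bdry G x + tensor_bdry G y"
    if "x \<in> tensor_component G j" "y \<in> tensor_component G j" for x y j
    using linear_on_add[OF lin el[OF that(1)] el[OF that(2)]]
    by (simp add: tensor_bdry_eq lift_const_add reduce_add)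
  have sc: "tensor_bdry G (scale c x) = scale c (tensor_bdry G x)"
    if "x \<in> tensor_component G j" for x c j
    using linear_on_smult[OF lin _ el[OF that], of "single 0 c"]
    by (simp add: tensor_bdry_eq lift_const_scale reduce_smult)
  have z: "tensor_bdry G 0 = 0"
    using sc[of 0 0 0] by (simp add: tensor_component_def)
  have sub: "PM.subspace (tensor_component G j)" for j
  proof (rule PM.subspaceI)
    show "x + y \<in> tensor_component G j"
      if "x \<in> tensor_component G j" "y \<in> tensor_component G j" for x y
      using that keys_add[of x y] unfolding tensor_component_def by blast
    show "scale c x \<in> tensor_component G j" if "x \<in> tensor_component G j" for c x
      using that unfolding tensor_component_def by (force simp: in_keys_iff)
  qed (simp add: tensor_component_def)
  show "PM.subspace (tor_cycles G i)"
  proof (rule PM.subspaceI)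
    show "x + y \<in> tor_cycles G i" if "x \<in> tor_cycles G i" "y \<in> tor_cycles G i" for x y
      using that PM.subspace_add[OF sub] add[of x i y] by (simp add: tor_cycles_def)
    show "scale c x \<in> tor_cycles G i" if "x \<in> tor_cycles G i" for c x
      using that PM.subspace_scale[OF sub] sc[of x i] by (simp add: tor_cycles_def)
  qed (use PM.subspace_0[OF sub] z in \<open>simp add: tor_cycles_def\<close>)
  show "PM.subspace (tor_boundaries G i)"
    unfolding tor_boundaries_def
  proof (rule PM.subspaceI)
    note s = sub[of "Suc i"]
    show "0 \<in> tensor_bdry G ` tensor_component G (Suc i)"
      using z PM.subspace_0[OF s] by (metis image_eqI)
    show "x + y \<in> tensor_bdry G ` tensor_component G (Suc i)"
      if x: "x \<in> tensor_bdry G ` tensor_component G (Suc i)" and y: "y \<in> tensor_bdry G ` tensor_component G (Suc i)" for x y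
    proof -
      obtain x' y' where "x' \<in> tensor_component G (Suc i)" "y' \<in> tensor_component G (Suc i)"
        "x = tensor_bdry G x'" "y = tensor_bdry G y'" using x y by (elim imageE)
      then show ?thesis using add[of x' "Suc i" y'] PM.subspace_add[OF s] by (metis image_eqI)
    qed
    show "scale c x \<in> tensor_bdry G ` tensor_component G (Suc i)"
      if x: "x \<in> tensor_bdry G ` tensor_component G (Suc i)" for x c
    proof -
      obtain x' where "x' \<in> tensor_component G (Suc i)" "x = tensor_bdry G x'" using x by (elim imageE)
      then show ?thesis using sc[of x' "Suc i" c] PM.subspace_scale[OF s] by (metis image_eqI)
    qed
  qed
qed

text \<open>Let \<open>\<phi>\<close> and \<open>\<psi>\<close> be comparison maps from \<open>F\<close> to \<open>G\<close> and back. Both composites are homotopic to the identity, and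
  \<open>\<psi> \<phi>\<close> is even equal to the identity modulo the variables, since \<open>\<partial>\<close> vanishes there on the minimal
  resolution \<open>F\<close>. Thus the classes of the elements \<open>\<phi> b\<close> form a basis of \<open>Tor\<close>.\<close>

lemma quotient_dim_tor:
  fixes F :: "('b, 'k::field, 'z) free_complex_scheme" and G :: "('c, 'k, 'y) free_complex_scheme"
  assumes F: "free_resolution n I F" and G: "free_resolution n I G"
    and min: "minimal_complex n F" and fin: "finite {b \<in> basis F. hdeg F b = i}"
  shows "quotient_dim (tor_cycles G i) (tor_boundaries G i) = card {b \<in> basis F. hdeg F b = i}"
proof -
  obtain \<phi> where \<phi>: "\<And>b. b \<in> basis F \<Longrightarrow> \<phi> b \<in> component n G (hdeg F b)"
    "\<phi> (gen0 F) = single (gen0 G) 1"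
    "\<And>i v. v \<in> component n F i \<Longrightarrow> bdry G (free_ext \<phi> v) = free_ext \<phi> (bdry F v)"
    using comparison_map_exists[OF F G] by metis
  obtain \<psi> where \<psi>: "\<And>b. b \<in> basis G \<Longrightarrow> \<psi> b \<in> component n F (hdeg G b)"
    "\<psi> (gen0 G) = single (gen0 F) 1"
    "\<And>i v. v \<in> component n G i \<Longrightarrow> bdry F (free_ext \<psi> v) = free_ext \<psi> (bdry G v)"
    using comparison_map_exists[OF G F] by metis
  have \<phi>c: "free_ext \<phi> v \<in> component n G j" if "v \<in> component n F j" for v j
    by (rule free_ext_component[OF that]) (use \<phi>(1) in blast)
  have \<psi>c: "free_ext \<psi> v \<in> component n F j" if "v \<in> component n G j" for v j
    by (rule free_ext_component[OF that]) (use \<psi>(1) in blast)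
  have \<phi>e: "free_ext \<phi> v \<in> elems n G" if "v \<in> elems n F" for v
    by (rule free_ext_elems[OF that]) (use \<phi>(1) component_elems in blast)
  have \<psi>e: "free_ext \<psi> v \<in> elems n F" if "v \<in> elems n G" for v
    by (rule free_ext_elems[OF that]) (use \<psi>(1) component_elems in blast)
  have degree_0: "v = single (gen0 H) (lookup v (gen0 H))"
    if "free_resolution n I H" "v \<in> component n H 0" for v and H :: "('d, 'k, 'w) free_complex_scheme"
  proof (rule poly_mapping_eqI)
    fix k
    have "k \<in> keys v \<Longrightarrow> k = gen0 H"
      using component_keys[OF that(2), of k] resolution_degree_0[OF that(1), of k] by blast
    then show "lookup v k
        = lookup (single (gen0 H) (lookup v (gen0 H))) k"
      by (cases "k = gen0 H") (auto simp: lookup_single in_keys_iff)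
  qed
  define uF where "uF v = free_ext \<psi> (free_ext \<phi> v) - v" for v
  define uG where "uG v = free_ext \<phi> (free_ext \<psi> v) - v" for v
  have uF: "linear_on n (elems n F) uF" unfolding uF_def
    by (simp add: linear_on_def free_ext_add free_ext_smult smult_diff_right)
  have uG: "linear_on n (elems n G) uG" unfolding uG_def
    by (simp add: linear_on_def free_ext_add free_ext_smult smult_diff_right)
  obtain \<eta> where \<eta>: "\<And>b. b \<in> basis F \<Longrightarrow> \<eta> b \<in> component n F (Suc (hdeg F b))"
    "\<And>i v. v \<in> component n F i \<Longrightarrow> uF v = bdry F (free_ext \<eta> v) + free_ext \<eta> (bdry F v)"
  proof (rule null_homotopy_exists[OF F F uF])
    show "uF v \<in> component n F j" if "v \<in> component n F j" for v j
      using that by (simp add: uF_def \<phi>c \<psi>c)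
    show "bdry F (uF v) = uF (bdry F v)" if "v \<in> component n F j" for v j
      using linear_on_elems_diff[OF resolution_linear[OF F] component_elems[OF \<psi>c[OF \<phi>c[OF that]]] component_elems[OF that]]
      by (simp add: uF_def \<psi>(3)[OF \<phi>c[OF that]] \<phi>(3)[OF that])
    show "uF v = 0" if "v \<in> component n F 0" for v
      by (subst degree_0[OF F that]) (simp add: uF_def \<phi>(2) \<psi>(2))
  qed blast
  obtain \<zeta> where \<zeta>: "\<And>b. b \<in> basis G \<Longrightarrow> \<zeta> b \<in> component n G (Suc (hdeg G b))"
    "\<And>i v. v \<in> component n G i \<Longrightarrow> uG v = bdry G (free_ext \<zeta> v) + free_ext \<zeta> (bdry G v)"
  proof (rule null_homotopy_exists[OF G G uG])
    show "uG v \<in> component n G j" if "v \<in> component n G j" for v j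
      using that by (simp add: uG_def \<phi>c \<psi>c)
    show "bdry G (uG v) = uG (bdry G v)" if "v \<in> component n G j" for v j
      using linear_on_elems_diff[OF resolution_linear[OF G] component_elems[OF \<phi>c[OF \<psi>c[OF that]]] component_elems[OF that]]
      by (simp add: uG_def \<phi>(3)[OF \<psi>c[OF that]] \<psi>(3)[OF that])
    show "uG v = 0" if "v \<in> component n G 0" for v
      by (subst degree_0[OF G that]) (simp add: uG_def \<phi>(2) \<psi>(2))
  qed blast
  have retract: "reduce (free_ext \<psi> (free_ext \<phi> v)) = reduce v" if v: "v \<in> component n F j" for v j
  proof -
    have "reduce (bdry F (free_ext \<eta> v)) = 0"
      using min \<eta>(1) component_elems[OF v] unfolding minimal_complex_def
      by (blast intro: free_ext_elems component_elems)
    moreover have "reduce (free_ext \<eta> (bdry F v)) = 0"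
      using min component_elems[OF v] resolution_bdry_elems[OF F]
      by (intro reduce_linear_eq_0[OF linear_on_free_ext, of _ n F]) (auto simp: minimal_complex_def)
    ultimately have "reduce (uF v) = 0" using \<eta>(2)[OF v] by (simp add: reduce_add)
    then show ?thesis by (simp add: uF_def reduce_diff)
  qed
  define T where "T x = reduce (free_ext \<psi> (lift_const x))" for x
  have T_eq: "T (reduce v) = reduce (free_ext \<psi> v)" if "v \<in> component n G j" for v j
    unfolding T_def using that
    by (intro reduce_linear_cong[OF linear_on_free_ext, of _ n G] component_elems[of _ n G j]
        lift_const_component reduce_component) auto
  have T_add: "T (x + y) = T x + T y" and T_scale: "T (scale c x) = scale c (T x)" for x y c
    by (simp_all add: T_def lift_const_add free_ext_add reduce_add lift_const_scale free_ext_smult reduce_smult)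
  have T_0: "T 0 = 0" using T_scale[of 0 0] by simp
  have T_diff: "T (x - y) = T x - T y" for x y
    using T_add[of "x - y" y] by simp
  have T_sum: "T (sum g A) = (\<Sum>a\<in>A. T (g a))" for g :: "'e \<Rightarrow> _" and A
    by (induction A rule: infinite_finite_induct) (simp_all add: T_0 T_add)
  let ?B = "{b \<in> basis F. hdeg F b = i}"
  define x where "x b = reduce (\<phi> b)" for b
  have Tx: "T (x b) = single b 1" if "b \<in> ?B" for b
    using that T_eq[OF \<phi>(1), of b] retract[of "single b 1" i] by (simp add: x_def)
  have inj: "inj_on x ?B"
    by (rule inj_onI) (metis Tx lookup_single_eq lookup_single_not_eq one_neq_zero)
  have T_bd: "T y = 0" if y: "y \<in> tor_boundaries G i" for y
  proof -
    obtain t where t: "t \<in> tensor_component G (Suc i)" "y = reduce (bdry G (lift_const t))"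
      using y by (auto simp: tor_boundaries_def tensor_bdry_eq)
    have l: "lift_const t \<in> component n G (Suc i)" by (rule lift_const_component[OF t(1)])
    have "T y = reduce (bdry F (free_ext \<psi> (lift_const t)))"
      using T_eq[OF resolution_bdry_component[OF G l]] \<psi>(3)[OF l] t(2) by simp
    then show ?thesis
      using min component_elems[OF \<psi>c[OF l]] by (simp add: minimal_complex_def)
  qed
  have xZ: "x b \<in> tor_cycles G i" if b: "b \<in> ?B" for b
  proof -
    have e: "single b 1 \<in> component n F i" using b by simp
    have c: "\<phi> b \<in> component n G i" using \<phi>(1)[of b] b by simp
    have "tensor_bdry G (x b) = reduce (bdry G (\<phi> b))"
      unfolding tensor_bdry_eq x_def
      by (intro reduce_linear_cong[OF resolution_linear[OF G]] component_elems[OF c]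
          component_elems[OF lift_const_component[OF reduce_component[OF c]]]) simp
    also have "bdry G (\<phi> b) = free_ext \<phi> (bdry F (single b 1))"
      using \<phi>(3)[OF e] by simp
    also have "reduce \<dots> = 0"
      using min component_elems[OF e] resolution_bdry_elems[OF F]
      by (intro reduce_linear_eq_0[OF linear_on_free_ext, of _ n F]) (auto simp: minimal_complex_def)
    finally show ?thesis
      using reduce_component[OF c] by (simp add: tor_cycles_def x_def)
  qed
  have bm: "basis_modulo (tor_cycles G i) (tor_boundaries G i) (x ` ?B)"
    unfolding basis_modulo_def scale_def[symmetric]
  proof (intro conjI ballI)
    show "finite (x ` ?B)" "x ` ?B \<subseteq> tor_cycles G i" using fin xZ by auto
    fix z assume z: "z \<in> tor_cycles G i"
    then have zc: "z \<in> tensor_component G i" "reduce (bdry G (lift_const z)) = 0"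
      by (auto simp: tor_cycles_def tensor_bdry_eq)
    define Z where "Z = lift_const z"
    have Z: "Z \<in> component n G i" unfolding Z_def by (rule lift_const_component[OF zc(1)])
    define w where "w = free_ext \<psi> Z"
    have w: "w \<in> component n F i" unfolding w_def by (rule \<psi>c[OF Z])
    define c where "c y = (if y \<in> x ` ?B then lookup (T z) (inv_into ?B x y) else 0)" for y
    have c: "c (x b) = lookup (T z) b" if "b \<in> ?B" for b
      using that inj by (simp add: c_def)
    have "(\<Sum>y\<in>x ` ?B. scale (c y) y) = (\<Sum>b\<in>?B. scale (lookup (T z) b) (x b))"
      by (subst sum.reindex[OF inj]) (auto intro: sum.cong simp: c)
    also have "\<dots> = reduce (free_ext \<phi> w)"
      unfolding reduce_linear[OF linear_on_free_ext component_elems[OF w]]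
      using component_keys[OF w] fin
      by (intro sum.mono_neutral_cong_right) (auto simp: T_def w_def Z_def x_def in_keys_iff)
    also have "\<dots> = reduce (uG Z) + z"
      by (simp add: uG_def w_def reduce_diff Z_def)
    also have "reduce (uG Z) = reduce (bdry G (free_ext \<zeta> Z))"
    proof -
      have "reduce (free_ext \<zeta> (bdry G Z)) = 0"
        using zc(2) resolution_bdry_elems[OF G component_elems[OF Z]]
        by (intro reduce_linear_eq_0[OF linear_on_free_ext, of _ n G]) (auto simp: Z_def)
      then show ?thesis using \<zeta>(2)[OF Z] by (simp add: reduce_add)
    qed
    finally have "z - (\<Sum>y\<in>x ` ?B. scale (c y) y) = - reduce (bdry G (free_ext \<zeta> Z))" by simp
    moreover have "reduce (bdry G (free_ext \<zeta> Z)) \<in> tor_boundaries G i"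
    proof -
      have h: "free_ext \<zeta> Z \<in> component n G (Suc i)"
        by (rule free_ext_component[OF Z]) (use \<zeta>(1) in blast)
      have "reduce (bdry G (free_ext \<zeta> Z)) = tensor_bdry G (reduce (free_ext \<zeta> Z))"
        unfolding tensor_bdry_eq
        by (intro reduce_linear_cong[OF resolution_linear[OF G]] component_elems[OF h]
            component_elems[OF lift_const_component[OF reduce_component[OF h]]]) simp
      then show ?thesis using reduce_component[OF h] by (simp add: tor_boundaries_def)
    qed
    ultimately have ex: "z - (\<Sum>y\<in>x ` ?B. scale (c y) y) \<in> tor_boundaries G i"
      using PM.subspace_neg[OF subspace_tor(2)[OF G]] by simp
    show "\<exists>!c. (\<forall>y. y \<notin> x ` ?B \<longrightarrow> c y = 0) \<and> z - (\<Sum>y\<in>x ` ?B. scale (c y) y) \<in> tor_boundaries G i"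
    proof (rule ex1I[of _ c])
      show "(\<forall>y. y \<notin> x ` ?B \<longrightarrow> c y = 0) \<and> z - (\<Sum>y\<in>x ` ?B. scale (c y) y) \<in> tor_boundaries G i"
        using ex by (simp add: c_def)
      fix d assume d: "(\<forall>y. y \<notin> x ` ?B \<longrightarrow> d y = 0) \<and> z - (\<Sum>y\<in>x ` ?B. scale (d y) y) \<in> tor_boundaries G i"
      have "d (x b) = c (x b)" if b: "b \<in> ?B" for b
      proof -
        have "T z = (\<Sum>y\<in>x ` ?B. scale (d y) (T y))"
          using T_bd[OF conjunct2[OF d]] by (simp add: T_diff T_sum T_scale)
        also have "\<dots> = (\<Sum>b\<in>?B. single b (d (x b)))"
          by (subst sum.reindex[OF inj]) (auto intro!: sum.cong simp: Tx)
        finally show ?thesis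
          using b fin by (simp add: c lookup_sum lookup_single when_def)
      qed
      then show "d = c" using d by (auto simp: fun_eq_iff c_def)
    qed
  qed
  show ?thesis
    using quotient_dim_eqI[OF bm subspace_tor(2,1)[OF G]] card_image[OF inj] by simp
qed

text \<open>In particular the choice made in the definition of \<^const>\<open>betti\<close> does not matter.\<close>

lemma betti_eq_card:
  fixes F :: "(nat, 'k::field, 'z) free_complex_scheme"
  assumes F: "free_resolution n I F" and min: "minimal_complex n F"
    and fin: "finite {b \<in> basis F. hdeg F b = i}"
  shows "betti n I i = card {b \<in> basis F. hdeg F b = i}"
proof -
  let ?t = "free_complex.truncate F"
  have t: "basis ?t = basis F" "hdeg ?t = hdeg F" "gen0 ?t = gen0 F" "bdry ?t = bdry F"
    by (simp_all add: free_complex.truncate_def)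
  have "elems n ?t = elems n F" "component n ?t j = component n F j" for j
    by (simp_all add: elems_def component_def t)
  with F have "free_resolution n I ?t"
    unfolding free_resolution_def linear_bdry_def t by simp
  then have "free_resolution n I (SOME F :: (nat, 'k) free_complex. free_resolution n I F)"
    by (rule someI)
  from quotient_dim_tor[OF F this min fin] show ?thesis
    by (simp add: betti_def Let_def)
qed

section \<open>Filtered algebras with a derivation over a field\<close>

lemma scale_pm_simps [simp]: "scale 0 x = 0" "scale 1 x = x" "scale c 0 = 0"
  by (auto intro!: poly_mapping_eqI)

lemma pm_expansion:
  assumes "finite A" "keys x \<subseteq> A"
  shows "x = (\<Sum>b\<in>A. scale (lookup x b) (single b 1))"
  using poly_mapping_sum_singles[OF assms] by simp

lemma span_into_subspace:
  assumes "x \<in> PM.span S" "PM.subspace V" "\<And>s. s \<in> S \<Longrightarrow> s \<in> V"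
  shows "x \<in> V"
  using PM.span_minimal[of S V] assms by blast

text \<open>This is what remains of a minimal resolution with a DGA structure when the variables are set to \<open>1\<close>. The set
  \<open>supp b\<close> is the support of the squarefree degree of \<open>b\<close>, and \<open>W A i\<close> is the part of homological degree \<open>i\<close>
  in the degrees supported on \<open>A\<close>; in particular \<open>W UNIV i\<close> is the whole component of degree \<open>i\<close>.\<close>

locale filtered_dga =
  fixes B :: "'b set" and deg :: "'b \<Rightarrow> nat" and supp :: "'b \<Rightarrow> nat set" and one :: 'b
    and d :: "('b \<Rightarrow>\<^sub>0 'k::field) \<Rightarrow> ('b \<Rightarrow>\<^sub>0 'k)"
    and mult :: "('b \<Rightarrow>\<^sub>0 'k) \<Rightarrow> ('b \<Rightarrow>\<^sub>0 'k) \<Rightarrow> ('b \<Rightarrow>\<^sub>0 'k)" (infixl \<open>\<bullet>\<close> 70)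
    and n :: nat
    and W :: "nat set \<Rightarrow> nat \<Rightarrow> ('b \<Rightarrow>\<^sub>0 'k) set"
  assumes W_def: "W A i = {x. \<forall>b\<in>keys x. b \<in> B \<and> deg b = i \<and> supp b \<subseteq> A}"
    and deg_0: "b \<in> B \<and> deg b = 0 \<longleftrightarrow> b = one"
    and supp_one: "supp one = {}"
    and supp_bound: "b \<in> B \<Longrightarrow> supp b \<subseteq> {..<n}"
    and d_add: "x \<in> W UNIV i \<Longrightarrow> y \<in> W UNIV i \<Longrightarrow> d (x + y) = d x + d y"
    and d_scale: "x \<in> W UNIV i \<Longrightarrow> d (scale c x) = scale c (d x)"
    and d_degree_0: "x \<in> W UNIV 0 \<Longrightarrow> d x = 0"
    and d_W: "x \<in> W A (Suc i) \<Longrightarrow> d x \<in> W A i"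
    and d_d: "x \<in> W UNIV i \<Longrightarrow> d (d x) = 0"
    and d_minimal: "b \<in> B \<Longrightarrow> b' \<in> keys (d (single b 1)) \<Longrightarrow> supp b' \<subset> supp b"
    and d_exact: "x \<in> W A (Suc i) \<Longrightarrow> d x = 0 \<Longrightarrow> \<exists>y\<in>W A (Suc (Suc i)). d y = x"
    and mult_W: "x \<in> W A i \<Longrightarrow> y \<in> W A' j \<Longrightarrow> x \<bullet> y \<in> W (A \<union> A') (i + j)"
    and mult_add_left: "x \<in> W UNIV i \<Longrightarrow> x' \<in> W UNIV i \<Longrightarrow> y \<in> W UNIV j \<Longrightarrow> (x + x') \<bullet> y = x \<bullet> y + x' \<bullet> y"
    and mult_add_right: "x \<in> W UNIV i \<Longrightarrow> y \<in> W UNIV j \<Longrightarrow> y' \<in> W UNIV j \<Longrightarrow> x \<bullet> (y + y') = x \<bullet> y + x \<bullet> y'"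
    and mult_scale_left: "x \<in> W UNIV i \<Longrightarrow> y \<in> W UNIV j \<Longrightarrow> scale c x \<bullet> y = scale c (x \<bullet> y)"
    and mult_scale_right: "x \<in> W UNIV i \<Longrightarrow> y \<in> W UNIV j \<Longrightarrow> x \<bullet> scale c y = scale c (x \<bullet> y)"
    and mult_assoc: "x \<in> W UNIV i \<Longrightarrow> y \<in> W UNIV j \<Longrightarrow> z \<in> W UNIV l \<Longrightarrow> x \<bullet> y \<bullet> z = x \<bullet> (y \<bullet> z)"
    and mult_commute: "x \<in> W UNIV i \<Longrightarrow> y \<in> W UNIV j \<Longrightarrow> x \<bullet> y = scale ((- 1) ^ (i * j)) (y \<bullet> x)"
    and leibniz: "x \<in> W UNIV i \<Longrightarrow> y \<in> W UNIV j \<Longrightarrow> d (x \<bullet> y) = d x \<bullet> y + scale ((- 1) ^ i) (x \<bullet> d y)"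
    and one_one: "single one 1 \<bullet> single one 1 = single one 1"
    and degree_1_nonempty: "\<exists>b\<in>B. deg b = 1"
begin

abbreviation e :: "'b \<Rightarrow> ('b \<Rightarrow>\<^sub>0 'k)" where "e b \<equiv> single b 1"
abbreviation C :: "nat \<Rightarrow> ('b \<Rightarrow>\<^sub>0 'k) set" where "C \<equiv> W UNIV"

lemma W_subspace: "PM.subspace (W A i)"
proof (rule PM.subspaceI)
  show "x + y \<in> W A i" if "x \<in> W A i" "y \<in> W A i" for x y
    using that keys_add[of x y] unfolding W_def by blast
  show "scale c x \<in> W A i" if "x \<in> W A i" for c x
    using that unfolding W_def by (force simp: in_keys_iff)
qed (simp add: W_def)

lemmas W_intros = PM.subspace_0[OF W_subspace] PM.subspace_add[OF W_subspace]
  PM.subspace_scale[OF W_subspace] PM.subspace_diff[OF W_subspace] PM.subspace_sum[OF W_subspace]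

lemma W_mono: "A \<subseteq> A' \<Longrightarrow> x \<in> W A i \<Longrightarrow> x \<in> W A' i"
  unfolding W_def by blast

lemma W_C: "x \<in> W A i \<Longrightarrow> x \<in> C i"
  by (rule W_mono) auto

lemma basis_W: "b \<in> B \<Longrightarrow> e b \<in> W (supp b) (deg b)"
  by (simp add: W_def)

lemma basis_C: "b \<in> B \<Longrightarrow> e b \<in> C (deg b)"
  by (rule W_C[OF basis_W])

lemma scale_basis_W: "b \<in> B \<Longrightarrow> deg b = i \<Longrightarrow> supp b \<subseteq> A \<Longrightarrow> scale c (e b) \<in> W A i"
  by (auto simp: W_def)

lemma C_keys: "x \<in> C i \<Longrightarrow> b \<in> keys x \<Longrightarrow> b \<in> B \<and> deg b = i"
  by (simp add: W_def)

lemma mult_C: "x \<in> C i \<Longrightarrow> y \<in> C j \<Longrightarrow> x \<bullet> y \<in> C (i + j)"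
  using mult_W[of x UNIV i y UNIV j] by simp

lemma one_C: "e one \<in> C 0"
  using deg_0[of one] by (auto simp: W_def)

lemma d_0 [simp]: "d 0 = 0"
  by (rule d_degree_0) (rule W_intros(1))

lemma d_diff: "x \<in> C i \<Longrightarrow> y \<in> C i \<Longrightarrow> d (x - y) = d x - d y"
  using d_add[of "x - y" i y] W_intros(4)[of x UNIV i y] by simp

lemma mult_0_left [simp]: "y \<in> C j \<Longrightarrow> 0 \<bullet> y = 0"
  using mult_scale_left[of 0 0 y j 0] W_intros(1)[of UNIV 0] by simp

lemma mult_0_right [simp]: "x \<in> C i \<Longrightarrow> x \<bullet> 0 = 0"
  using mult_scale_right[of x i 0 0 0] W_intros(1)[of UNIV 0] by simp

lemma mult_diff_left: "x \<in> C i \<Longrightarrow> x' \<in> C i \<Longrightarrow> y \<in> C j \<Longrightarrow> (x - x') \<bullet> y = x \<bullet> y - x' \<bullet> y"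
  using mult_add_left[of "x - x'" i x' y j] W_intros(4)[of x UNIV i x'] by simp

lemma mult_diff_right: "x \<in> C i \<Longrightarrow> y \<in> C j \<Longrightarrow> y' \<in> C j \<Longrightarrow> x \<bullet> (y - y') = x \<bullet> y - x \<bullet> y'"
  using mult_add_right[of x i "y - y'" j y'] W_intros(4)[of y UNIV j y'] by simp

text \<open>The maps are linear only on the graded components, so an induction over a span has to carry
  the component along.\<close>

lemma d_span:
  assumes "x \<in> PM.span S" "S \<subseteq> C i" "PM.subspace V" "\<And>s. s \<in> S \<Longrightarrow> d s \<in> V"
  shows "d x \<in> V"
proof -
  have "x \<in> {x \<in> C i. d x \<in> V}"
    using assms(1)
  proof (rule span_into_subspace)
    show "PM.subspace {x \<in> C i. d x \<in> V}"
      by (rule PM.subspaceI)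
        (auto simp: W_intros d_add[of _ i] d_scale[of _ i] PM.subspace_0[OF assms(3)]
          PM.subspace_add[OF assms(3)] PM.subspace_scale[OF assms(3)])
  qed (use assms in auto)
  then show ?thesis by simp
qed

lemma mult_span_right:
  assumes "y \<in> PM.span S" "S \<subseteq> C j" "PM.subspace V" "x \<in> C i" "\<And>s. s \<in> S \<Longrightarrow> x \<bullet> s \<in> V"
  shows "x \<bullet> y \<in> V"
proof -
  have "y \<in> {y \<in> C j. x \<bullet> y \<in> V}"
    using assms(1)
  proof (rule span_into_subspace)
    show "PM.subspace {y \<in> C j. x \<bullet> y \<in> V}"
      by (rule PM.subspaceI)
        (auto simp: W_intros mult_add_right[OF assms(4), of _ j] mult_scale_right[OF assms(4), of _ j]
          mult_0_right[OF assms(4)] PM.subspace_0[OF assms(3)]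
          PM.subspace_add[OF assms(3)] PM.subspace_scale[OF assms(3)])
  qed (use assms in auto)
  then show ?thesis by simp
qed

lemma mult_span_left:
  assumes "x \<in> PM.span S" "S \<subseteq> C i" "PM.subspace V" "y \<in> C j" "\<And>s. s \<in> S \<Longrightarrow> s \<bullet> y \<in> V"
  shows "x \<bullet> y \<in> V"
proof -
  have "x \<in> {x \<in> C i. x \<bullet> y \<in> V}"
    using assms(1)
  proof (rule span_into_subspace)
    show "PM.subspace {x \<in> C i. x \<bullet> y \<in> V}"
      by (rule PM.subspaceI)
        (auto simp: W_intros mult_add_left[OF _ _ assms(4), of _ i] mult_scale_left[OF _ assms(4), of _ i]
          mult_0_left[OF assms(4)] PM.subspace_0[OF assms(3)]
          PM.subspace_add[OF assms(3)] PM.subspace_scale[OF assms(3)])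
  qed (use assms in auto)
  then show ?thesis by simp
qed

lemma span_basis: "x \<in> PM.span (e ` keys x)"
  by (subst pm_expansion[OF finite_keys order_refl])
    (intro PM.span_sum PM.span_scale PM.span_base imageI)

lemma W_span: "x \<in> W A i \<Longrightarrow> x \<in> PM.span (e ` {b \<in> B. deg b = i \<and> supp b \<subseteq> A})"
  using PM.span_mono[of "e ` keys x" "e ` {b \<in> B. deg b = i \<and> supp b \<subseteq> A}"]
    span_basis[of x] unfolding W_def by blast

definition W_lt :: "nat set \<Rightarrow> nat \<Rightarrow> ('b \<Rightarrow>\<^sub>0 'k) set" where
  "W_lt A i = {x. \<forall>b\<in>keys x. b \<in> B \<and> deg b = i \<and> supp b \<subset> A}"

lemma W_lt_subspace: "PM.subspace (W_lt A i)"
proof (rule PM.subspaceI)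
  show "x + y \<in> W_lt A i" if "x \<in> W_lt A i" "y \<in> W_lt A i" for x y
    using that keys_add[of x y] unfolding W_lt_def by blast
  show "scale c x \<in> W_lt A i" if "x \<in> W_lt A i" for c x
    using that unfolding W_lt_def by (force simp: in_keys_iff)
qed (simp add: W_lt_def)

lemma d_W_lt:
  assumes x: "x \<in> W A (Suc i)" shows "d x \<in> W_lt A i"
proof (rule d_span[OF W_span[OF x] _ W_lt_subspace])
  show "e ` {b \<in> B. deg b = Suc i \<and> supp b \<subseteq> A} \<subseteq> C (Suc i)"
    using basis_C by force
  fix s assume "s \<in> e ` {b \<in> B. deg b = Suc i \<and> supp b \<subseteq> A}"
  then obtain b where b: "b \<in> B" "deg b = Suc i" "supp b \<subseteq> A" "s = e b" by auto
  have "d s \<in> C i" using d_W[of s UNIV i] basis_C[OF b(1)] b by simp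
  then show "d s \<in> W_lt A i"
    using C_keys[of "d s" i] d_minimal[OF b(1)] b unfolding W_lt_def by blast
qed

lemma basis_notin_d:
  assumes "b \<in> B" "x \<in> W (supp b) (Suc i)" "b \<in> keys y" shows "d x \<noteq> y"
  using d_W_lt[OF assms(2)] assms(3) unfolding W_lt_def by blast

lemma d_basis_nonzero:
  assumes b: "b \<in> B" "deg b = Suc i" shows "d (e b) \<noteq> 0"
proof
  assume "d (e b) = 0"
  then obtain y where "y \<in> W (supp b) (Suc (Suc i))" "d y = e b"
    using d_exact[of "e b" "supp b" i] basis_W[OF b(1)] b by auto
  then show False using basis_notin_d[OF b(1), of y "Suc i" "e b"] by simp
qed

lemma C_0_eq: "x \<in> C 0 \<Longrightarrow> x = scale (lookup x one) (e one)"
  using pm_expansion[of "{one}" x] C_keys[of x 0] deg_0 by auto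

text \<open>The differential of \<open>b\<close> is nonzero and lies below \<open>b\<close>, so the degree can be lowered step by step.\<close>

lemma degree_1_below:
  assumes "b \<in> B" "deg b = Suc i" shows "\<exists>g\<in>B. deg g = 1 \<and> supp g \<subseteq> supp b"
  using assms
proof (induction i arbitrary: b)
  case (Suc i)
  have "d (e b) \<in> W_lt (supp b) (Suc i)"
    using d_W_lt[of "e b" "supp b" "Suc i"] basis_W[OF Suc.prems(1)] Suc.prems(2) by simp
  moreover obtain c where "c \<in> keys (d (e b))"
    using d_basis_nonzero[OF Suc.prems] by (metis ex_in_conv keys_eq_empty)
  ultimately have c: "c \<in> B" "deg c = Suc i" "supp c \<subset> supp b" unfolding W_lt_def by blast+
  with Suc.IH[OF c(1,2)] show ?case by blast
qed auto

lemma degree_1_normalized: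
  assumes g: "g \<in> B" "deg g = 1"
  obtains c where "c \<noteq> 0" "d (scale c (e g)) = e one"
proof -
  have "d (e g) \<in> C 0" using d_W[of "e g" UNIV 0] basis_C[OF g(1)] g by simp
  then obtain t where eq: "d (e g) = scale t (e one)" using C_0_eq by blast
  have t: "t \<noteq> 0" using eq d_basis_nonzero[OF g(1), of 0] g by auto
  have "d (scale (1 / t) (e g)) = scale (1 / t) (scale t (e one))"
    using d_scale[OF basis_C[OF g(1)]] eq by simp
  also have "\<dots> = e one" using t by simp
  finally show ?thesis using t by (intro that[of "1 / t"]) auto
qed

text \<open>Left multiplication \<open>u\<close> by the basis element of degree \<open>0\<close> is idempotent, commutes with \<open>d\<close> and is
  the identity in degree \<open>0\<close>. For a basis element \<open>x\<close> the element \<open>x - u x\<close> is a cycle, hence lies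
  strictly lower in the filtration, where \<open>u\<close> is the identity; but \<open>u\<close> also annihilates it.\<close>

lemma one_mult_basis: "b \<in> B \<Longrightarrow> deg b = i \<Longrightarrow> e one \<bullet> e b = e b"
proof (induction i arbitrary: b)
  case 0
  then have "b = one" using deg_0[of b] by blast
  then show ?case using one_one by simp
next
  case (Suc i)
  from Suc.prems show ?case
  proof (induction "card (supp b)" arbitrary: b rule: less_induct)
    case less
    let ?x = "e b" and ?y = "e b - e one \<bullet> e b"
    have x: "?x \<in> W (supp b) (Suc i)" using basis_W[OF less.prems(1)] less.prems(2) by simp
    have ux: "e one \<bullet> ?x \<in> W (supp b) (Suc i)"
      using mult_W[of "e one" "{}" 0 ?x "supp b" "Suc i"] basis_W[of one] deg_0[of one] supp_one x by auto
    have dx: "d ?x \<in> C i" using d_W[OF x] by (rule W_C)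
    have udx: "e one \<bullet> d ?x = d ?x"
    proof -
      have "e one \<bullet> d ?x - d ?x \<in> {0}"
      proof -
        have "d ?x \<in> {z \<in> C i. e one \<bullet> z = z}"
        proof (rule span_into_subspace[OF W_span[OF dx]])
          show "PM.subspace {z \<in> C i. e one \<bullet> z = z}"
            by (rule PM.subspaceI)
              (auto simp: W_intros mult_add_right[OF one_C, of _ i] mult_scale_right[OF one_C, of _ i]
                mult_0_right[OF one_C])
        qed (use Suc.IH basis_C in auto)
        then show ?thesis by simp
      qed
      then show ?thesis by simp
    qed
    have "d (e one \<bullet> ?x) = d ?x"
      using leibniz[OF one_C W_C[OF x]] d_degree_0[OF one_C] udx mult_0_left[OF W_C[OF x]] by simp
    then have "d ?y = 0" using d_diff[OF W_C[OF x] W_C[OF ux]] by simp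
    moreover have y: "?y \<in> W (supp b) (Suc i)" by (rule W_intros(4)[OF x ux])
    ultimately obtain z where z: "z \<in> W (supp b) (Suc (Suc i))" "d z = ?y" using d_exact by blast
    have low: "?y \<in> W_lt (supp b) (Suc i)" using d_W_lt[OF z(1)] z(2) by simp
    have fin: "finite (supp b)" using supp_bound[OF less.prems(1)] finite_subset by blast
    have "?y \<in> {z \<in> C (Suc i). e one \<bullet> z = z}"
    proof (rule span_into_subspace[OF span_basis[of ?y]])
      show "PM.subspace {z \<in> C (Suc i). e one \<bullet> z = z}"
        by (rule PM.subspaceI)
          (auto simp: W_intros mult_add_right[OF one_C, of _ "Suc i"] mult_scale_right[OF one_C, of _ "Suc i"]
            mult_0_right[OF one_C])
      fix s assume "s \<in> e ` keys ?y"
      then obtain c where c: "c \<in> keys ?y" "s = e c" by blast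
      then have "c \<in> B" "deg c = Suc i" "supp c \<subset> supp b" using low unfolding W_lt_def by blast+
      with less.hyps[of c] fin c(2) basis_C[of c] show "s \<in> {z \<in> C (Suc i). e one \<bullet> z = z}"
        by (simp add: psubset_card_mono)
    qed
    then have "e one \<bullet> ?y = ?y" by simp
    moreover have "e one \<bullet> ?y = 0"
      using mult_diff_right[OF one_C W_C[OF x] W_C[OF ux]] mult_assoc[OF one_C one_C W_C[OF x]] one_one by simp
    ultimately show ?case by simp
  qed
qed

lemma one_mult: assumes "x \<in> C i" shows "e one \<bullet> x = x"
proof -
  have "x \<in> {z \<in> C i. e one \<bullet> z = z}"
  proof (rule span_into_subspace[OF W_span[OF assms]])
    show "PM.subspace {z \<in> C i. e one \<bullet> z = z}"
      by (rule PM.subspaceI)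
        (auto simp: W_intros mult_add_right[OF one_C, of _ i] mult_scale_right[OF one_C, of _ i]
          mult_0_right[OF one_C])
  qed (use one_mult_basis basis_C in auto)
  then show ?thesis by simp
qed

subsection \<open>Generation in degree one\<close>

definition G :: "'b set" where "G = {b \<in> B. deg b = 1}"

fun products :: "nat \<Rightarrow> ('b \<Rightarrow>\<^sub>0 'k) set" where
  "products 0 = {e one}"
| "products (Suc i) = (\<lambda>(g, p). e g \<bullet> p) ` (G \<times> products i)"

lemma products_C: "products i \<subseteq> C i"
proof (induction i)
  case (Suc i)
  have "e g \<bullet> p \<in> C (Suc i)" if "g \<in> G" "p \<in> products i" for g p
    using mult_C[OF basis_C, of g p i] that Suc by (auto simp: G_def)
  then show ?case by auto
qed (simp add: one_C)

lemma degree_1_mult_products: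
  assumes v: "v \<in> C 1" and y: "y \<in> PM.span (products i)"
  shows "v \<bullet> y \<in> PM.span (products (Suc i))"
proof (rule mult_span_right[OF y products_C PM.subspace_span v])
  fix p assume p: "p \<in> products i"
  show "v \<bullet> p \<in> PM.span (products (Suc i))"
  proof (rule mult_span_left[OF W_span[OF v] _ PM.subspace_span])
    show "p \<in> C i" using p products_C by blast
  qed (use p basis_C in \<open>force simp: G_def intro!: PM.span_base\<close>)+
qed

text \<open>Let \<open>v\<close> be an element of degree one below \<open>g\<close> with \<open>d v = 1\<close>. Then \<open>g - v \<bullet> d g\<close> is a cycle, hence
  a boundary \<open>d h\<close> with \<open>h\<close> below \<open>g\<close>. So \<open>g = v \<bullet> d g + d h\<close>, where both \<open>d g\<close> and \<open>d h\<close> lie strictly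
  below \<open>g\<close> by minimality.\<close>

lemma generated_in_degree_1: "b \<in> B \<Longrightarrow> e b \<in> PM.span (products (deg b))"
proof (induction "card (supp b)" arbitrary: b rule: less_induct)
  case less
  show ?case
  proof (cases "deg b")
    case 0
    then have "b = one" using deg_0[of b] less.prems by blast
    then show ?thesis using 0 by (auto intro: PM.span_base)
  next
    case (Suc i)
    have fin: "finite (supp b)" using supp_bound[OF less.prems] finite_subset by blast
    have low: "z \<in> PM.span (products j)" if z: "z \<in> W_lt (supp b) j" for z j
    proof -
      have "e c \<in> PM.span (products j)" if "c \<in> keys z" for c
      proof -
        have c: "c \<in> B" "deg c = j" "supp c \<subset> supp b" using z that by (auto simp: W_lt_def)
        show ?thesis using less.hyps[OF psubset_card_mono[OF fin c(3)] c(1)] c(2) by simp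
      qed
      then have "PM.span (e ` keys z) \<subseteq> PM.span (products j)"
        by (intro PM.span_minimal PM.subspace_span) auto
      then show ?thesis using span_basis[of z] by blast
    qed
    have x: "e b \<in> W (supp b) (Suc i)" using basis_W[OF less.prems] Suc by simp
    obtain g where g: "g \<in> B" "deg g = 1" "supp g \<subseteq> supp b"
      using degree_1_below[OF less.prems Suc] by blast
    obtain c where c: "d (scale c (e g)) = e one" using degree_1_normalized[OF g(1,2)] by blast
    define v where "v = scale c (e g)"
    have v: "v \<in> W (supp b) 1"
      unfolding v_def by (rule scale_basis_W[OF g])
    have dx: "d (e b) \<in> W (supp b) i" by (rule d_W[OF x])
    have vdx: "v \<bullet> d (e b) \<in> W (supp b) (Suc i)" using mult_W[OF v dx] by simp
    have "d (v \<bullet> d (e b)) = d (e b)"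
      using leibniz[OF W_C[OF v] W_C[OF dx]] c d_d[OF W_C[OF x]] one_mult[OF W_C[OF dx]]
        mult_0_right[OF W_C[OF v]] by (simp add: v_def)
    then have "d (e b - v \<bullet> d (e b)) = 0" using d_diff[OF W_C[OF x] W_C[OF vdx]] by simp
    then obtain h where h: "h \<in> W (supp b) (Suc (Suc i))" "d h = e b - v \<bullet> d (e b)"
      using d_exact[OF W_intros(4)[OF x vdx]] by blast
    have "v \<bullet> d (e b) \<in> PM.span (products (Suc i))"
      by (rule degree_1_mult_products[OF W_C[OF v] low[OF d_W_lt[OF x]]])
    moreover have "d h \<in> PM.span (products (Suc i))" by (rule low[OF d_W_lt[OF h(1)]])
    ultimately have "v \<bullet> d (e b) + d h \<in> PM.span (products (Suc i))" by (rule PM.span_add)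
    then show ?thesis using h(2) Suc by simp
  qed
qed

text \<open>If \<open>g'\<close> is below \<open>g\<close>, then suitable multiples of both have differential \<open>1\<close>. Their difference is a
  cycle below \<open>g\<close>, hence a boundary, in which \<open>g\<close> cannot occur by minimality.\<close>

lemma supp_incomparable:
  assumes g: "g \<in> G" "g' \<in> G" "supp g' \<subseteq> supp g" shows "g' = g"
proof (rule ccontr)
  assume ne: "g' \<noteq> g"
  have B: "g \<in> B" "g' \<in> B" "deg g = 1" "deg g' = 1" using g by (auto simp: G_def)
  obtain c where c: "c \<noteq> 0" "d (scale c (e g)) = e one" using degree_1_normalized[OF B(1,3)] .
  obtain c' where c': "c' \<noteq> 0" "d (scale c' (e g')) = e one" using degree_1_normalized[OF B(2,4)] .
  have w: "scale c (e g) \<in> W (supp g) 1" "scale c' (e g') \<in> W (supp g) 1"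
    by (rule scale_basis_W[OF B(1,3) order_refl] scale_basis_W[OF B(2,4) g(3)])+
  let ?x = "scale c (e g) - scale c' (e g')"
  have "d ?x = 0" using d_diff[OF W_C[OF w(1)] W_C[OF w(2)]] c c' by simp
  then obtain y where y: "y \<in> W (supp g) (Suc (Suc 0))" "d y = ?x"
    using d_exact[of ?x "supp g" 0] W_intros(4)[OF w] by auto
  have "g \<in> keys ?x"
    using c ne by (simp add: in_keys_iff lookup_minus lookup_single)
  then show False using basis_notin_d[OF B(1) y(1)] y(2) by blast
qed

lemma finite_G: "finite G"
proof (rule finite_imageD)
  show "finite (supp ` G)"
    by (rule finite_subset[of _ "Pow {..<n}"]) (use supp_bound in \<open>auto simp: G_def\<close>)
  show "inj_on supp G" by (rule inj_onI) (metis supp_incomparable order_refl)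
qed

text \<open>The square of a generator \<open>g\<close> lies in degree two below \<open>g\<close>. There are no basis elements there:
  the differential of one would be a nonzero multiple of \<open>g\<close>, but \<open>g\<close> is not a cycle. This is what
  replaces the sign rule in characteristic two.\<close>

lemma generator_square: assumes g: "g \<in> G" shows "e g \<bullet> e g = 0"
proof -
  have B: "g \<in> B" "deg g = 1" using g by (auto simp: G_def)
  have False if b: "b \<in> B" "deg b = Suc (Suc 0)" "supp b \<subseteq> supp g" for b
  proof -
    have db: "d (e b) \<in> W (supp g) 1"
      using d_W[of "e b" "supp g" 1] W_mono[OF b(3) basis_W[OF b(1)]] b(2) by simp
    have "keys (d (e b)) \<subseteq> {g}"
    proof
      fix c assume "c \<in> keys (d (e b))"
      with db have "c \<in> G" "supp c \<subseteq> supp g" by (auto simp: W_def G_def)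
      then show "c \<in> {g}" using supp_incomparable[OF g] by blast
    qed
    then obtain t where eq: "d (e b) = scale t (e g)"
      using pm_expansion[of "{g}" "d (e b)"] by auto
    then have "scale t (d (e g)) = 0"
      using d_d[OF basis_C[OF b(1)]] d_scale[OF basis_C[OF B(1)]] by metis
    then have "t = 0"
      using d_basis_nonzero[OF B(1), of 0] B by simp
    then show False using eq d_basis_nonzero[OF b(1,2)] by simp
  qed
  moreover have "e g \<bullet> e g \<in> W (supp g) (Suc (Suc 0))"
    using mult_W[OF basis_W[OF B(1)] basis_W[OF B(1)]] B by simp
  ultimately have "keys (e g \<bullet> e g) = {}" unfolding W_def by blast
  then show ?thesis by simp
qed

end

section \<open>Standard monomials form a cone\<close>

text \<open>The greedy choice of a basis from a spanning family. Applied to the monomials in the generators it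
  selects the standard monomials.\<close>

lemma leading_members_basis:
  fixes u :: "'i \<Rightarrow> ('b \<Rightarrow>\<^sub>0 'k::field)" and w :: "'i \<Rightarrow> nat"
  assumes fin: "finite I" and w: "inj_on w I"
    and J: "J = {i \<in> I. u i \<notin> PM.span (u ` {j \<in> I. w j < w i})}"
  shows "inj_on u J \<and> PM.independent (u ` J) \<and> PM.span (u ` J) = PM.span (u ` I)"
proof -
  have finJ: "finite J" using fin J by simp
  have ind: "inj_on u {i \<in> J. w i < k} \<and> PM.independent (u ` {i \<in> J. w i < k})" for k
  proof (induction k)
    case 0
    then show ?case by (simp add: PM.independent_empty)
  next
    case (Suc k)
    show ?case
    proof (cases "\<exists>i\<in>J. w i = k")
      case False
      then have "{i \<in> J. w i < Suc k} = {i \<in> J. w i < k}" by (auto simp: less_Suc_eq)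
      with Suc show ?thesis by simp
    next
      case True
      then obtain i where i: "i \<in> J" "w i = k" by blast
      have eq: "{i \<in> J. w i < Suc k} = insert i {i \<in> J. w i < k}"
        using i w J by (auto simp: less_Suc_eq dest: inj_onD)
      have "u i \<notin> PM.span (u ` {j \<in> I. w j < w i})" using i J by blast
      moreover have "PM.span (u ` {i \<in> J. w i < k}) \<subseteq> PM.span (u ` {j \<in> I. w j < w i})"
        using i J by (intro PM.span_mono image_mono) auto
      ultimately have ni: "u i \<notin> PM.span (u ` {i \<in> J. w i < k})" by blast
      have "u i \<notin> u ` {i \<in> J. w i < k}" using ni by (metis PM.span_base)
      then have "inj_on u (insert i {i \<in> J. w i < k})"
        unfolding inj_on_insert by (intro conjI conjunct1[OF Suc]) blast
      moreover have "PM.independent (u ` insert i {i \<in> J. w i < k})"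
        unfolding image_insert by (rule PM.independent_insertI[OF ni conjunct2[OF Suc]])
      ultimately show ?thesis unfolding eq by (rule conjI)
    qed
  qed
  have "{i \<in> J. w i < Suc (Max (insert 0 (w ` J)))} = J"
    using finJ by (auto simp: less_Suc_eq_le intro: Max_ge)
  with ind[of "Suc (Max (insert 0 (w ` J)))"] have 1: "inj_on u J" "PM.independent (u ` J)" by simp_all
  have "u i \<in> PM.span (u ` J)" if "i \<in> I" for i
    using that
  proof (induction "w i" arbitrary: i rule: less_induct)
    case less
    show ?case
    proof (cases "i \<in> J")
      case True
      then show ?thesis by (intro PM.span_base imageI)
    next
      case False
      then have "u i \<in> PM.span (u ` {j \<in> I. w j < w i})" using less.prems J by blast
      moreover have "PM.span (u ` {j \<in> I. w j < w i}) \<subseteq> PM.span (u ` J)"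
        using less.hyps by (intro PM.span_minimal PM.subspace_span) auto
      ultimately show ?thesis by blast
    qed
  qed
  then have "PM.span (u ` I) \<subseteq> PM.span (u ` J)"
    by (intro PM.span_minimal PM.subspace_span) auto
  moreover have "PM.span (u ` J) \<subseteq> PM.span (u ` I)"
    using J by (intro PM.span_mono) auto
  ultimately show ?thesis using 1 by blast
qed

lemma single_one_inject:
  "single b (1 :: 'k::field) = single c 1 \<longleftrightarrow> b = c"
  by (metis lookup_single_eq lookup_single_not_eq one_neq_zero)

context filtered_dga
begin

lemma mult_anticommute: "x \<in> C 1 \<Longrightarrow> y \<in> C 1 \<Longrightarrow> x \<bullet> y = - (y \<bullet> x)"
  using mult_commute[of x 1 y 1] PM.scale_minus_left[of 1 "y \<bullet> x"] by simp

text \<open>Let \<open>a\<^sub>0,\<dots>,a\<^bsub>m-1\<^esub>\<close> be the generators, scaled to have differential \<open>1\<close>. Then \<open>v\<^sub>0 = a\<^sub>0\<close> and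
  \<open>v\<^sub>i = a\<^sub>i - a\<^sub>0\<close> will do: their squares vanish because those of the generators do and the generators
  anticommute.\<close>

lemma adapted_generators_exist:
  obtains v and m :: nat where "0 < m" "\<And>i. i < m \<Longrightarrow> v i \<in> C 1" "\<And>i. i < m \<Longrightarrow> v i \<bullet> v i = 0"
    "d (v 0) = e one" "\<And>i. 0 < i \<Longrightarrow> i < m \<Longrightarrow> d (v i) = 0"
    "\<And>g. g \<in> G \<Longrightarrow> e g \<in> PM.span (v ` {..<m})"
proof -
  define m where "m = card G"
  have "G \<noteq> {}" using degree_1_nonempty by (auto simp: G_def)
  then have m: "0 < m" using finite_G by (simp add: m_def card_gt_0_iff)
  obtain \<gamma> where \<gamma>: "bij_betw \<gamma> {..<m} G"
    using ex_bij_betw_nat_finite[OF finite_G] by (auto simp: m_def lessThan_atLeast0)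
  have \<gamma>G: "\<gamma> i \<in> B" "deg (\<gamma> i) = 1" "\<gamma> i \<in> G" if "i < m" for i
    using bij_betwE[OF \<gamma>] that by (auto simp: G_def)
  have "\<exists>c. c \<noteq> 0 \<and> d (scale c (e (\<gamma> i))) = e one" if "i < m" for i
    using degree_1_normalized[OF \<gamma>G(1,2)[OF that]] by metis
  then obtain c where c: "\<And>i. i < m \<Longrightarrow> c i \<noteq> 0 \<and> d (scale (c i) (e (\<gamma> i))) = e one" by metis
  define a where "a i = scale (c i) (e (\<gamma> i))" for i
  have aC: "a i \<in> C 1" if "i < m" for i
    unfolding a_def by (rule scale_basis_W) (use \<gamma>G[OF that] in auto)
  have da: "d (a i) = e one" if "i < m" for i using c[OF that] by (simp add: a_def)
  have eC: "e (\<gamma> i) \<in> C 1" if "i < m" for i using basis_C[OF \<gamma>G(1)[OF that]] \<gamma>G[OF that] by simp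
  have aa: "a i \<bullet> a i = 0" if "i < m" for i
  proof -
    note E = eC[OF that]
    have "scale (c i) (e (\<gamma> i)) \<bullet> scale (c i) (e (\<gamma> i)) = scale (c i) (scale (c i) (e (\<gamma> i) \<bullet> e (\<gamma> i)))"
      by (simp only: mult_scale_left[OF E W_intros(3)[OF E]] mult_scale_right[OF E E])
    then show ?thesis
      unfolding a_def generator_square[OF \<gamma>G(3)[OF that]] by (simp only: scale_pm_simps)
  qed
  define v where "v i = (if i = 0 then a 0 else a i - a 0)" for i
  show ?thesis
  proof (rule that[OF m])
    show vC: "v i \<in> C 1" if "i < m" for i
      using aC[OF that] aC[OF m] W_intros(4)[of "a i" UNIV 1 "a 0"] by (simp add: v_def)
    show "v i \<bullet> v i = 0" if i: "i < m" for i
    proof (cases "i = 0")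
      case False
      note A = aC[OF i] aC[OF m]
      have "v i \<bullet> v i = (a i \<bullet> a i - a 0 \<bullet> a i) - (a i \<bullet> a 0 - a 0 \<bullet> a 0)"
        using False A W_intros(4)[OF A]
        by (simp add: v_def mult_diff_right[of _ 1 _ 1] mult_diff_left[of _ 1 _ _ 1])
      also have "\<dots> = 0" using aa[OF i] aa[OF m] mult_anticommute[OF A] by simp
      finally show ?thesis .
    qed (simp add: v_def aa m)
    show "d (v 0) = e one" by (simp add: v_def da m)
    show "d (v i) = 0" if "0 < i" "i < m" for i
      using that d_diff[OF aC[OF that(2)] aC[OF m]] da[OF that(2)] da[OF m] by (simp add: v_def)
    fix g assume "g \<in> G"
    then obtain i where i: "i < m" "g = \<gamma> i" using bij_betw_imp_surj_on[OF \<gamma>] by auto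
    have v: "v j \<in> PM.span (v ` {..<m})" if "j < m" for j using that by (auto intro: PM.span_base)
    have "a i = (if i = 0 then v 0 else v i + v 0)" by (simp add: v_def)
    then have "a i \<in> PM.span (v ` {..<m})" using v[OF i(1)] v[OF m] PM.span_add by auto
    then have "scale (1 / c i) (a i) \<in> PM.span (v ` {..<m})" by (rule PM.span_scale)
    then show "e g \<in> PM.span (v ` {..<m})" using c[OF i(1)] i(2) by (simp add: a_def)
  qed
qed

context
  fixes v :: "nat \<Rightarrow> ('b \<Rightarrow>\<^sub>0 'k)" and m :: nat
  assumes m: "0 < m" and vC: "\<And>i. i < m \<Longrightarrow> v i \<in> C 1" and v_square: "\<And>i. i < m \<Longrightarrow> v i \<bullet> v i = 0"
    and d_v0: "d (v 0) = e one" and d_v: "\<And>i. 0 < i \<Longrightarrow> i < m \<Longrightarrow> d (v i) = 0"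
    and v_span: "\<And>g. g \<in> G \<Longrightarrow> e g \<in> PM.span (v ` {..<m})"
begin

fun list_product :: "nat list \<Rightarrow> ('b \<Rightarrow>\<^sub>0 'k)" where
  "list_product [] = e one"
| "list_product (i # is) = v i \<bullet> list_product is"

definition monomial :: "nat set \<Rightarrow> ('b \<Rightarrow>\<^sub>0 'k)" where
  "monomial S = list_product (sorted_list_of_set S)"

lemma monomial_empty [simp]: "monomial {} = e one"
  by (simp add: monomial_def)

lemma monomial_insert_less:
  assumes "finite S" "\<And>j. j \<in> S \<Longrightarrow> i < j" shows "monomial (insert i S) = v i \<bullet> monomial S"
proof -
  have "i \<notin> S" using assms(2) by blast
  then have "sorted_list_of_set (insert i S) = i # sorted_list_of_set S"
    using assms by (simp add: insort_is_Cons less_imp_le)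
  then show ?thesis by (simp add: monomial_def)
qed

lemma monomial_C: assumes "S \<subseteq> {..<m}" shows "monomial S \<in> C (card S)"
  using finite_subset[OF assms finite_lessThan] assms
proof (induction S rule: finite_linorder_min_induct)
  case (insert b A)
  then have "v b \<bullet> monomial A \<in> C (1 + card A)" by (intro mult_C vC) auto
  moreover have "b \<notin> A" using insert by blast
  ultimately show ?case using insert by (simp add: monomial_insert_less)
qed (simp add: one_C)

lemma v_mult_monomial:
  assumes "S \<subseteq> {..<m}" "i < m"
  shows "(i \<in> S \<longrightarrow> v i \<bullet> monomial S = 0) \<and>
    (i \<notin> S \<longrightarrow> (\<exists>s. s \<noteq> 0 \<and> v i \<bullet> monomial S = scale s (monomial (insert i S))))"
  using finite_subset[OF assms(1) finite_lessThan] assms(1)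
proof (induction S rule: finite_linorder_min_induct)
  case empty
  then show ?case using monomial_insert_less[of "{}" i] by (auto intro!: exI[of _ 1])
next
  case (insert b A)
  have bA: "b < m" "A \<subseteq> {..<m}" and lt: "\<And>j. j \<in> A \<Longrightarrow> b < j" using insert by auto
  note C = vC[OF assms(2)] vC[OF bA(1)] monomial_C[OF bA(2)]
  have eq: "monomial (insert b A) = v b \<bullet> monomial A"
    by (rule monomial_insert_less[OF insert.hyps(1) lt])
  consider "i < b" | "i = b" | "b < i" by (metis linorder_neqE_nat)
  then show ?case
  proof cases
    case 1
    then have "\<And>j. j \<in> insert b A \<Longrightarrow> i < j" using lt by force
    then have "monomial (insert i (insert b A)) = v i \<bullet> monomial (insert b A)"
      using insert.hyps(1) by (intro monomial_insert_less) auto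
    moreover have "i \<notin> insert b A" using 1 lt by force
    ultimately show ?thesis by (auto intro!: exI[of _ 1])
  next
    case 2
    have "v i \<bullet> (v b \<bullet> monomial A) = 0"
      using mult_assoc[OF C(2) C(2) C(3)] v_square[OF bA(1)] C(3) 2 by simp
    with 2 show ?thesis by (simp add: eq)
  next
    case 3
    have "v i \<bullet> (v b \<bullet> monomial A) = - (v b \<bullet> v i) \<bullet> monomial A"
      using mult_assoc[OF C(1) C(2) C(3)] mult_anticommute[OF C(1,2)] by simp
    also have "\<dots> = scale (- 1) (v b \<bullet> (v i \<bullet> monomial A))"
      using mult_assoc[OF C(2) C(1) C(3)] mult_scale_left[OF mult_C[OF C(2,1)] C(3), of "- 1"]
      by (simp add: PM.scale_minus_left)
    finally have *: "v i \<bullet> monomial (insert b A) = scale (- 1) (v b \<bullet> (v i \<bullet> monomial A))"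
      by (simp add: eq)
    show ?thesis
    proof (cases "i \<in> A")
      case True
      then have "v i \<bullet> monomial A = 0" using insert.IH bA by blast
      then show ?thesis using True * mult_0_right[OF C(2)] by simp
    next
      case False
      then obtain s where s: "s \<noteq> 0" "v i \<bullet> monomial A = scale s (monomial (insert i A))"
        using insert.IH bA by blast
      have "monomial (insert i A) \<in> C (card (insert i A))"
        using assms(2) bA by (intro monomial_C) auto
      then have "v i \<bullet> monomial (insert b A) = scale (- s) (v b \<bullet> monomial (insert i A))"
        using * s(2) mult_scale_right[OF C(2)] by simp
      also have "v b \<bullet> monomial (insert i A) = monomial (insert b (insert i A))"
        using insert.hyps(1) lt 3 by (intro monomial_insert_less[symmetric]) auto
      finally show ?thesis
        using s(1) False 3 by (auto simp: insert_commute intro!: exI[of _ "- s"])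
    qed
  qed
qed

lemma d_monomial_pos: assumes "S \<subseteq> {0<..<m}" shows "d (monomial S) = 0"
  using finite_subset[OF assms finite_greaterThanLessThan] assms
proof (induction S rule: finite_linorder_min_induct)
  case empty
  then show ?case using d_degree_0[OF one_C] by simp
next
  case (insert b A)
  then have bA: "0 < b" "b < m" "A \<subseteq> {..<m}" and lt: "\<And>j. j \<in> A \<Longrightarrow> b < j" by auto
  have "d (v b \<bullet> monomial A) = d (v b) \<bullet> monomial A + scale ((- 1) ^ 1) (v b \<bullet> d (monomial A))"
    by (rule leibniz[OF vC[OF bA(2)] monomial_C[OF bA(3)]])
  also have "\<dots> = 0"
    using d_v[OF bA(1,2)] insert mult_0_left[OF monomial_C[OF bA(3)]] mult_0_right[OF vC[OF bA(2)]] by simp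
  finally show ?case using monomial_insert_less[OF insert.hyps(1) lt] by simp
qed

lemma d_monomial:
  assumes S: "S \<subseteq> {..<m}" shows "d (monomial S) = (if 0 \<in> S then monomial (S - {0}) else 0)"
proof (cases "0 \<in> S")
  case False
  then have "S \<subseteq> {0<..<m}" using S by (auto intro: gr0I)
  then show ?thesis using d_monomial_pos False by simp
next
  case True
  let ?T = "S - {0}"
  have T: "?T \<subseteq> {0<..<m}" "?T \<subseteq> {..<m}" "finite ?T" using S finite_subset[OF S] by auto
  have "monomial S = v 0 \<bullet> monomial ?T"
    using monomial_insert_less[OF T(3), of 0] True by (auto simp: insert_absorb)
  then have "d (monomial S) = d (v 0) \<bullet> monomial ?T + scale ((- 1) ^ 1) (v 0 \<bullet> d (monomial ?T))"
    using leibniz[OF vC[OF m] monomial_C[OF T(2)]] by simp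
  also have "\<dots> = monomial ?T"
    using d_v0 d_monomial_pos[OF T(1)] one_mult[OF monomial_C[OF T(2)]] mult_0_right[OF vC[OF m]] by simp
  finally show ?thesis using True by simp
qed

definition subsets_of_size :: "nat \<Rightarrow> nat set set" where
  "subsets_of_size i = {S. S \<subseteq> {..<m} \<and> card S = i}"

lemma finite_subsets_of_size: "finite (subsets_of_size i)"
  by (rule finite_subset[of _ "Pow {..<m}"]) (auto simp: subsets_of_size_def)

lemma products_monomial_span: "products i \<subseteq> PM.span (monomial ` subsets_of_size i)"
proof (induction i)
  case 0
  have "monomial {} \<in> PM.span (monomial ` subsets_of_size 0)"
    by (intro PM.span_base imageI) (simp add: subsets_of_size_def)
  then show ?case by simp
next
  case (Suc i)
  show ?case
  proof
    fix x assume "x \<in> products (Suc i)"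
    then obtain g p where x: "g \<in> G" "p \<in> products i" "x = e g \<bullet> p" by auto
    have "e g \<bullet> p \<in> PM.span (monomial ` subsets_of_size (Suc i))"
    proof (rule mult_span_left[OF v_span[OF x(1)] _ PM.subspace_span])
      show "v ` {..<m} \<subseteq> C 1" using vC by auto
      show "p \<in> C i" using x(2) products_C by blast
      fix s assume "s \<in> v ` {..<m}"
      then obtain j where j: "j < m" "s = v j" by auto
      have "p \<in> PM.span (monomial ` subsets_of_size i)" using Suc x(2) by blast
      then show "s \<bullet> p \<in> PM.span (monomial ` subsets_of_size (Suc i))"
      proof (rule mult_span_right[OF _ _ PM.subspace_span])
        show "monomial ` subsets_of_size i \<subseteq> C i"
          using monomial_C by (auto simp: subsets_of_size_def)
        show "s \<in> C 1" using j vC by simp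
        fix t assume "t \<in> monomial ` subsets_of_size i"
        then obtain S where S: "S \<subseteq> {..<m}" "card S = i" "t = monomial S"
          by (auto simp: subsets_of_size_def)
        show "s \<bullet> t \<in> PM.span (monomial ` subsets_of_size (Suc i))"
        proof (cases "j \<in> S")
          case True
          then have "s \<bullet> t = 0" using v_mult_monomial[OF S(1) j(1)] j S by simp
          then show ?thesis by (simp add: PM.span_zero)
        next
          case False
          then obtain r where r: "s \<bullet> t = scale r (monomial (insert j S))"
            using v_mult_monomial[OF S(1) j(1)] j S by blast
          have "insert j S \<in> subsets_of_size (Suc i)"
            using S j False finite_subset[OF S(1)] by (simp add: subsets_of_size_def)
          then show ?thesis unfolding r by (intro PM.span_scale PM.span_base imageI)
        qed
      qed
    qed
    then show "x \<in> PM.span (monomial ` subsets_of_size (Suc i))" using x(3) by simp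
  qed
qed

lemma span_monomials: "PM.span (monomial ` subsets_of_size i) = PM.span (e ` {b \<in> B. deg b = i})"
proof
  have "monomial S \<in> PM.span (e ` {b \<in> B. deg b = i})" if "S \<in> subsets_of_size i" for S
    using W_span[of "monomial S" UNIV i] monomial_C[of S] that by (simp add: subsets_of_size_def)
  then show "PM.span (monomial ` subsets_of_size i) \<subseteq> PM.span (e ` {b \<in> B. deg b = i})"
    by (intro PM.span_minimal PM.subspace_span) auto
  have "e b \<in> PM.span (monomial ` subsets_of_size i)" if b: "b \<in> B" "deg b = i" for b
  proof -
    have "PM.span (products i) \<subseteq> PM.span (monomial ` subsets_of_size i)"
      by (intro PM.span_minimal PM.subspace_span products_monomial_span)
    then show ?thesis using generated_in_degree_1[OF b(1)] b(2) by blast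
  qed
  then show "PM.span (e ` {b \<in> B. deg b = i}) \<subseteq> PM.span (monomial ` subsets_of_size i)"
    by (intro PM.span_minimal PM.subspace_span) auto
qed

definition smaller_monomials :: "nat set \<Rightarrow> ('b \<Rightarrow>\<^sub>0 'k) set" where
  "smaller_monomials S = monomial ` {T. T \<subseteq> {..<m} \<and> card T = card S \<and> set_encode T < set_encode S}"

text \<open>The order by the binary weight \<open>\<Sum>i\<in>S. 2 ^ i\<close> is compatible with the product: adding one new element to two
  sets adds the same number to their weights.\<close>

definition standard_complex :: "nat set set" where
  "standard_complex = {S. S \<subseteq> {..<m} \<and> monomial S \<notin> PM.span (smaller_monomials S)}"

lemma smaller_monomials_C: "S \<subseteq> {..<m} \<Longrightarrow> smaller_monomials S \<subseteq> C (card S)"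
  unfolding smaller_monomials_def
proof safe
  fix T assume "T \<subseteq> {..<m}" "card T = card S"
  then show "monomial T \<in> C (card S)" using monomial_C[of T] by simp
qed

text \<open>A relation that expresses the monomial of \<open>S\<close> by smaller ones becomes one for \<open>insert i S\<close> when it is
  multiplied by \<open>v i\<close>; the terms that contain \<open>v i\<close> vanish.\<close>

lemma standard_complex_insert:
  assumes S: "insert i S \<in> standard_complex" and i: "i \<notin> S" shows "S \<in> standard_complex"
proof (rule ccontr)
  have sub: "S \<subseteq> {..<m}" "i < m" using S by (auto simp: standard_complex_def)
  assume "S \<notin> standard_complex"
  then have "monomial S \<in> PM.span (smaller_monomials S)" using sub by (simp add: standard_complex_def)
  then have "v i \<bullet> monomial S \<in> PM.span (smaller_monomials (insert i S))"
  proof (rule mult_span_right[OF _ smaller_monomials_C[OF sub(1)] PM.subspace_span vC[OF sub(2)]])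
    fix t assume "t \<in> smaller_monomials S"
    then obtain T where T: "T \<subseteq> {..<m}" "card T = card S" "set_encode T < set_encode S" "t = monomial T"
      by (auto simp: smaller_monomials_def)
    have fin: "finite S" "finite T" using sub T finite_subset by blast+
    show "v i \<bullet> t \<in> PM.span (smaller_monomials (insert i S))"
    proof (cases "i \<in> T")
      case True
      then show ?thesis using v_mult_monomial[OF T(1) sub(2)] T(4) by (simp add: PM.span_zero)
    next
      case False
      then obtain r where r: "v i \<bullet> t = scale r (monomial (insert i T))"
        using v_mult_monomial[OF T(1) sub(2)] T(4) by blast
      have "set_encode (insert i T) < set_encode (insert i S)"
        using T(3) fin False i by (simp add: set_encode_insert)
      then have "monomial (insert i T) \<in> smaller_monomials (insert i S)"
        unfolding smaller_monomials_def using T sub fin False i by (intro imageI) simp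
      then show ?thesis unfolding r by (intro PM.span_scale PM.span_base)
    qed
  qed
  moreover obtain s where s: "s \<noteq> 0" "v i \<bullet> monomial S = scale s (monomial (insert i S))"
    using v_mult_monomial[OF sub] i by blast
  ultimately have "scale s (monomial (insert i S)) \<in> PM.span (smaller_monomials (insert i S))" by simp
  from PM.span_scale[OF this, of "1 / s"] show False
    using S s(1) by (simp add: standard_complex_def)
qed

lemma standard_complex_subset:
  assumes "S \<in> standard_complex" "U \<subseteq> S" shows "U \<in> standard_complex"
proof -
  have fin: "finite S" using assms(1) finite_subset[of S "{..<m}"] by (simp add: standard_complex_def)
  have "U \<union> A \<in> standard_complex \<Longrightarrow> U \<in> standard_complex" if "finite A" "A \<inter> U = {}" for A
    using that
  proof (induction A rule: finite_induct)
    case (insert x F)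
    then show ?case using standard_complex_insert[of x "U \<union> F"] by auto
  qed simp
  from this[of "S - U"] fin assms show ?thesis by (auto simp: Un_absorb1)
qed

text \<open>The differential replaces a relation that expresses the monomial of \<open>insert 0 S\<close> by smaller ones by
  such a relation for \<open>S\<close>.\<close>

lemma standard_complex_apex:
  assumes S: "S \<in> standard_complex" shows "insert 0 S \<in> standard_complex"
proof (cases "0 \<in> S")
  case True
  then show ?thesis using S by (simp add: insert_absorb)
next
  case False
  have sub: "S \<subseteq> {..<m}" "insert 0 S \<subseteq> {..<m}" using S m by (auto simp: standard_complex_def)
  have fin: "finite S" using sub finite_subset by blast
  show ?thesis
  proof (rule ccontr)
    assume "insert 0 S \<notin> standard_complex"
    then have "monomial (insert 0 S) \<in> PM.span (smaller_monomials (insert 0 S))"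
      using sub by (simp add: standard_complex_def)
    then have "d (monomial (insert 0 S)) \<in> PM.span (smaller_monomials S)"
    proof (rule d_span[OF _ smaller_monomials_C[OF sub(2)] PM.subspace_span])
      fix t assume "t \<in> smaller_monomials (insert 0 S)"
      then obtain T where T: "T \<subseteq> {..<m}" "card T = card (insert 0 S)"
        "set_encode T < set_encode (insert 0 S)" "t = monomial T"
        by (auto simp: smaller_monomials_def)
      have finT: "finite T" using T finite_subset by blast
      show "d t \<in> PM.span (smaller_monomials S)"
      proof (cases "0 \<in> T")
        case True
        then have "set_encode T = 1 + set_encode (T - {0})"
          using set_encode_insert[of "T - {0}" 0] finT by (simp add: insert_absorb)
        moreover have "set_encode (insert 0 S) = 1 + set_encode S"
          using set_encode_insert[of S 0] fin False by simp
        ultimately have "monomial (T - {0}) \<in> smaller_monomials S"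
          unfolding smaller_monomials_def using T fin finT False True by (intro imageI) auto
        then show ?thesis using d_monomial[OF T(1)] T(4) True by (simp add: PM.span_base)
      next
        case False
        then show ?thesis using d_monomial[OF T(1)] T(4) by (simp add: PM.span_zero)
      qed
    qed
    then have "monomial S \<in> PM.span (smaller_monomials S)"
      using d_monomial[OF sub(2)] False by simp
    then show False using S by (simp add: standard_complex_def)
  qed
qed

lemma empty_standard: "{} \<in> standard_complex"
proof -
  have "smaller_monomials {} = {}"
    by (auto simp: smaller_monomials_def dest: finite_subset)
  moreover have "e one \<noteq> 0" by (metis lookup_single_eq lookup_zero one_neq_zero)
  ultimately show ?thesis by (simp add: standard_complex_def)
qed

lemma card_standard:
  "finite {b \<in> B. deg b = i} \<and> card {S \<in> standard_complex. card S = i} = card {b \<in> B. deg b = i}"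
proof -
  let ?J = "{S \<in> standard_complex. card S = i}" and ?E = "{b \<in> B. deg b = i}"
  have "inj_on set_encode (subsets_of_size i)"
    by (rule inj_on_subset[OF inj_on_set_encode]) (auto simp: subsets_of_size_def dest: finite_subset)
  moreover have "?J = {S \<in> subsets_of_size i.
      monomial S \<notin> PM.span (monomial ` {T \<in> subsets_of_size i. set_encode T < set_encode S})}"
    unfolding standard_complex_def smaller_monomials_def subsets_of_size_def by (auto simp: conj_assoc)
  ultimately have J: "inj_on monomial ?J" "PM.independent (monomial ` ?J)"
    "PM.span (monomial ` ?J) = PM.span (monomial ` subsets_of_size i)"
    using leading_members_basis[OF finite_subsets_of_size] by blast+
  have finJ: "finite ?J"
    by (rule finite_subset[OF _ finite_subsets_of_size[of i]]) (auto simp: standard_complex_def subsets_of_size_def)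
  have inj: "inj_on e ?E"
    by (rule inj_onI) (simp add: single_one_inject)
  have indE: "PM.independent (e ` ?E)"
    unfolding PM.independent_explicit_module
  proof (intro allI impI)
    fix t u w assume t: "finite t" "t \<subseteq> e ` ?E" "(\<Sum>w\<in>t. scale (u w) w) = 0" "w \<in> t"
    then obtain b where b: "w = e b" by auto
    have "lookup (scale (u x) x) b = (if x = w then u x else 0)" if "x \<in> t" for x
    proof -
      obtain b' where "x = e b'" using t(2) \<open>x \<in> t\<close> by auto
      then show ?thesis using b by (cases "b' = b") (auto simp: lookup_single single_one_inject)
    qed
    then have "(\<Sum>x\<in>t. lookup (scale (u x) x) b) = (\<Sum>x\<in>t. if x = w then u x else 0)"
      by (intro sum.cong refl)
    then have "(\<Sum>x\<in>t. lookup (scale (u x) x) b) = u w"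
      using t(1,4) by simp
    then show "u w = 0" using arg_cong[OF t(3), of "\<lambda>x. lookup x b"] by (simp add: lookup_sum)
  qed
  have sp: "PM.span (monomial ` ?J) = PM.span (e ` ?E)" using J(3) span_monomials by simp
  have "finite (e ` ?E)"
    using PM.independent_span_bound[OF finite_imageI[OF finJ, of monomial] indE]
      sp PM.span_superset[of "e ` ?E"] by simp
  then have finE: "finite ?E" using inj by (rule finite_imageD)
  have "card (monomial ` ?J) = card (e ` ?E)"
    using PM.dim_eq_card[OF sp J(2)] PM.dim_eq_card[OF refl indE] by simp
  then show ?thesis using finE card_image[OF J(1)] card_image[OF inj] by simp
qed

lemma standard_complex_cone: "simplicial_complex standard_complex" "is_cone standard_complex"
proof -
  have "finite standard_complex"
    by (rule finite_subset[of _ "Pow {..<m}"]) (auto simp: standard_complex_def)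
  moreover have "finite S" if "S \<in> standard_complex" for S
    using that finite_subset[of S "{..<m}"] by (simp add: standard_complex_def)
  ultimately show "simplicial_complex standard_complex"
    unfolding simplicial_complex_def using empty_standard standard_complex_subset by blast
  show "is_cone standard_complex"
    unfolding is_cone_def
    using standard_complex_apex[OF empty_standard] standard_complex_apex by (intro exI[of _ 0]) simp
qed

end

theorem filtered_dga_cone:
  "\<exists>\<Delta> :: nat set set. simplicial_complex \<Delta> \<and> is_cone \<Delta> \<and>
    (\<forall>i. finite {b \<in> B. deg b = i} \<and> f_vector \<Delta> i = card {b \<in> B. deg b = i})"
proof (rule adapted_generators_exist)
  fix v and m :: nat
  assume vm: "0 < m" "\<And>i. i < m \<Longrightarrow> v i \<in> C 1" "\<And>i. i < m \<Longrightarrow> v i \<bullet> v i = 0"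
    "d (v 0) = e one" "\<And>i. 0 < i \<Longrightarrow> i < m \<Longrightarrow> d (v i) = 0"
    "\<And>g. g \<in> G \<Longrightarrow> e g \<in> PM.span (v ` {..<m})"
  show ?thesis
    by (rule exI[of _ "standard_complex v m"])
      (simp add: f_vector_def standard_complex_cone[OF vm] card_standard[OF vm])
qed

end

section \<open>Monomials and divisibility\<close>

lemma monomial_divides_sum:
  fixes p :: "'k::field mpoly"
  assumes "\<And>m. m \<in> keys p \<Longrightarrow> \<exists>k. m = a + k"
  obtains q where "p = single a 1 * q" "\<And>n. p \<in> polyring n \<Longrightarrow> q \<in> polyring n"
proof -
  have a: "a + (m - a) = m" if "m \<in> keys p" for m
    using assms[OF that] by auto
  define q where "q = (\<Sum>m\<in>keys p. single (m - a) (lookup p m))"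
  have "single a 1 * q = (\<Sum>m\<in>keys p. single m (lookup p m))"
    unfolding q_def sum_distrib_left by (intro sum.cong refl) (simp add: mult_single a)
  then have "p = single a 1 * q"
    by (simp flip: poly_mapping_sum_singles)
  moreover have "q \<in> polyring n" if "p \<in> polyring n" for n
    unfolding q_def
  proof (intro polyring_sum polyring_single)
    fix m assume m: "m \<in> keys p"
    then have "keys m \<subseteq> {..<n}" using that by (simp add: polyring_def)
    moreover have "keys (m - a) \<subseteq> keys m"
      using keys_monomial_add[of a "m - a"] a[OF m] by auto
    ultimately show "keys (m - a) \<subseteq> {..<n}" by blast
  qed
  ultimately show ?thesis using that by blast
qed

lemma single_one_mult_cancel:
  fixes p q :: "'k::field mpoly"
  shows "single a 1 * p = single a 1 * q \<longleftrightarrow> p = q"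
proof
  assume eq: "single a 1 * p = single a 1 * q"
  show "p = q"
    by (rule poly_mapping_eqI)
      (use arg_cong[OF eq, of "\<lambda>p. lookup p (a + k)" for k] in \<open>simp add: lookup_single_times_add\<close>)
qed simp

definition squarefree_monomial :: "nat set \<Rightarrow> (nat \<Rightarrow>\<^sub>0 nat)" where
  "squarefree_monomial A = (\<Sum>j\<in>A. single j 1)"

lemma lookup_squarefree_monomial:
  "finite A \<Longrightarrow> lookup (squarefree_monomial A) j = (if j \<in> A then 1 else 0)"
  by (simp add: squarefree_monomial_def lookup_sum lookup_single when_def)

lemma keys_squarefree_monomial: "finite A \<Longrightarrow> keys (squarefree_monomial A) = A"
  by (auto simp: in_keys_iff lookup_squarefree_monomial split: if_splits)

section \<open>Setting the variables to one\<close>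

definition eval_1 :: "'k::field mpoly \<Rightarrow> 'k" where
  "eval_1 p = (\<Sum>m\<in>keys p. lookup p m)"

lemma eval_1_superset:
  "finite A \<Longrightarrow> keys p \<subseteq> A \<Longrightarrow> eval_1 p = (\<Sum>m\<in>A. lookup p m)"
  unfolding eval_1_def by (rule sum.mono_neutral_left) (auto simp: in_keys_iff)

lemma eval_1_add: "eval_1 (p + q) = eval_1 p + eval_1 q"
proof -
  let ?A = "keys p \<union> keys q"
  have "eval_1 (p + q) = (\<Sum>m\<in>?A. lookup (p + q) m)"
    by (rule eval_1_superset) (simp_all add: keys_add)
  then show ?thesis
    by (simp add: lookup_add sum.distrib eval_1_superset[of ?A])
qed

lemma eval_1_single [simp]: "eval_1 (single m c) = c"
  by (simp add: eval_1_def)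

lemma eval_1_0 [simp]: "eval_1 0 = 0"
  by (simp add: eval_1_def)

lemma eval_1_diff: "eval_1 (p - q) = eval_1 p - eval_1 q"
  using eval_1_add[of "p - q" q] by simp

lemma eval_1_mult: "eval_1 (p * q) = eval_1 p * eval_1 q"
proof (induction p rule: poly_mapping_add_induct)
  case (add b c p)
  have "eval_1 (single b c * q) = c * eval_1 q"
    by (induction q rule: poly_mapping_add_induct) (simp_all add: distrib_left eval_1_add mult_single)
  with add show ?case by (simp add: distrib_right eval_1_add)
qed simp

definition dehom :: "('b, 'k::field) fvec \<Rightarrow> ('b \<Rightarrow>\<^sub>0 'k)" where
  "dehom v = Poly_Mapping.map eval_1 v"

lemma lookup_dehom [simp]: "lookup (dehom v) b = eval_1 (lookup v b)"
  by (auto simp: dehom_def map.rep_eq when_def)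

lemma dehom_add: "dehom (v + w) = dehom v + dehom w"
  and dehom_diff: "dehom (v - w) = dehom v - dehom w"
  and dehom_smult: "dehom (smult p v) = scale (eval_1 p) (dehom v)"
  and dehom_0 [simp]: "dehom 0 = 0"
  and dehom_lift_const [simp]: "dehom (lift_const x) = x"
  by (auto intro!: poly_mapping_eqI simp: lookup_add lookup_minus eval_1_add eval_1_diff eval_1_mult)

lemma dehom_sum: "dehom (sum g A) = (\<Sum>a\<in>A. dehom (g a))"
  by (induction A rule: infinite_finite_induct) (auto simp: dehom_add)

lemma keys_dehom: "keys (dehom v) \<subseteq> keys v"
  by (auto simp: in_keys_iff)

lemma lift_const_single [simp]: "lift_const (single b 1) = single b 1"
  by (simp add: lift_const_def)

lemma dehom_linear_cong:
  assumes L: "linear_on n (elems n F) L" and v: "v \<in> elems n F" and w: "w \<in> elems n F"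
    and eq: "dehom v = dehom w"
  shows "dehom (L v) = dehom (L w)"
proof -
  have "dehom (v - w) = 0" using eq by (simp add: dehom_diff)
  then have z: "eval_1 (lookup (v - w) b) = 0" for b
    by (metis lookup_dehom lookup_zero)
  have "v - w \<in> elems n F" using v w by simp
  from linear_on_expansion[OF L this] have "dehom (L (v - w)) = 0"
    by (simp add: dehom_sum dehom_smult z)
  then show ?thesis
    using linear_on_elems_diff[OF L v w] by (simp add: dehom_diff)
qed

section \<open>Homogeneous elements\<close>

context
  fixes n :: nat and F :: "('b, 'k::field, 'z) graded_free_complex_scheme"
begin

lemma homogeneous_key:
  "v \<in> homogeneous n F a \<Longrightarrow> m \<in> keys (lookup v b) \<Longrightarrow>
    int (lookup m j) + mdeg F b j = a j"
proof -
  assume v: "v \<in> homogeneous n F a" and m: "m \<in> keys (lookup v b)"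
  then have "b \<in> keys v" by (auto simp: in_keys_iff)
  with v m show ?thesis by (simp add: homogeneous_def)
qed

lemma homogeneousI:
  assumes "v \<in> elems n F"
    "\<And>b m j. m \<in> keys (lookup v b) \<Longrightarrow> int (lookup m j) + mdeg F b j = a j"
  shows "v \<in> homogeneous n F a"
  using assms by (simp add: homogeneous_def)

lemma homogeneous_coefficient:
  assumes v: "v \<in> homogeneous n F a" and b: "b \<in> keys v"
  obtains m c where "lookup v b = single m c" "c \<noteq> 0"
    "\<And>j. int (lookup m j) + mdeg F b j = a j"
proof -
  have "lookup v b \<noteq> 0" using b by (simp add: in_keys_iff)
  then obtain m where m: "m \<in> keys (lookup v b)"
    by (metis ex_in_conv keys_eq_empty)
  have "m' = m" if "m' \<in> keys (lookup v b)" for m'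
  proof (rule poly_mapping_eqI)
    fix j show "lookup m' j = lookup m j"
      using homogeneous_key[OF v that, of j] homogeneous_key[OF v m, of j] by simp
  qed
  then have "keys (lookup v b) \<subseteq> {m}" by blast
  then have "lookup v b = single m (lookup (lookup v b) m)"
    using poly_mapping_sum_singles[of "{m}" "lookup v b"] by simp
  then show ?thesis
    by (rule that) (use m homogeneous_key[OF v m] in \<open>simp_all add: in_keys_iff\<close>)
qed

lemma basis_homogeneous: "b \<in> basis F \<Longrightarrow> single b 1 \<in> homogeneous n F (mdeg F b)"
  by (rule homogeneousI) (auto simp: lookup_single when_def split: if_splits)

lemma dehom_inject_homogeneous:
  assumes v: "v \<in> homogeneous n F a" and z: "dehom v = 0" shows "v = 0"
proof (rule ccontr)
  assume "v \<noteq> 0"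
  then obtain b where b: "b \<in> keys v" by (metis ex_in_conv keys_eq_empty)
  obtain m c where "lookup v b = single m c" "c \<noteq> 0"
    using homogeneous_coefficient[OF v b] .
  then have "lookup (dehom v) b \<noteq> 0" by simp
  then show False using z by simp
qed

definition part :: "(nat \<Rightarrow> int) \<Rightarrow> ('b, 'k) fvec \<Rightarrow> ('b, 'k) fvec" where
  "part a v = Poly_Mapping.mapp (\<lambda>b. Poly_Mapping.mapp
    (\<lambda>m c. if \<forall>j. int (lookup m j) + mdeg F b j = a j then c else 0)) v"

lemma lookup_part:
  "lookup (lookup (part a v) b) m =
    (if \<forall>j. int (lookup m j) + mdeg F b j = a j
     then lookup (lookup v b) m else 0)"
  by (auto simp: part_def lookup_mapp when_def in_keys_iff)

lemma part_add: "part a (v + w) = part a v + part a w"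
  by (intro poly_mapping_eqI) (simp add: lookup_part lookup_add)

lemma part_0: "part a 0 = 0"
  by (intro poly_mapping_eqI) (simp add: lookup_part)

lemma part_sum: "part a (sum g A) = (\<Sum>x\<in>A. part a (g x))"
  by (induction A rule: infinite_finite_induct) (simp_all add: part_0 part_add)

lemma part_homogeneous:
  assumes v: "v \<in> homogeneous n F b" shows "part a v = (if b = a then v else 0)"
proof (intro poly_mapping_eqI)
  fix c m
  show "lookup (lookup (part a v) c) m =
      lookup (lookup (if b = a then v else 0) c) m"
  proof (cases "m \<in> keys (lookup v c)")
    case True
    then have "(\<forall>j. int (lookup m j) + mdeg F c j = a j) \<longleftrightarrow> b = a"
      using homogeneous_key[OF v True] by auto
    then show ?thesis unfolding lookup_part by simp
  qed (auto simp: lookup_part in_keys_iff)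
qed

lemma part_in:
  assumes v: "v \<in> component n F i"
  shows "part a v \<in> component n F i" "part a v \<in> homogeneous n F a"
proof -
  have k: "keys (lookup (part a v) b) \<subseteq> keys (lookup v b)" for b
    by (auto simp: in_keys_iff lookup_part split: if_splits)
  have "keys (part a v) \<subseteq> keys v"
  proof
    fix b assume "b \<in> keys (part a v)"
    then have "keys (lookup (part a v) b) \<noteq> {}"
      by (simp add: in_keys_iff)
    then have "keys (lookup v b) \<noteq> {}" using k[of b] by blast
    then show "b \<in> keys v" by (simp add: in_keys_iff)
  qed
  moreover have "lookup (part a v) b \<in> polyring n" for b
    using k[of b] elems_lookup[OF component_elems[OF v], of b] unfolding polyring_def by blast
  ultimately show c: "part a v \<in> component n F i"
    unfolding component_iff using component_keys[OF v] by (simp add: subset_iff)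
  show "part a v \<in> homogeneous n F a"
    by (rule homogeneousI[OF component_elems[OF c]]) (auto simp: in_keys_iff lookup_part split: if_splits)
qed

text \<open>The differential preserves the degree of each term, and an element is the sum of its terms.\<close>

lemma bdry_part:
  assumes res: "graded_free_resolution n I F" and u: "u \<in> elems n F"
  shows "bdry F (part a u) = part a (bdry F u)"
proof -
  have F: "free_resolution n I F" and gr: "\<And>b v. v \<in> homogeneous n F b \<Longrightarrow> bdry F v \<in> homogeneous n F b"
    using res by (auto simp: graded_free_resolution_def)
  note lin = resolution_linear[OF F]
  let ?t = "\<lambda>b m. single b (single m (lookup (lookup u b) m))"
  have mem: "?t b m \<in> elems n F" "bdry F (part a (?t b m)) = part a (bdry F (?t b m))" "part a (?t b m) \<in> elems n F"
    if b: "b \<in> keys u" and m: "m \<in> keys (lookup u b)" for b m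
  proof -
    have "keys m \<subseteq> {..<n}" using elems_lookup[OF u, of b] m by (simp add: polyring_def)
    then show t: "?t b m \<in> elems n F" using elems_keys[OF u b] by simp
    define c where "c j = int (lookup m j) + mdeg F b j" for j
    have h: "?t b m \<in> homogeneous n F c"
      by (rule homogeneousI[OF t]) (auto simp: lookup_single when_def c_def split: if_splits)
    show "bdry F (part a (?t b m)) = part a (bdry F (?t b m))"
      unfolding part_homogeneous[OF h] part_homogeneous[OF gr[OF h]]
      by (simp add: linear_on_0[OF lin])
    show "part a (?t b m) \<in> elems n F" unfolding part_homogeneous[OF h] using t by simp
  qed
  have u_eq: "u = (\<Sum>b\<in>keys u. \<Sum>m\<in>keys (lookup u b). ?t b m)"
  proof (rule poly_mapping_eqI)
    fix c
    have "lookup u c = (\<Sum>m\<in>keys (lookup u c).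
        single m (lookup (lookup u c) m))"
      by (rule poly_mapping_sum_singles) simp_all
    moreover have "(\<Sum>b\<in>keys u. lookup (\<Sum>m\<in>keys (lookup u b). ?t b m) c)
      = (\<Sum>b\<in>keys u. if b = c then \<Sum>m\<in>keys (lookup u c).
        single m (lookup (lookup u c) m) else 0)"
      by (intro sum.cong refl) (auto simp: lookup_sum lookup_single)
    ultimately show "lookup u c =
        lookup (\<Sum>b\<in>keys u. \<Sum>m\<in>keys (lookup u b). ?t b m) c"
      by (simp add: lookup_sum in_keys_iff)
  qed
  have 1: "bdry F (\<Sum>b\<in>keys u. \<Sum>m\<in>keys (lookup u b). part a (?t b m))
    = (\<Sum>b\<in>keys u. \<Sum>m\<in>keys (lookup u b). bdry F (part a (?t b m)))"
    by (simp only: linear_on_elems_sum[OF lin] elems_sum mem(3) cong: sum.cong)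
  have 2: "bdry F (\<Sum>b\<in>keys u. \<Sum>m\<in>keys (lookup u b). ?t b m)
    = (\<Sum>b\<in>keys u. \<Sum>m\<in>keys (lookup u b). bdry F (?t b m))"
    by (simp only: linear_on_elems_sum[OF lin] elems_sum mem(1) cong: sum.cong)
  have "bdry F (part a u) = (\<Sum>b\<in>keys u. \<Sum>m\<in>keys (lookup u b). bdry F (part a (?t b m)))"
    using 1 by (subst u_eq) (simp only: part_sum)
  also have "\<dots> = (\<Sum>b\<in>keys u. \<Sum>m\<in>keys (lookup u b). part a (bdry F (?t b m)))"
    using mem(2) by (intro sum.cong refl)
  also have "\<dots> = part a (bdry F (\<Sum>b\<in>keys u. \<Sum>m\<in>keys (lookup u b). ?t b m))"
    unfolding 2 by (simp only: part_sum)
  also have "\<dots> = part a (bdry F u)" by (simp only: u_eq[symmetric])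
  finally show ?thesis .
qed

end

section \<open>The degrees of a minimal resolution of a squarefree ideal\<close>

text \<open>Some squarefree generator divides \<open>m\<close>, and it also divides \<open>m\<close> with one factor \<open>x\<^sub>j\<close> removed,
  since it contains \<open>x\<^sub>j\<close> at most once.\<close>

lemma squarefree_ideal_reduce_exponent:
  fixes I :: "'k::field mpoly set"
  assumes I: "squarefree_monomial_ideal n I" and m: "single m c \<in> I" "c \<noteq> 0"
    and j: "2 \<le> lookup m j"
  obtains k where "m = single j 1 + k" "\<And>c'. single k c' \<in> I"
proof -
  obtain Gs where Gs: "Gs \<subseteq> squarefree_monomials n" "I = ideal_generated n Gs"
    using I by (auto simp: squarefree_monomial_ideal_def)
  obtain A co where A: "finite A" "A \<subseteq> Gs" "\<And>g. g \<in> A \<Longrightarrow> co g \<in> polyring n"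
    "single m c = (\<Sum>g\<in>A. co g * g)"
    using m(1) unfolding Gs(2) ideal_generated_def by auto
  have "m \<in> keys (\<Sum>g\<in>A. co g * g)" using A(4) m(2) by (metis keys_single insertI1)
  then obtain g where g: "g \<in> A" "m \<in> keys (co g * g)"
    using keys_sum[of "\<lambda>g. co g * g" A] by blast
  obtain s where s: "g = single s 1" "\<And>i. lookup s i \<le> 1"
    using A(2) g(1) Gs(1) unfolding squarefree_monomials_def by blast
  obtain t where t: "t \<in> keys (co g)" "m = t + s"
    using g(2) keys_mult[of "co g" g] s(1) by (auto split: if_splits)
  have "1 \<le> lookup t j" using j s(2)[of j] t(2) by (simp add: lookup_add)
  then have tj: "t = single j 1 + (t - single j 1)"
    by (intro poly_mapping_eqI) (auto simp: lookup_add lookup_minus lookup_single when_def)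
  have "keys t \<subseteq> {..<n}" using A(3)[OF g(1)] t(1) by (simp add: polyring_def)
  then have k: "keys (t - single j 1) \<subseteq> {..<n}"
    using keys_monomial_add[of "single j 1" "t - single j 1"] tj by auto
  show ?thesis
  proof (rule that)
    show "m = single j 1 + (t - single j 1 + s)"
      using t(2) tj by (simp add: add.assoc[symmetric])
    fix c' :: 'k
    let ?p = "single (t - single j 1) c'"
    have "(\<Sum>g\<in>{g}. ?p * g) \<in> ideal_generated n Gs"
      unfolding ideal_generated_def mem_Collect_eq using A(2) g(1) k
      by (intro exI[of _ "{g}"] exI[of _ "\<lambda>_. ?p"]) auto
    then show "single (t - single j 1 + s) c' \<in> I"
      by (simp add: Gs(2) s(1) mult_single)
  qed
qed

lemma component_divide_monomial:
  assumes v: "v \<in> component n F i"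
    and dv: "\<And>b m. m \<in> keys (lookup v b) \<Longrightarrow> \<exists>k. m = a + k"
  obtains w where "w \<in> component n F i" "v = smult (single a 1) w"
proof -
  have "\<exists>q. lookup v b = single a 1 * q \<and> q \<in> polyring n" for b
    using monomial_divides_sum[of "lookup v b" a] dv elems_lookup[OF component_elems[OF v]] by metis
  then obtain q where q: "\<And>b. lookup v b = single a 1 * q b" "\<And>b. q b \<in> polyring n"
    by metis
  define w where "w = (\<Sum>b\<in>keys v. single b (q b))"
  have "w \<in> component n F i"
    unfolding w_def using component_keys[OF v] q(2) by (intro component_sum component_single) auto
  moreover have "smult (single a 1) w = v"
    unfolding w_def smult_sum by (simp flip: q(1) poly_mapping_sum_singles)
  ultimately show ?thesis using that by blast
qed

lemma smult_monomial_eq_0: "smult (single a 1) v = 0 \<Longrightarrow> v = 0"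
proof (rule poly_mapping_eqI)
  fix b assume "smult (single a 1) v = 0"
  then have "single a 1 * lookup v b = single a 1 * 0"
    by (metis lookup_smult lookup_zero mult_zero_right)
  then show "lookup v b = lookup 0 b"
    by (simp only: single_one_mult_cancel lookup_zero)
qed

context
  fixes n :: nat and I :: "'k::field mpoly set" and F :: "('b, 'k, 'z) graded_free_complex_scheme"
  assumes I: "squarefree_monomial_ideal n I" and F: "minimal_graded_free_resolution n I F"
begin

lemma graded_resolution: "graded_free_resolution n I F"
  using F by (simp add: minimal_graded_free_resolution_def)

lemma resolution: "free_resolution n I F"
  using graded_resolution by (simp add: graded_free_resolution_def)

lemma minimal_resolution: "v \<in> elems n F \<Longrightarrow> lookup (lookup (bdry F v) b) 0 = 0"
  using F unfolding minimal_graded_free_resolution_def by (elim conjE) blast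

lemma bdry_homogeneous: "v \<in> homogeneous n F a \<Longrightarrow> bdry F v \<in> homogeneous n F a"
  using graded_resolution unfolding graded_free_resolution_def by (elim conjE) blast

lemma mdeg_beyond: "b \<in> basis F \<Longrightarrow> n \<le> j \<Longrightarrow> mdeg F b j = 0"
  using graded_resolution unfolding graded_free_resolution_def by (elim conjE) blast

lemma mdeg_gen0: "mdeg F (gen0 F) j = 0"
  using graded_resolution unfolding graded_free_resolution_def by (elim conjE) blast

text \<open>By minimality such an element is not a boundary, so by exactness it is not a cycle.\<close>

lemma unit_coefficient_not_cycle:
  assumes v: "v \<in> component n F (Suc i)" and b: "lookup (lookup v b) 0 \<noteq> 0"
  shows "bdry F v \<noteq> 0"
proof
  assume "bdry F v = 0"
  then obtain u where "u \<in> component n F (Suc (Suc i))" "bdry F u = v"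
    using resolution_exact[OF resolution v] by blast
  then show False using minimal_resolution[of u b] b component_elems by metis
qed

lemma bdry_basis_nonzero:
  assumes "b \<in> basis F" "hdeg F b = Suc i" shows "bdry F (single b 1) \<noteq> 0"
  by (rule unit_coefficient_not_cycle[of _ i b]) (use assms in simp_all)

text \<open>If the degree of a basis element \<open>b\<close> had an entry \<open>\<ge> 2\<close>, then \<open>\<partial> b = x\<^sub>j w\<close> with a cycle \<open>w = \<partial> h\<close>,
  since the degrees one step below have entries \<open>\<le> 1\<close>. So \<open>b - x\<^sub>j h\<close> would be a cycle with a unit coefficient.\<close>

lemma mdeg_squarefree: "b \<in> basis F \<Longrightarrow> mdeg F b j = 0 \<or> mdeg F b j = 1"
proof (induction "hdeg F b" arbitrary: b j)
  case 0
  then have "b = gen0 F" using resolution_degree_0[OF resolution, of b] by simp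
  then show ?case by (simp add: mdeg_gen0)
next
  case (Suc i)
  define v where "v = bdry F (single b 1)"
  have e: "single b 1 \<in> component n F (Suc i)" using Suc by simp
  have v: "v \<in> component n F i" unfolding v_def by (rule resolution_bdry_component[OF resolution e])
  have hv: "v \<in> homogeneous n F (mdeg F b)"
    unfolding v_def by (rule bdry_homogeneous[OF basis_homogeneous[OF Suc.prems]])
  have v0: "v \<noteq> 0" unfolding v_def using bdry_basis_nonzero[OF Suc.prems Suc.hyps(2)[symmetric]] .
  then obtain c where c: "c \<in> keys v" by (metis ex_in_conv keys_eq_empty)
  have below: "mdeg F c j = 0 \<or> mdeg F c j = 1" if "c \<in> keys v" for c
    using Suc.hyps(1)[of c] component_keys[OF v that] by simp
  obtain m t where m: "lookup v c = single m t" "t \<noteq> 0"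
    "\<And>j. int (lookup m j) + mdeg F c j = mdeg F b j"
    using homogeneous_coefficient[OF hv c] by metis
  have nonneg: "0 \<le> mdeg F b j" using m(3)[of j] below[OF c] by auto
  moreover have False if two: "2 \<le> mdeg F b j"
  proof -
    have jn: "j < n" using mdeg_beyond[OF Suc.prems, of j] two by (metis linorder_not_less not_numeral_le_zero)
    have xj: "single (single j 1) (1::'k) \<in> polyring n" using jn by simp
    have dv: "\<exists>k. m' = single j 1 + k" if "m' \<in> keys (lookup v b')" for b' m'
    proof -
      have "b' \<in> keys v" using that by (auto simp: in_keys_iff)
      then have "1 \<le> lookup m' j"
        using homogeneous_key[OF hv that, of j] below[of b'] two by auto
      then have "m' = single j 1 + (m' - single j 1)"
        by (intro poly_mapping_eqI) (auto simp: lookup_add lookup_minus lookup_single when_def)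
      then show ?thesis by blast
    qed
    obtain w where w: "w \<in> component n F i" "v = smult (single (single j 1) 1) w"
      using component_divide_monomial[OF v dv] .
    have "w \<in> bdry F ` component n F (Suc i)"
    proof (cases i)
      case (Suc i')
      have "smult (single (single j 1) 1) (bdry F w) = bdry F v"
        using linear_on_smult[OF resolution_linear[OF resolution] xj component_elems[OF w(1)]] w(2) by simp
      also have "\<dots> = 0" unfolding v_def by (rule resolution_bdry_bdry[OF resolution e])
      finally have "bdry F w = 0" by (rule smult_monomial_eq_0)
      then show ?thesis using resolution_exact[OF resolution, of w i'] w(1) Suc by auto
    next
      case 0
      have c0: "c = gen0 F" if "c \<in> keys v" for c
        using component_keys[OF v that] 0 resolution_degree_0[OF resolution, of c] by simp
      have vm: "v = single (gen0 F) (single m t)"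
        using poly_mapping_sum_singles[of "{gen0 F}" v] c0 c m(1) by auto
      have "v \<in> bdry F ` component n F 1" unfolding v_def using e 0 by simp
      then have mI: "single m t \<in> I"
        unfolding resolution_image[OF resolution] vm by (auto dest: injD[OF inj_single])
      have "2 \<le> lookup m j"
        using m(3)[of j] two mdeg_gen0[of j] c0[OF c] by simp
      then obtain k where k: "m = single j 1 + k" "\<And>c'. single k c' \<in> I"
        using squarefree_ideal_reduce_exponent[OF I mI m(2)] by blast
      have "smult (single (single j 1) 1) (w - single (gen0 F) (single k t)) = 0"
        unfolding smult_diff_right w(2)[symmetric] vm by (simp add: mult_single k(1))
      then have "w = single (gen0 F) (single k t)"
        using smult_monomial_eq_0 by fastforce
      then show ?thesis using k(2) 0 resolution_image[OF resolution] by auto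
    qed
    then obtain h where h: "h \<in> component n F (Suc i)" "bdry F h = w" by auto
    let ?y = "single b 1 - smult (single (single j 1) 1) h"
    have xh: "smult (single (single j 1) 1) h \<in> component n F (Suc i)"
      using xj h(1) by simp
    have "bdry F ?y = v - smult (single (single j 1) 1) w"
      using linear_on_elems_diff[OF resolution_linear[OF resolution] component_elems[OF e] component_elems[OF xh]]
        linear_on_smult[OF resolution_linear[OF resolution] xj component_elems[OF h(1)]] h(2) by (simp add: v_def)
    then have "bdry F ?y = 0" using w(2) by simp
    moreover have "single j (Suc 0) \<noteq> 0"
      by (metis lookup_single_eq lookup_zero nat.distinct(1))
    then have "lookup (lookup ?y b) 0 \<noteq> 0"
      by (simp add: lookup_minus lookup_times_0 lookup_single)
    ultimately show False using unit_coefficient_not_cycle[OF component_diff[OF e xh]] by blast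
  qed
  ultimately show ?case by (cases "mdeg F b j \<le> 1") auto
qed

section \<open>The dehomogenized algebra\<close>

definition support :: "'b \<Rightarrow> nat set" where
  "support b = {j. mdeg F b j = 1}"

definition filt :: "nat set \<Rightarrow> nat \<Rightarrow> ('b \<Rightarrow>\<^sub>0 'k) set" where
  "filt A i = {x. \<forall>b\<in>keys x. b \<in> basis F \<and> hdeg F b = i \<and> support b \<subseteq> A}"

definition indicator_degree :: "nat set \<Rightarrow> nat \<Rightarrow> int" where
  "indicator_degree A j = (if j \<in> A then 1 else 0)"

text \<open>For \<open>A \<subseteq> {..<n}\<close> this is, on \<open>filt A i\<close>, the inverse of setting the variables to \<open>1\<close>, with values in degree
  \<open>indicator_degree A\<close>.\<close>

definition homogenize :: "nat set \<Rightarrow> ('b \<Rightarrow>\<^sub>0 'k) \<Rightarrow> ('b, 'k) fvec" where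
  "homogenize A x = Poly_Mapping.mapp (\<lambda>b. single (squarefree_monomial (A - support b))) x"

lemma support_bound: "b \<in> basis F \<Longrightarrow> support b \<subseteq> {..<n}"
  using mdeg_beyond unfolding support_def by (metis (mono_tags, lifting) lessThan_iff linorder_not_less mem_Collect_eq subsetI zero_neq_one)

lemma mdeg_support: "b \<in> basis F \<Longrightarrow> mdeg F b j = (if j \<in> support b then 1 else 0)"
  using mdeg_squarefree[of b j] by (auto simp: support_def)

lemma lookup_homogenize: "lookup (homogenize A x) b =
    single (squarefree_monomial (A - support b)) (lookup x b)"
  by (auto simp: homogenize_def lookup_mapp when_def in_keys_iff)

lemma dehom_homogenize [simp]: "dehom (homogenize A x) = x"
  by (rule poly_mapping_eqI) (simp add: lookup_homogenize)

text \<open>\<open>homogenize\<close> needs a finite set of variables, while \<open>A\<close> may be infinite.\<close>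

lemma filt_restrict: "filt A i = filt (A \<inter> {..<n}) i"
  using support_bound unfolding filt_def by blast

lemma homogenize_in:
  assumes x: "x \<in> filt A i" and A: "A \<subseteq> {..<n}"
  shows "homogenize A x \<in> component n F i" "homogenize A x \<in> homogeneous n F (indicator_degree A)"
proof -
  have fin: "finite (A - support b)" for b using A finite_subset by blast
  have k: "b \<in> keys x \<and> m = squarefree_monomial (A - support b)"
    if "m \<in> keys (lookup (homogenize A x) b)" for b m
    using that by (auto simp: lookup_homogenize in_keys_iff split: if_splits)
  have "b \<in> keys x" if "b \<in> keys (homogenize A x)" for b
    using that by (auto simp: in_keys_iff lookup_homogenize)
  moreover have "lookup (homogenize A x) b \<in> polyring n" for b
    unfolding lookup_homogenize using A keys_squarefree_monomial[OF fin] by (intro polyring_single) auto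
  ultimately show c: "homogenize A x \<in> component n F i"
    using x unfolding component_iff filt_def by simp
  show "homogenize A x \<in> homogeneous n F (indicator_degree A)"
  proof (rule homogeneousI[OF component_elems[OF c]])
    fix b m j assume "m \<in> keys (lookup (homogenize A x) b)"
    then have b: "b \<in> keys x" "m = squarefree_monomial (A - support b)" using k by blast+
    then have "b \<in> basis F" "support b \<subseteq> A" using x by (simp_all add: filt_def)
    then show "int (lookup m j) + mdeg F b j = indicator_degree A j"
      unfolding b(2) lookup_squarefree_monomial[OF fin] mdeg_support[OF \<open>b \<in> basis F\<close>] indicator_degree_def by auto
  qed
qed

text \<open>Since the basis elements have squarefree degrees, those that occur in an element of degree \<open>a\<close> are
  supported where \<open>a\<close> is positive, however large its entries are. For this reason the degree \<open>a\<close> of a product matters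
  only through its support, and products do not leave the filtration.\<close>

lemma dehom_filt:
  assumes v: "v \<in> component n F i" "v \<in> homogeneous n F a" and a: "\<And>j. j \<notin> A \<Longrightarrow> a j \<le> 0"
  shows "dehom v \<in> filt A i"
  unfolding filt_def mem_Collect_eq
proof (intro ballI)
  fix b assume "b \<in> keys (dehom v)"
  then have b: "b \<in> keys v" using keys_dehom[of v] by blast
  note B = component_keys[OF v(1) b]
  obtain m c where m: "\<And>j. int (lookup m j) + mdeg F b j = a j"
    using homogeneous_coefficient[OF v(2) b] by blast
  have "j \<in> A" if "j \<in> support b" for j
    using m[of j] a[of j] that by (auto simp: support_def)
  with B show "b \<in> basis F \<and> hdeg F b = i \<and> support b \<subseteq> A" by blast
qed

lemma lift_const_filt: "x \<in> filt A i \<Longrightarrow> lift_const x \<in> component n F i"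
  by (rule lift_const_component) (auto simp: filt_def tensor_component_def)

definition dehom_d :: "('b \<Rightarrow>\<^sub>0 'k) \<Rightarrow> ('b \<Rightarrow>\<^sub>0 'k)" where
  "dehom_d x = dehom (bdry F (lift_const x))"

lemma dehom_bdry:
  assumes "v \<in> elems n F" "lift_const (dehom v) \<in> elems n F" shows "dehom (bdry F v) = dehom_d (dehom v)"
  unfolding dehom_d_def
  by (rule dehom_linear_cong[OF resolution_linear[OF resolution] assms]) simp

lemma dehom_lift_elems: assumes "v \<in> elems n F" shows "lift_const (dehom v) \<in> elems n F"
  using assms keys_dehom[of v] unfolding elems_def by auto

text \<open>The homogenization \<open>v\<close> of a cycle is a cycle, because setting the variables to \<open>1\<close> is injective in each
  degree. If \<open>\<partial> u = v\<close>, then the homogeneous part of \<open>u\<close> in the degree of \<open>v\<close> also has the boundary \<open>v\<close>, and it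
  dehomogenizes into the filtration.\<close>

lemma dehom_d_exact:
  assumes x: "x \<in> filt A (Suc i)" and dx: "dehom_d x = 0"
  shows "\<exists>y\<in>filt A (Suc (Suc i)). dehom_d y = x"
proof -
  let ?A = "A \<inter> {..<n}"
  have xA: "x \<in> filt ?A (Suc i)" using x filt_restrict[of A] by simp
  define v where "v = homogenize ?A x"
  have v: "v \<in> component n F (Suc i)" "v \<in> homogeneous n F (indicator_degree ?A)"
    unfolding v_def by (rule homogenize_in[OF xA]; simp)+
  have dv: "dehom v = x" by (simp add: v_def)
  have "dehom (bdry F v) = 0"
    using dehom_bdry[OF component_elems[OF v(1)] dehom_lift_elems[OF component_elems[OF v(1)]]] dv dx by simp
  then have "bdry F v = 0" by (rule dehom_inject_homogeneous[OF bdry_homogeneous[OF v(2)]])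
  then obtain u where u: "u \<in> component n F (Suc (Suc i))" "bdry F u = v"
    using resolution_exact[OF resolution v(1)] by blast
  define y where "y = part F (indicator_degree ?A) u"
  have y: "y \<in> component n F (Suc (Suc i))" "y \<in> homogeneous n F (indicator_degree ?A)"
    unfolding y_def by (rule part_in[OF u(1)])+
  have "bdry F y = v"
    unfolding y_def bdry_part[OF graded_resolution component_elems[OF u(1)]] u(2)
      part_homogeneous[OF v(2)] by simp
  then have "dehom_d (dehom y) = x"
    using dehom_bdry[OF component_elems[OF y(1)] dehom_lift_elems[OF component_elems[OF y(1)]]] dv by simp
  moreover have "dehom y \<in> filt A (Suc (Suc i))"
    by (rule dehom_filt[OF y]) (auto simp: indicator_degree_def)
  ultimately show ?thesis by blast
qed

context
  fixes mul
  assumes dga: "dga_structure n F mul"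
begin

definition dehom_mult :: "('b \<Rightarrow>\<^sub>0 'k) \<Rightarrow> ('b \<Rightarrow>\<^sub>0 'k) \<Rightarrow> ('b \<Rightarrow>\<^sub>0 'k)" where
  "dehom_mult x y = dehom (mul (lift_const x) (lift_const y))"

lemma mul_bilinear: "bilinear_mult n F mul"
  using dga unfolding dga_structure_def by (elim conjE)

lemma mul_elems: "v \<in> elems n F \<Longrightarrow> w \<in> elems n F \<Longrightarrow> mul v w \<in> elems n F"
  using mul_bilinear unfolding bilinear_mult_def by (elim conjE) blast

lemma mul_linear_left: "w \<in> elems n F \<Longrightarrow> linear_on n (elems n F) (\<lambda>v. mul v w)"
  and mul_linear_right: "w \<in> elems n F \<Longrightarrow> linear_on n (elems n F) (mul w)"
  using mul_bilinear unfolding bilinear_mult_def linear_on_def by simp_all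

lemma mul_homogeneous:
  "v \<in> homogeneous n F a \<Longrightarrow> w \<in> homogeneous n F b \<Longrightarrow> mul v w \<in> homogeneous n F (\<lambda>j. a j + b j)"
  using dga unfolding dga_structure_def by (elim conjE) blast

lemma mul_gen0: "p \<in> polyring n \<Longrightarrow> q \<in> polyring n \<Longrightarrow>
    mul (single (gen0 F) p) (single (gen0 F) q) = single (gen0 F) (p * q)"
  using dga unfolding dga_structure_def by (elim conjE) blast

lemma mul_component:
  assumes "v \<in> component n F i" "w \<in> component n F j"
  shows "bdry F (mul v w) = mul (bdry F v) w + smult ((- 1) ^ i) (mul v (bdry F w))"
    "mul v w \<in> component n F (i + j)" "mul v w = smult ((- 1) ^ (i * j)) (mul w v)"
proof -
  have "\<forall>i j. \<forall>a\<in>component n F i. \<forall>b\<in>component n F j.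
        bdry F (mul a b) = mul (bdry F a) b + smult ((- 1) ^ i) (mul a (bdry F b)) \<and>
        mul a b \<in> component n F (i + j) \<and>
        mul a b = smult ((- 1) ^ (i * j)) (mul b a)"
    using dga unfolding dga_structure_def by (elim conjE)
  note * = this[rule_format, OF assms]
  show "bdry F (mul v w) = mul (bdry F v) w + smult ((- 1) ^ i) (mul v (bdry F w))"
    by (rule conjunct1[OF *])
  show "mul v w \<in> component n F (i + j)"
    by (rule conjunct1[OF conjunct2[OF *]])
  show "mul v w = smult ((- 1) ^ (i * j)) (mul w v)"
    by (rule conjunct2[OF conjunct2[OF *]])
qed

lemma mul_assoc:
  "u \<in> elems n F \<Longrightarrow> v \<in> elems n F \<Longrightarrow> w \<in> elems n F \<Longrightarrow> mul (mul u v) w = mul u (mul v w)"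
  using dga unfolding dga_structure_def by (elim conjE) blast

lemma dehom_mul:
  assumes v: "v \<in> elems n F" and w: "w \<in> elems n F"
  shows "dehom (mul v w) = dehom_mult (dehom v) (dehom w)"
proof -
  note l = dehom_lift_elems[OF v] dehom_lift_elems[OF w]
  have "dehom (mul v w) = dehom (mul (lift_const (dehom v)) w)"
    by (rule dehom_linear_cong[OF mul_linear_left[OF w] v l(1)]) simp
  also have "\<dots> = dehom (mul (lift_const (dehom v)) (lift_const (dehom w)))"
    by (rule dehom_linear_cong[OF mul_linear_right[OF l(1)] w l(2)]) simp
  finally show ?thesis by (simp add: dehom_mult_def)
qed

lemma eval_1_sign: "eval_1 ((- 1) ^ i :: 'k mpoly) = (- 1) ^ i"
  by (simp add: neg_one_power_eq_single)

lemma dehom_filtered_dga: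
  assumes "I \<noteq> {0}"
  shows "filtered_dga (basis F) (hdeg F) support (gen0 F) dehom_d dehom_mult n filt"
proof
  note lin = resolution_linear[OF resolution]
  have L: "lift_const x \<in> component n F i" "lift_const x \<in> elems n F" if "x \<in> filt UNIV i" for x i
    using lift_const_filt[OF that] component_elems by blast+
  have FU: "filt A i \<subseteq> filt UNIV i" for A i by (auto simp: filt_def)
  show "filt A i = {x. \<forall>b\<in>keys x. b \<in> basis F \<and> hdeg F b = i \<and> support b \<subseteq> A}" for A i
    by (rule filt_def)
  show "b \<in> basis F \<and> hdeg F b = 0 \<longleftrightarrow> b = gen0 F" for b by (rule resolution_degree_0[OF resolution])
  show "support (gen0 F) = {}" by (simp add: support_def mdeg_gen0)
  show "support b \<subseteq> {..<n}" if "b \<in> basis F" for b using that by (rule support_bound)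
  show "dehom_d (x + y) = dehom_d x + dehom_d y" if "x \<in> filt UNIV i" "y \<in> filt UNIV i" for x y i
    using linear_on_add[OF lin L(2)[OF that(1)] L(2)[OF that(2)]]
    by (simp add: dehom_d_def lift_const_add dehom_add)
  show "dehom_d (scale c x) = scale c (dehom_d x)" if "x \<in> filt UNIV i" for x i c
    using linear_on_smult[OF lin _ L(2)[OF that], of "single 0 c"]
    by (simp add: dehom_d_def lift_const_scale dehom_smult)
  show "dehom_d x = 0" if "x \<in> filt UNIV 0" for x
    using resolution_bdry_0[OF resolution L(1)[OF that]] by (simp add: dehom_d_def)
  show "dehom_d x \<in> filt A i" if x: "x \<in> filt A (Suc i)" for x A i
  proof -
    let ?A = "A \<inter> {..<n}"
    have xA: "x \<in> filt ?A (Suc i)" using x filt_restrict[of A] by simp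
    note h = homogenize_in[OF xA]
    have c: "homogenize ?A x \<in> component n F (Suc i)" by (rule h) simp
    have "dehom (bdry F (homogenize ?A x)) \<in> filt A i"
      by (rule dehom_filt[OF resolution_bdry_component[OF resolution c] bdry_homogeneous[OF h(2)]])
        (auto simp: indicator_degree_def)
    then show ?thesis
      using dehom_bdry[OF component_elems[OF c] dehom_lift_elems[OF component_elems[OF c]]] by simp
  qed
  show "dehom_d (dehom_d x) = 0" if "x \<in> filt UNIV i" for x i
  proof -
    have "bdry F (lift_const x) \<in> elems n F" by (rule resolution_bdry_elems[OF resolution L(2)[OF that]])
    from dehom_bdry[OF this dehom_lift_elems[OF this]] show ?thesis
      using resolution_bdry_bdry[OF resolution L(1)[OF that]] by (simp add: dehom_d_def)
  qed
  show "support c \<subset> support b"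
    if b: "b \<in> basis F" and c: "c \<in> keys (dehom_d (single b 1))" for b c
  proof -
    let ?v = "bdry F (single b 1)"
    have ck: "c \<in> keys ?v" using c keys_dehom[of ?v] by (auto simp: dehom_d_def)
    have e: "single b 1 \<in> elems n F" using b by simp
    have cB: "c \<in> basis F" using elems_keys[OF resolution_bdry_elems[OF resolution e] ck] .
    obtain m t where m: "lookup ?v c = single m t" "t \<noteq> 0"
      "\<And>j. int (lookup m j) + mdeg F c j = mdeg F b j"
      using homogeneous_coefficient[OF bdry_homogeneous[OF basis_homogeneous[OF b]] ck] by metis
    have "m \<noteq> 0" using minimal_resolution[OF e, of c] m(1,2) by auto
    then obtain j where j: "lookup m j \<noteq> 0" by (metis poly_mapping_eqI lookup_zero)
    have "mdeg F c j' \<le> mdeg F b j'" for j' using m(3)[of j'] by simp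
    then have "support c \<subseteq> support b"
      using mdeg_support[OF cB] mdeg_support[OF b] by (smt (verit, best) subsetI)
    moreover have "j \<in> support b" "j \<notin> support c"
      using m(3)[of j] j mdeg_support[OF cB, of j] mdeg_support[OF b, of j] by (auto split: if_splits)
    ultimately show ?thesis by blast
  qed
  show "\<exists>y\<in>filt A (Suc (Suc i)). dehom_d y = x" if "x \<in> filt A (Suc i)" "dehom_d x = 0" for x A i
    using that by (rule dehom_d_exact)
  show "dehom_mult x y \<in> filt (A \<union> A') (i + j)" if x: "x \<in> filt A i" and y: "y \<in> filt A' j" for x y A A' i j
  proof -
    let ?A = "A \<inter> {..<n}" and ?A' = "A' \<inter> {..<n}"
    have xA: "x \<in> filt ?A i" and yA: "y \<in> filt ?A' j"
      using x y filt_restrict[of A] filt_restrict[of A'] by simp_all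
    have hx: "homogenize ?A x \<in> component n F i" "homogenize ?A x \<in> homogeneous n F (indicator_degree ?A)"
      by (rule homogenize_in[OF xA]; simp)+
    have hy: "homogenize ?A' y \<in> component n F j" "homogenize ?A' y \<in> homogeneous n F (indicator_degree ?A')"
      by (rule homogenize_in[OF yA]; simp)+
    have "dehom (mul (homogenize ?A x) (homogenize ?A' y)) \<in> filt (A \<union> A') (i + j)"
      by (rule dehom_filt[OF mul_component(2)[OF hx(1) hy(1)] mul_homogeneous[OF hx(2) hy(2)]])
        (auto simp: indicator_degree_def)
    then show ?thesis
      using dehom_mul[OF component_elems[OF hx(1)] component_elems[OF hy(1)]] by simp
  qed
  show "dehom_mult (x + x') y = dehom_mult x y + dehom_mult x' y"
    if "x \<in> filt UNIV i" "x' \<in> filt UNIV i" "y \<in> filt UNIV j" for x x' y i j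
    using linear_on_add[OF mul_linear_left[OF L(2)[OF that(3)]] L(2)[OF that(1)] L(2)[OF that(2)]]
    by (simp add: dehom_mult_def lift_const_add dehom_add)
  show "dehom_mult x (y + y') = dehom_mult x y + dehom_mult x y'"
    if "x \<in> filt UNIV i" "y \<in> filt UNIV j" "y' \<in> filt UNIV j" for x y y' i j
    using linear_on_add[OF mul_linear_right[OF L(2)[OF that(1)]] L(2)[OF that(2)] L(2)[OF that(3)]]
    by (simp add: dehom_mult_def lift_const_add dehom_add)
  show "dehom_mult (scale c x) y = scale c (dehom_mult x y)" if "x \<in> filt UNIV i" "y \<in> filt UNIV j" for x y c i j
    using linear_on_smult[OF mul_linear_left[OF L(2)[OF that(2)]] _ L(2)[OF that(1)], of "single 0 c"]
    by (simp add: dehom_mult_def lift_const_scale dehom_smult)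
  show "dehom_mult x (scale c y) = scale c (dehom_mult x y)" if "x \<in> filt UNIV i" "y \<in> filt UNIV j" for x y c i j
    using linear_on_smult[OF mul_linear_right[OF L(2)[OF that(1)]] _ L(2)[OF that(2)], of "single 0 c"]
    by (simp add: dehom_mult_def lift_const_scale dehom_smult)
  show "dehom_mult (dehom_mult x y) z = dehom_mult x (dehom_mult y z)"
    if "x \<in> filt UNIV i" "y \<in> filt UNIV j" "z \<in> filt UNIV l" for x y z i j l
    using dehom_mul[OF mul_elems[OF L(2)[OF that(1)] L(2)[OF that(2)]] L(2)[OF that(3)]]
      dehom_mul[OF L(2)[OF that(1)] mul_elems[OF L(2)[OF that(2)] L(2)[OF that(3)]]]
      mul_assoc[OF L(2)[OF that(1)] L(2)[OF that(2)] L(2)[OF that(3)]]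
    by (simp add: dehom_mult_def)
  show "dehom_mult x y = scale ((- 1) ^ (i * j)) (dehom_mult y x)"
    if "x \<in> filt UNIV i" "y \<in> filt UNIV j" for x y i j
    using arg_cong[OF mul_component(3)[OF L(1)[OF that(1)] L(1)[OF that(2)]], of dehom]
    by (simp add: dehom_mult_def dehom_smult eval_1_sign)
  show "dehom_d (dehom_mult x y) = dehom_mult (dehom_d x) y + scale ((- 1) ^ i) (dehom_mult x (dehom_d y))"
    if "x \<in> filt UNIV i" "y \<in> filt UNIV j" for x y i j
  proof -
    note X = L[OF that(1)] and Y = L[OF that(2)]
    note bX = resolution_bdry_elems[OF resolution X(2)] and bY = resolution_bdry_elems[OF resolution Y(2)]
    have "dehom (bdry F (mul (lift_const x) (lift_const y))) = dehom_d (dehom_mult x y)"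
      using dehom_bdry[OF mul_elems[OF X(2) Y(2)] dehom_lift_elems[OF mul_elems[OF X(2) Y(2)]]]
      by (simp add: dehom_mult_def)
    moreover have "dehom (mul (bdry F (lift_const x)) (lift_const y)) = dehom_mult (dehom_d x) y"
      using dehom_mul[OF bX Y(2)] by (simp add: dehom_d_def)
    moreover have "dehom (mul (lift_const x) (bdry F (lift_const y))) = dehom_mult x (dehom_d y)"
      using dehom_mul[OF X(2) bY] by (simp add: dehom_d_def)
    ultimately show ?thesis
      using arg_cong[OF mul_component(1)[OF X(1) Y(1)], of dehom]
      by (simp add: dehom_add dehom_smult eval_1_sign)
  qed
  show "dehom_mult (single (gen0 F) 1) (single (gen0 F) 1) = single (gen0 F) 1"
    using arg_cong[OF mul_gen0[of 1 1], of dehom] dehom_lift_const[of "single (gen0 F) 1"]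
    by (simp add: dehom_mult_def)
  show "\<exists>b\<in>basis F. hdeg F b = 1"
  proof -
    have "0 \<in> I"
      using I unfolding squarefree_monomial_ideal_def ideal_generated_def by (fastforce intro: exI[of _ "{}"])
    then obtain p where "p \<in> I" "p \<noteq> 0" using assms by blast
    then obtain v where v: "v \<in> component n F 1" "bdry F v = single (gen0 F) p"
      using resolution_image[OF resolution] by (metis imageE image_eqI)
    have "v \<noteq> 0"
    proof
      assume "v = 0"
      then have "single (gen0 F) p = 0" using v(2) resolution_bdry_zero[OF resolution] by simp
      then show False using \<open>p \<noteq> 0\<close> by (metis lookup_single_eq lookup_zero)
    qed
    then obtain b where "b \<in> keys v" by (metis ex_in_conv keys_eq_empty)
    then show ?thesis using component_keys[OF v(1)] by blast
  qed
qed

end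

lemma minimal_complex: "minimal_complex n F"
  unfolding minimal_complex_def using minimal_resolution by (auto intro!: poly_mapping_eqI)

end

theorem betti_numbers_of_dga_resolution:
  fixes I :: "'k::field mpoly set"
  assumes I: "squarefree_monomial_ideal n I" "I \<noteq> {0}" and dga: "minimal_resolution_is_DGA n I"
  shows "\<exists>\<Delta> :: nat set set. simplicial_complex \<Delta> \<and> is_cone \<Delta> \<and> (\<forall>i. f_vector \<Delta> i = betti n I i)"
proof -
  obtain F :: "(nat, 'k) graded_free_complex" and mul
    where F: "minimal_graded_free_resolution n I F" and mul: "dga_structure n F mul"
    using dga unfolding minimal_resolution_is_DGA_def by blast
  from filtered_dga.filtered_dga_cone[OF dehom_filtered_dga[OF I(1) F mul I(2)]]
  obtain \<Delta> :: "nat set set" where \<Delta>: "simplicial_complex \<Delta>" "is_cone \<Delta>"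
    "\<And>i. finite {b \<in> basis F. hdeg F b = i} \<and> f_vector \<Delta> i = card {b \<in> basis F. hdeg F b = i}"
    by auto
  have "f_vector \<Delta> i = betti n I i" for i
    using betti_eq_card[OF resolution[OF I(1) F] minimal_complex[OF I(1) F], of i] \<Delta>(3)[of i] by simp
  with \<Delta>(1,2) show ?thesis by blast
qed

section \<open>The exterior algebra on the natural numbers\<close>

text \<open>An element of the exterior algebra is given by its coefficients at the products
  \<open>e\<^sub>S\<close> of the generators in \<open>S\<close> in increasing order. The sign in \<open>e\<^sub>S \<and> e\<^sub>T\<close> counts the pairs that
  are out of order. All operations vanish on infinite sets, since sums over infinite sets are \<open>0\<close>.\<close>

definition crossings :: "nat set \<Rightarrow> nat set \<Rightarrow> nat" where
  "crossings S T = card {(s, t). s \<in> S \<and> t \<in> T \<and> t < s}"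

definition below :: "nat \<Rightarrow> nat set \<Rightarrow> nat" where
  "below i S = card {s \<in> S. s < i}"

definition wedge :: "(nat set \<Rightarrow> 'r::comm_ring_1) \<Rightarrow> (nat set \<Rightarrow> 'r) \<Rightarrow> nat set \<Rightarrow> 'r" where
  "wedge \<phi> \<psi> U = (\<Sum>S\<in>Pow U. (- 1) ^ crossings S (U - S) * \<phi> S * \<psi> (U - S))"

definition contract :: "nat \<Rightarrow> (nat set \<Rightarrow> 'r::comm_ring_1) \<Rightarrow> nat set \<Rightarrow> 'r" where
  "contract i \<phi> U = (if i \<in> U then 0 else (- 1) ^ below i U * \<phi> (insert i U))"

definition alternate :: "(nat set \<Rightarrow> 'r::comm_ring_1) \<Rightarrow> nat set \<Rightarrow> 'r" where
  "alternate \<phi> U = (- 1) ^ card U * \<phi> U"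

definition unit_vec :: "nat set \<Rightarrow> nat set \<Rightarrow> 'r::comm_ring_1" where
  "unit_vec T S = (if S = T then 1 else 0)"

lemma finite_crossings: "finite S \<Longrightarrow> finite T \<Longrightarrow> finite {(s, t). s \<in> S \<and> t \<in> T \<and> t < (s::nat)}"
  by (rule finite_subset[of _ "S \<times> T"]) auto

lemma crossings_Un_left:
  assumes "finite A" "finite B" "finite T" "A \<inter> B = {}"
  shows "crossings (A \<union> B) T = crossings A T + crossings B T"
proof -
  have "{(s, t). s \<in> A \<union> B \<and> t \<in> T \<and> t < s} =
      {(s, t). s \<in> A \<and> t \<in> T \<and> t < s} \<union> {(s, t). s \<in> B \<and> t \<in> T \<and> t < s}" by auto
  then show ?thesis
    unfolding crossings_def using assms by (simp add: card_Un_disjoint finite_crossings disjoint_iff)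
qed

lemma crossings_Un_right:
  assumes "finite A" "finite B" "finite S" "A \<inter> B = {}"
  shows "crossings S (A \<union> B) = crossings S A + crossings S B"
proof -
  have "{(s, t). s \<in> S \<and> t \<in> A \<union> B \<and> t < s} =
      {(s, t). s \<in> S \<and> t \<in> A \<and> t < s} \<union> {(s, t). s \<in> S \<and> t \<in> B \<and> t < s}" by auto
  then show ?thesis
    unfolding crossings_def using assms by (simp add: card_Un_disjoint finite_crossings disjoint_iff)
qed

lemma crossings_swap:
  assumes "finite S" "finite T" "S \<inter> T = {}"
  shows "crossings S T + crossings T S = card S * card T"
proof -
  have "card {(s, t). s \<in> T \<and> t \<in> S \<and> t < s} = card {(s, t). s \<in> S \<and> t \<in> T \<and> s < t}"
    by (rule bij_betw_same_card[of prod.swap]) (auto simp: bij_betw_def inj_on_def image_iff)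
  moreover have "{(s, t). s \<in> S \<and> t \<in> T \<and> t < s} \<union> {(s, t). s \<in> S \<and> t \<in> T \<and> s < t} = S \<times> T"
    using assms(3) by (auto simp: disjoint_iff) (metis linorder_neqE_nat)
  moreover have "card ({(s, t). s \<in> S \<and> t \<in> T \<and> t < s} \<union> {(s, t). s \<in> S \<and> t \<in> T \<and> s < t}) =
      card {(s, t). s \<in> S \<and> t \<in> T \<and> t < s} + card {(s, t). s \<in> S \<and> t \<in> T \<and> s < t}"
    by (rule card_Un_disjoint)
      (auto intro: finite_subset[OF _ finite_cartesian_product[OF assms(1,2)]])
  ultimately show ?thesis
    using assms by (simp add: crossings_def card_cartesian_product)
qed

lemma crossings_single_left: "crossings {i} T = below i T"
  unfolding crossings_def below_def
  by (rule bij_betw_same_card[of snd]) (auto simp: bij_betw_def inj_on_def image_iff)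

lemma crossings_single_right:
  assumes "finite S" "i \<notin> S" shows "crossings S {i} + below i S = card S"
  using crossings_swap[of S "{i}"] assms by (simp add: crossings_single_left)

lemma crossings_insert_left:
  "finite S \<Longrightarrow> finite T \<Longrightarrow> i \<notin> S \<Longrightarrow> crossings (insert i S) T = crossings S T + below i T"
  using crossings_Un_left[of "{i}" S T] by (simp add: crossings_single_left)

lemma crossings_insert_right:
  "finite S \<Longrightarrow> finite T \<Longrightarrow> i \<notin> T \<Longrightarrow> i \<notin> S \<Longrightarrow>
    crossings S (insert i T) + below i S = crossings S T + card S"
  using crossings_Un_right[of "{i}" T S] crossings_single_right[of S i] by simp

lemma crossings_empty [simp]: "crossings {} T = 0" "crossings S {} = 0"
  by (simp_all add: crossings_def)

lemma below_Un: "finite S \<Longrightarrow> finite T \<Longrightarrow> S \<inter> T = {} \<Longrightarrow> below i (S \<union> T) = below i S + below i T"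
  using crossings_Un_right[of S T "{i}"] by (simp add: crossings_single_left)

lemma below_insert:
  assumes "j \<notin> S" shows "below i (insert j S) = below i S + (if j < i then 1 else 0)"
proof -
  have "{s \<in> insert j S. s < i} = (if j < i then insert j {s \<in> S. s < i} else {s \<in> S. s < i})" by auto
  moreover have "finite {s \<in> S. s < i}" by (rule finite_subset[of _ "{..<i}"]) auto
  ultimately show ?thesis using assms by (simp add: below_def)
qed

lemma sign_eqI: "even (a + b) \<Longrightarrow> (- 1 :: 'r::comm_ring_1) ^ a = (- 1) ^ b"
  and sign_oppI: "odd (a + b) \<Longrightarrow> (- 1 :: 'r::comm_ring_1) ^ a = - ((- 1) ^ b)"
  by (auto simp: minus_one_power_iff)

lemma wedge_infinite: "infinite U \<Longrightarrow> wedge \<phi> \<psi> U = 0"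
  by (simp add: wedge_def)

lemma wedge_add_left: "wedge (\<lambda>U. \<phi> U + \<phi>' U) \<psi> U = wedge \<phi> \<psi> U + wedge \<phi>' \<psi> U"
  and wedge_add_right: "wedge \<phi> (\<lambda>U. \<psi> U + \<psi>' U) U = wedge \<phi> \<psi> U + wedge \<phi> \<psi>' U"
  and wedge_diff_right: "wedge \<phi> (\<lambda>U. \<psi> U - \<psi>' U) U = wedge \<phi> \<psi> U - wedge \<phi> \<psi>' U"
  by (simp_all add: wedge_def algebra_simps sum.distrib sum_subtractf)

lemma wedge_smult_left: "wedge (\<lambda>U. p * \<phi> U) \<psi> U = p * wedge \<phi> \<psi> U"
  and wedge_smult_right: "wedge \<phi> (\<lambda>U. p * \<psi> U) U = p * wedge \<phi> \<psi> U"
  by (auto simp: wedge_def sum_distrib_left mult_ac intro!: sum.cong)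

lemma wedge_uminus_left: "wedge (\<lambda>U. - \<phi> U) \<psi> U = - wedge \<phi> \<psi> U"
  and wedge_uminus_right: "wedge \<phi> (\<lambda>U. - \<psi> U) U = - wedge \<phi> \<psi> U"
  using wedge_smult_left[of "- 1" \<phi> \<psi> U] wedge_smult_right[of \<phi> "- 1" \<psi> U] by simp_all

lemma wedge_zero_left: "wedge (\<lambda>U. 0) \<psi> U = 0" and wedge_zero_right: "wedge \<phi> (\<lambda>U. 0) U = 0"
  by (simp_all add: wedge_def)

lemma wedge_sum_left: "wedge (\<lambda>U. \<Sum>i\<in>A. \<phi> i U) \<psi> U = (\<Sum>i\<in>A. wedge (\<phi> i) \<psi> U)"
  by (induction A rule: infinite_finite_induct) (simp_all add: wedge_zero_left wedge_add_left)

lemma wedge_sum_right: "wedge \<phi> (\<lambda>U. \<Sum>i\<in>A. \<psi> i U) U = (\<Sum>i\<in>A. wedge \<phi> (\<psi> i) U)"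
  by (induction A rule: infinite_finite_induct) (simp_all add: wedge_zero_right wedge_add_right)

lemma wedge_cong:
  "(\<And>S. S \<subseteq> U \<Longrightarrow> \<phi> S = \<phi>' S) \<Longrightarrow> (\<And>S. S \<subseteq> U \<Longrightarrow> \<psi> S = \<psi>' S) \<Longrightarrow> wedge \<phi> \<psi> U = wedge \<phi>' \<psi>' U"
  unfolding wedge_def by (intro sum.cong) auto

lemma wedge_unit_vec_left:
  "wedge (unit_vec T) \<psi> U = (if finite U \<and> T \<subseteq> U then (- 1) ^ crossings T (U - T) * \<psi> (U - T) else 0)"
proof (cases "finite U")
  case True
  have "wedge (unit_vec T) \<psi> U = (\<Sum>S\<in>Pow U. if S = T then (- 1) ^ crossings S (U - S) * \<psi> (U - S) else 0)"
    unfolding wedge_def unit_vec_def by (intro sum.cong) auto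
  also have "\<dots> = (if T \<in> Pow U then (- 1) ^ crossings T (U - T) * \<psi> (U - T) else 0)"
    using True by (subst sum.delta) auto
  finally show ?thesis using True by simp
qed (simp add: wedge_infinite)

lemma wedge_assoc: "wedge (wedge \<phi> \<psi>) \<chi> U = wedge \<phi> (wedge \<psi> \<chi>) U"
proof (cases "finite U")
  case True
  let ?f = "\<lambda>P Q R. (- 1) ^ (crossings P Q + crossings P R + crossings Q R) * \<phi> P * \<psi> Q * \<chi> R"
  have "wedge (wedge \<phi> \<psi>) \<chi> U = (\<Sum>S\<in>Pow U. \<Sum>P\<in>Pow S. ?f P (S - P) (U - S))"
  proof -
    have "(- 1) ^ crossings S (U - S) * ((- 1) ^ crossings P (S - P) * \<phi> P * \<psi> (S - P)) * \<chi> (U - S)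
        = ?f P (S - P) (U - S)" if "S \<subseteq> U" "P \<subseteq> S" for S P
    proof -
      have "crossings S (U - S) = crossings P (U - S) + crossings (S - P) (U - S)"
        using crossings_Un_left[of P "S - P" "U - S"] that True finite_subset[OF that(1)] finite_subset[OF that(2)]
        by (auto simp: Un_absorb1)
      then show ?thesis by (simp add: power_add mult_ac)
    qed
    then show ?thesis
      unfolding wedge_def sum_distrib_left sum_distrib_right by (intro sum.cong) auto
  qed
  also have "\<dots> = (\<Sum>(S, P)\<in>Sigma (Pow U) Pow. ?f P (S - P) (U - S))"
    using True by (subst sum.Sigma) (auto intro: finite_subset)
  also have "\<dots> = (\<Sum>(P, Q)\<in>Sigma (Pow U) (\<lambda>P. Pow (U - P)). ?f P Q (U - P - Q))"
    by (rule sum.reindex_bij_witness[where i = "\<lambda>(P, Q). (P \<union> Q, P)" and j = "\<lambda>(S, P). (P, S - P)"])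
      (auto intro!: arg_cong2[where f = "(*)"] arg_cong2[where f = "(^)"] arg_cong2[where f = "(+)"]
        arg_cong2[where f = crossings] arg_cong[where f = \<chi>])
  also have "\<dots> = (\<Sum>P\<in>Pow U. \<Sum>Q\<in>Pow (U - P). ?f P Q (U - P - Q))"
    using True by (subst sum.Sigma) (auto intro: finite_subset)
  also have "\<dots> = wedge \<phi> (wedge \<psi> \<chi>) U"
  proof -
    have "(- 1) ^ crossings P (U - P) * \<phi> P * ((- 1) ^ crossings Q (U - P - Q) * \<psi> Q * \<chi> (U - P - Q))
        = ?f P Q (U - P - Q)" if "P \<subseteq> U" "Q \<subseteq> U - P" for P Q
    proof -
      have "finite P" "finite Q" "finite (U - P - Q)" using True that by (auto intro: finite_subset)
      moreover have "U - P = Q \<union> (U - P - Q)" using that by auto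
      ultimately have "crossings P (U - P) = crossings P Q + crossings P (U - P - Q)"
        using crossings_Un_right[of Q "U - P - Q" P] by auto
      then show ?thesis by (simp add: power_add mult_ac)
    qed
    then show ?thesis
      unfolding wedge_def sum_distrib_left by (intro sum.cong) auto
  qed
  finally show ?thesis .
qed (simp add: wedge_infinite)

lemma wedge_commute:
  assumes \<phi>: "\<And>S. finite S \<Longrightarrow> card S \<noteq> i \<Longrightarrow> \<phi> S = 0" and \<psi>: "\<And>S. finite S \<Longrightarrow> card S \<noteq> j \<Longrightarrow> \<psi> S = 0"
  shows "wedge \<phi> \<psi> U = (- 1) ^ (i * j) * wedge \<psi> \<phi> U"
proof (cases "finite U")
  case True
  have "(- 1) ^ crossings (U - S) S * \<phi> (U - S) * \<psi> S
      = (- 1) ^ (i * j) * ((- 1) ^ crossings S (U - S) * \<psi> S * \<phi> (U - S))" if "S \<subseteq> U" for S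
  proof (cases "card (U - S) = i \<and> card S = j")
    case ij: True
    have "finite S" "finite (U - S)" using True that by (auto intro: finite_subset)
    then have "crossings (U - S) S + crossings S (U - S) = i * j"
      using crossings_swap[of "U - S" S] ij by auto
    then have "(- 1 :: 'a) ^ crossings (U - S) S = (- 1) ^ (i * j + crossings S (U - S))"
      by (intro sign_eqI) presburger
    then show ?thesis by (simp add: power_add mult_ac)
  next
    case False
    have "finite S" "finite (U - S)" using True that by (auto intro: finite_subset)
    then have "\<phi> (U - S) = 0 \<or> \<psi> S = 0" using \<phi> \<psi> False by blast
    then show ?thesis by auto
  qed
  then have "(\<Sum>S\<in>Pow U. (- 1) ^ crossings (U - S) S * \<phi> (U - S) * \<psi> S)
      = (- 1) ^ (i * j) * wedge \<psi> \<phi> U"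
    unfolding wedge_def sum_distrib_left by (intro sum.cong) auto
  moreover have "wedge \<phi> \<psi> U = (\<Sum>S\<in>Pow U. (- 1) ^ crossings (U - S) S * \<phi> (U - S) * \<psi> S)"
    unfolding wedge_def
    by (rule sum.reindex_bij_witness[where i = "\<lambda>S. U - S" and j = "\<lambda>S. U - S"]) (auto simp: double_diff)
  ultimately show ?thesis by simp
qed (simp add: wedge_infinite)

lemma sum_Pow_insert:
  assumes "finite U" "i \<notin> U"
  shows "(\<Sum>S\<in>Pow (insert i U). f S) = (\<Sum>S\<in>Pow U. f S) + (\<Sum>S\<in>Pow U. f (insert i S))"
proof -
  have "inj_on (insert i) (Pow U)" using assms(2) by (auto simp: inj_on_def)
  then show ?thesis
    unfolding Pow_insert using assms by (subst sum.union_disjoint) (auto simp: sum.reindex)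
qed

text \<open>Contraction is an antiderivation. For \<open>i \<in> U\<close> the left side is \<open>0\<close>, and on the right the term of a set
  \<open>S\<close> without \<open>i\<close> in the first sum cancels the term of \<open>insert i S\<close> in the second one.\<close>

lemma contract_wedge:
  "contract i (wedge \<phi> \<psi>) U = wedge (contract i \<phi>) \<psi> U + wedge (alternate \<phi>) (contract i \<psi>) U"
proof (cases "finite U")
  case fin: True
  show ?thesis
  proof (cases "i \<in> U")
    case True
    define V where "V = U - {i}"
    have V: "U = insert i V" "i \<notin> V" "finite V" using True fin by (auto simp: V_def)
    have "(- 1) ^ crossings S (insert i V - S) * contract i \<phi> S * \<psi> (insert i V - S)
        + (- 1) ^ crossings (insert i S) (V - S) * alternate \<phi> (insert i S) * contract i \<psi> (V - S) = 0"
      if "S \<subseteq> V" for S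
    proof -
      have S: "finite S" "i \<notin> S" "finite (V - S)" "i \<notin> V - S" using that V by (auto intro: finite_subset)
      have e: "insert i V - S = insert i (V - S)" using S by auto
      have "(- 1 :: 'a) ^ (crossings S (insert i (V - S)) + below i S)
          = - ((- 1) ^ (crossings (insert i S) (V - S) + card (insert i S) + below i (V - S)))"
        using crossings_insert_right[OF S(1,3,4,2)] crossings_insert_left[OF S(1,3,2)] S
        by (intro sign_oppI) (simp, blast)
      then show ?thesis
        using S unfolding e contract_def alternate_def by (simp add: power_add mult_ac)
    qed
    moreover have "insert i V - insert i S = V - S" if "S \<subseteq> V" for S using V by auto
    moreover have "contract i \<psi> (insert i V - S) = 0" "contract i \<phi> (insert i S) = 0" if "S \<subseteq> V" for S
      using that V by (auto simp: contract_def)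
    ultimately have "wedge (contract i \<phi>) \<psi> U + wedge (alternate \<phi>) (contract i \<psi>) U = 0"
      unfolding wedge_def V(1) sum_Pow_insert[OF V(3,2)]
      by (simp flip: sum.distrib)
    then show ?thesis using True by (simp add: contract_def)
  next
    case False
    have 1: "(- 1) ^ below i U * ((- 1) ^ crossings (insert i S) (U - S) * \<phi> (insert i S) * \<psi> (U - S))
        = (- 1) ^ crossings S (U - S) * contract i \<phi> S * \<psi> (U - S)"
      and 2: "(- 1) ^ below i U * ((- 1) ^ crossings S (insert i (U - S)) * \<phi> S * \<psi> (insert i (U - S)))
        = (- 1) ^ crossings S (U - S) * alternate \<phi> S * contract i \<psi> (U - S)"
      if "S \<subseteq> U" for S
    proof -
      have S: "finite S" "i \<notin> S" "finite (U - S)" "i \<notin> U - S" using that fin False by (auto intro: finite_subset)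
      have b: "below i U = below i S + below i (U - S)"
        using below_Un[OF S(1,3), of i] that by (simp add: Un_absorb1)
      have "(- 1 :: 'a) ^ (below i U + crossings (insert i S) (U - S)) = (- 1) ^ (crossings S (U - S) + below i S)"
        using crossings_insert_left[OF S(1,3,2)] b by (intro sign_eqI) (simp, blast)
      then show "(- 1) ^ below i U * ((- 1) ^ crossings (insert i S) (U - S) * \<phi> (insert i S) * \<psi> (U - S))
        = (- 1) ^ crossings S (U - S) * contract i \<phi> S * \<psi> (U - S)"
        using S by (simp add: contract_def power_add flip: mult.assoc)
      have "(- 1 :: 'a) ^ (below i U + crossings S (insert i (U - S)))
          = (- 1) ^ (crossings S (U - S) + card S + below i (U - S))"
        using crossings_insert_right[OF S(1,3,4,2)] b by (intro sign_eqI) presburger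
      from arg_cong[OF this, of "\<lambda>s. s * (\<phi> S * \<psi> (insert i (U - S)))"]
      show "(- 1) ^ below i U * ((- 1) ^ crossings S (insert i (U - S)) * \<phi> S * \<psi> (insert i (U - S)))
        = (- 1) ^ crossings S (U - S) * alternate \<phi> S * contract i \<psi> (U - S)"
        using S by (simp add: contract_def alternate_def power_add mult_ac)
    qed
    have e: "insert i U - S = insert i (U - S)" "insert i U - insert i S = U - S" if "S \<subseteq> U" for S
      using that False by auto
    have "contract i (wedge \<phi> \<psi>) U = (- 1) ^ below i U *
        ((\<Sum>S\<in>Pow U. (- 1) ^ crossings S (insert i (U - S)) * \<phi> S * \<psi> (insert i (U - S)))
        + (\<Sum>S\<in>Pow U. (- 1) ^ crossings (insert i S) (U - S) * \<phi> (insert i S) * \<psi> (U - S)))"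
      using False unfolding contract_def wedge_def sum_Pow_insert[OF fin False] by (simp add: e)
    also have "\<dots> = wedge (alternate \<phi>) (contract i \<psi>) U + wedge (contract i \<phi>) \<psi> U"
      unfolding distrib_left sum_distrib_left wedge_def
      by (intro arg_cong2[where f = "(+)"] sum.cong refl) (simp_all add: 1 2)
    finally show ?thesis by simp
  qed
qed (simp add: wedge_infinite contract_def)

lemma contract_contract: "contract i (contract j \<phi>) U = - contract j (contract i \<phi>) U"
proof (cases "i = j \<or> i \<in> U \<or> j \<in> U")
  case False
  have "(- 1 :: 'a) ^ (below i U + below j (insert i U)) = - ((- 1) ^ (below j U + below i (insert j U)))"
    using False by (intro sign_oppI) (auto simp: below_insert)
  then show ?thesis
    using False unfolding contract_def by (simp add: power_add insert_commute flip: mult.assoc)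
qed (auto simp: contract_def)

lemma contract_contract_same: "contract i (contract i \<phi>) U = 0"
  by (simp add: contract_def)

lemma contract_add: "contract i (\<lambda>U. \<phi> U + \<psi> U) U = contract i \<phi> U + contract i \<psi> U"
  and contract_diff: "contract i (\<lambda>U. \<phi> U - \<psi> U) U = contract i \<phi> U - contract i \<psi> U"
  and contract_smult: "contract i (\<lambda>U. p * \<phi> U) U = p * contract i \<phi> U"
  by (simp_all add: contract_def algebra_simps)

lemma contract_sum: "contract i (\<lambda>U. \<Sum>a\<in>A. \<phi> a U) U = (\<Sum>a\<in>A. contract i (\<phi> a) U)"
  by (simp add: contract_def sum_distrib_left)

lemma alternate_unit_vec: "alternate (unit_vec {j}) U = - unit_vec {j} U"
  by (auto simp: alternate_def unit_vec_def)

lemma contract_unit_vec: "contract i (unit_vec {j}) U = (if i = j then unit_vec {} U else 0)"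
proof -
  have "insert i U = {j} \<longleftrightarrow> i = j \<and> U \<subseteq> {j}" by auto
  then show ?thesis
    by (cases "U = {}") (auto simp: contract_def unit_vec_def below_def subset_singleton_iff)
qed

lemma wedge_one_left: "finite U \<Longrightarrow> wedge (unit_vec {}) \<psi> U = \<psi> U"
  by (simp add: wedge_unit_vec_left)

lemma contract_wedge_unit_vec:
  assumes "finite U"
  shows "contract i (wedge (unit_vec {j}) \<psi>) U =
    (if i = j then \<psi> U else 0) - wedge (unit_vec {j}) (contract i \<psi>) U"
proof -
  have "alternate (unit_vec {j} :: nat set \<Rightarrow> 'a) = (\<lambda>U. - unit_vec {j} U)"
    "contract i (unit_vec {j} :: nat set \<Rightarrow> 'a) = (\<lambda>U. if i = j then unit_vec {} U else 0)"
    by (auto simp: fun_eq_iff alternate_unit_vec contract_unit_vec)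
  then show ?thesis
    unfolding contract_wedge using assms
    by (simp add: wedge_uminus_left wedge_zero_left wedge_one_left cong: if_cong)
qed

lemma wedge_unit_vec_right:
  "wedge \<phi> (unit_vec {j}) U = wedge (unit_vec {j}) (alternate \<phi>) U"
proof (cases "finite U")
  case True
  have "wedge \<phi> (unit_vec {j}) U = (\<Sum>S\<in>Pow U. if S = U - {j} then (if j \<in> U then (- 1) ^ crossings S {j} * \<phi> S else 0) else 0)"
    unfolding wedge_def unit_vec_def
    by (intro sum.cong refl) (auto simp: double_diff)
  also have "\<dots> = (if j \<in> U then (- 1) ^ crossings (U - {j}) {j} * \<phi> (U - {j}) else 0)"
    using True by (subst sum.delta) auto
  also have "\<dots> = wedge (unit_vec {j}) (alternate \<phi>) U"
  proof (cases "j \<in> U")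
    case j: True
    have "(- 1 :: 'a) ^ crossings (U - {j}) {j} = (- 1) ^ (crossings {j} (U - {j}) + card (U - {j}))"
      using crossings_single_right[of "U - {j}" j] True
      by (intro sign_eqI) (simp add: crossings_single_left, presburger)
    then show ?thesis using True j by (simp add: wedge_unit_vec_left alternate_def power_add mult_ac)
  qed (simp add: wedge_unit_vec_left)
  finally show ?thesis .
qed (simp add: wedge_infinite)

lemma unit_vec_square: "wedge (unit_vec {j}) (wedge (unit_vec {j}) \<phi>) U = 0"
  by (auto simp: wedge_unit_vec_left)

lemma wedge_nonzero_obtain:
  assumes "wedge \<phi> \<psi> U \<noteq> 0"
  obtains S where "S \<subseteq> U" "finite U" "\<phi> S \<noteq> 0" "\<psi> (U - S) \<noteq> 0"
proof -
  have fin: "finite U" using assms wedge_infinite by blast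
  have "\<exists>S\<in>Pow U. (- 1) ^ crossings S (U - S) * \<phi> S * \<psi> (U - S) \<noteq> 0"
    using assms unfolding wedge_def by (meson sum.not_neutral_contains_not_neutral)
  then show ?thesis using that fin by (metis PowD mult_eq_0_iff mult_zero_left mult_zero_right)
qed

section \<open>The exterior face algebra of a cone\<close>

text \<open>The diagonal terms have to be assumed to vanish, because \<open>2\<close> may be a zero divisor.\<close>

lemma antisymmetric_sum_zero:
  fixes a :: "'i \<Rightarrow> 'i \<Rightarrow> 'r::comm_ring_1"
  assumes "finite A" "\<And>i j. a i j = - a j i" "\<And>i. a i i = 0"
  shows "(\<Sum>i\<in>A. \<Sum>j\<in>A. a i j) = 0"
  using assms(1)
proof (induction A rule: finite_induct)
  case (insert x A)
  have "(\<Sum>i\<in>A. a i x) = - (\<Sum>i\<in>A. a x i)"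
    unfolding sum_negf[symmetric] using assms(2) by (intro sum.cong refl)
  with insert show ?case by (simp add: sum.distrib assms(3))
qed simp

locale cone_complex =
  fixes \<Delta> :: "nat set set" and p :: nat
  assumes complex: "simplicial_complex \<Delta>" and apex: "{p} \<in> \<Delta>" and cone: "\<And>W. W \<in> \<Delta> \<Longrightarrow> insert p W \<in> \<Delta>"
begin

definition V :: "nat set" where "V = {v. {v} \<in> \<Delta>} - {p}"

lemma finite_complex: "finite \<Delta>"
  using complex by (simp add: simplicial_complex_def)

lemma finite_face: "S \<in> \<Delta> \<Longrightarrow> finite S"
  using complex by (simp add: simplicial_complex_def)

lemma empty_face: "{} \<in> \<Delta>"
  using complex by (simp add: simplicial_complex_def)

lemma subface: "S \<in> \<Delta> \<Longrightarrow> U \<subseteq> S \<Longrightarrow> U \<in> \<Delta>"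
  using complex by (simp add: simplicial_complex_def)

lemma face_vertices: "S \<in> \<Delta> \<Longrightarrow> S \<subseteq> insert p V"
  using subface by (auto simp: V_def)

lemma vertex: "v \<in> insert p V \<Longrightarrow> {v} \<in> \<Delta>"
  using apex by (auto simp: V_def)

lemma finite_V: "finite V"
proof -
  have "finite (\<Union>\<Delta>)" using finite_complex finite_face by blast
  then show ?thesis by (rule finite_subset[rotated]) (auto simp: V_def)
qed

lemma p_notin_V: "p \<notin> V" by (simp add: V_def)

definition delta :: "(nat set \<Rightarrow> 'r::comm_ring_1) \<Rightarrow> nat set \<Rightarrow> 'r" where
  "delta \<phi> U = (\<Sum>i\<in>V. contract i \<phi> U)"

definition boundary :: "(nat set \<Rightarrow> 'r::comm_ring_1) \<Rightarrow> nat set \<Rightarrow> 'r" where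
  "boundary \<phi> U = contract p \<phi> U + delta \<phi> U"

definition apex_mult :: "(nat set \<Rightarrow> 'r::comm_ring_1) \<Rightarrow> nat set \<Rightarrow> 'r" where
  "apex_mult \<phi> = wedge (unit_vec {p}) \<phi>"

definition restrict :: "(nat set \<Rightarrow> 'r::comm_ring_1) \<Rightarrow> nat set \<Rightarrow> 'r" where
  "restrict \<phi> U = (if U \<in> \<Delta> then \<phi> U else 0)"

text \<open>The automorphism of the exterior algebra with \<open>e\<^sub>i \<mapsto> e\<^sub>i + e\<^sub>p\<close> for \<open>i \<in> V\<close> that fixes the other
  generators, and its inverse.\<close>

definition theta :: "(nat set \<Rightarrow> 'r::comm_ring_1) \<Rightarrow> nat set \<Rightarrow> 'r" where
  "theta \<phi> U = \<phi> U + apex_mult (delta \<phi>) U"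

definition theta_inv :: "(nat set \<Rightarrow> 'r::comm_ring_1) \<Rightarrow> nat set \<Rightarrow> 'r" where
  "theta_inv \<phi> U = \<phi> U - apex_mult (delta \<phi>) U"

text \<open>The projection onto the functions on \<open>\<Delta>\<close> whose kernel is the preimage under \<open>theta\<close> of the ideal of
  nonfaces.\<close>

definition normal_form :: "(nat set \<Rightarrow> 'r::comm_ring_1) \<Rightarrow> nat set \<Rightarrow> 'r" where
  "normal_form \<phi> = theta_inv (restrict (theta \<phi>))"

definition supported :: "(nat set \<Rightarrow> 'r::comm_ring_1) \<Rightarrow> bool" where
  "supported \<phi> \<longleftrightarrow> (\<forall>U. U \<notin> \<Delta> \<longrightarrow> \<phi> U = 0)"

lemma delta_add: "delta (\<lambda>U. \<phi> U + \<psi> U) = (\<lambda>U. delta \<phi> U + delta \<psi> U)"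
  and delta_diff: "delta (\<lambda>U. \<phi> U - \<psi> U) = (\<lambda>U. delta \<phi> U - delta \<psi> U)"
  and delta_smult: "delta (\<lambda>U. q * \<phi> U) = (\<lambda>U. q * delta \<phi> U)"
  by (simp_all add: fun_eq_iff delta_def contract_add contract_diff contract_smult sum.distrib sum_subtractf sum_distrib_left)

lemma apex_mult_add: "apex_mult (\<lambda>U. \<phi> U + \<psi> U) = (\<lambda>U. apex_mult \<phi> U + apex_mult \<psi> U)"
  and apex_mult_diff: "apex_mult (\<lambda>U. \<phi> U - \<psi> U) = (\<lambda>U. apex_mult \<phi> U - apex_mult \<psi> U)"
  and apex_mult_smult: "apex_mult (\<lambda>U. q * \<phi> U) = (\<lambda>U. q * apex_mult \<phi> U)"
  by (simp_all add: fun_eq_iff apex_mult_def wedge_add_right wedge_diff_right wedge_smult_right)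

lemma boundary_add: "boundary (\<lambda>U. \<phi> U + \<psi> U) U = boundary \<phi> U + boundary \<psi> U"
  and boundary_smult: "boundary (\<lambda>U. q * \<phi> U) U = q * boundary \<phi> U"
  by (simp_all add: boundary_def delta_add delta_smult contract_add contract_smult algebra_simps)

lemma boundary_eq_sum: "boundary \<phi> U = (\<Sum>i\<in>insert p V. contract i \<phi> U)"
  using finite_V p_notin_V by (simp add: boundary_def delta_def)

lemma delta_eq: "delta \<phi> = (\<lambda>U. \<Sum>i\<in>V. contract i \<phi> U)"
  by (simp add: fun_eq_iff delta_def)

lemma boundary_eq: "boundary \<phi> = (\<lambda>U. \<Sum>i\<in>insert p V. contract i \<phi> U)"
  by (rule HOL.ext) (rule boundary_eq_sum)

lemma boundary_sum: "boundary (\<lambda>U. \<Sum>a\<in>A. \<phi> a U) U = (\<Sum>a\<in>A. boundary (\<phi> a) U)"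
  unfolding boundary_eq_sum contract_sum by (rule sum.swap)

lemma theta_add: "theta (\<lambda>U. \<phi> U + \<psi> U) = (\<lambda>U. theta \<phi> U + theta \<psi> U)"
  and theta_smult: "theta (\<lambda>U. q * \<phi> U) = (\<lambda>U. q * theta \<phi> U)"
  and theta_inv_add: "theta_inv (\<lambda>U. \<phi> U + \<psi> U) = (\<lambda>U. theta_inv \<phi> U + theta_inv \<psi> U)"
  and theta_inv_smult: "theta_inv (\<lambda>U. q * \<phi> U) = (\<lambda>U. q * theta_inv \<phi> U)"
  by (simp_all add: fun_eq_iff theta_def theta_inv_def delta_add delta_smult apex_mult_add apex_mult_smult algebra_simps)

lemma normal_form_add: "normal_form (\<lambda>U. \<phi> U + \<psi> U) = (\<lambda>U. normal_form \<phi> U + normal_form \<psi> U)"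
proof -
  have "restrict (\<lambda>U. theta \<phi> U + theta \<psi> U) = (\<lambda>U. restrict (theta \<phi>) U + restrict (theta \<psi>) U)"
    by (simp add: fun_eq_iff restrict_def)
  then show ?thesis by (simp add: normal_form_def theta_add theta_inv_add)
qed

lemma normal_form_smult: "normal_form (\<lambda>U. q * \<phi> U) = (\<lambda>U. q * normal_form \<phi> U)"
proof -
  have "restrict (\<lambda>U. q * theta \<phi> U) = (\<lambda>U. q * restrict (theta \<phi>) U)"
    by (simp add: fun_eq_iff restrict_def)
  then show ?thesis by (simp add: normal_form_def theta_smult theta_inv_smult)
qed

lemma apex_mult_ext: "apex_mult (apex_mult \<phi>) U = 0"
  by (simp add: apex_mult_def unit_vec_square)

lemma apex_mult_cong_finite:
  assumes "finite U" "\<And>S. finite S \<Longrightarrow> \<phi> S = \<psi> S" shows "apex_mult \<phi> U = apex_mult \<psi> U"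
  unfolding apex_mult_def using assms by (intro wedge_cong refl) (auto intro: finite_subset)

lemma delta_ext: "finite U \<Longrightarrow> delta (apex_mult \<phi>) U = - apex_mult (delta \<phi>) U"
proof -
  assume U: "finite U"
  have "delta (apex_mult \<phi>) U = (\<Sum>i\<in>V. - wedge (unit_vec {p}) (contract i \<phi>) U)"
    unfolding delta_def apex_mult_def using p_notin_V
    by (intro sum.cong refl) (auto simp: contract_wedge_unit_vec[OF U])
  also have "\<dots> = - apex_mult (delta \<phi>) U"
    unfolding apex_mult_def delta_def wedge_sum_right by (simp add: sum_negf)
  finally show ?thesis .
qed

lemma apex_mult_delta_ext: "finite U \<Longrightarrow> apex_mult (delta (apex_mult \<phi>)) U = 0"
proof -
  assume U: "finite U"
  have "apex_mult (delta (apex_mult \<phi>)) U = apex_mult (\<lambda>U. - apex_mult (delta \<phi>) U) U"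
    by (rule apex_mult_cong_finite[OF U]) (rule delta_ext)
  then show ?thesis using apex_mult_ext[of "delta \<phi>" U] by (simp add: apex_mult_def wedge_uminus_right)
qed

text \<open>The operator \<open>apex_mult \<circ> delta\<close> has square zero.\<close>

lemma theta_inv_theta: "finite U \<Longrightarrow> theta_inv (theta \<phi>) U = \<phi> U"
  and theta_theta_inv: "finite U \<Longrightarrow> theta (theta_inv \<phi>) U = \<phi> U"
proof -
  assume U: "finite U"
  have "apex_mult (delta (\<lambda>U. \<phi> U + apex_mult (delta \<phi>) U)) U = apex_mult (delta \<phi>) U"
    "apex_mult (delta (\<lambda>U. \<phi> U - apex_mult (delta \<phi>) U)) U = apex_mult (delta \<phi>) U"
    unfolding delta_add delta_diff apex_mult_add apex_mult_diff by (simp_all add: apex_mult_delta_ext[OF U])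
  then show "theta_inv (theta \<phi>) U = \<phi> U" "theta (theta_inv \<phi>) U = \<phi> U"
    unfolding theta_inv_def theta_def by simp_all
qed

lemma delta_wedge: "delta (wedge \<phi> \<psi>) U = wedge (delta \<phi>) \<psi> U + wedge (alternate \<phi>) (delta \<psi>) U"
  unfolding delta_def wedge_sum_left wedge_sum_right contract_wedge by (simp add: sum.distrib)

lemma boundary_wedge: "boundary (wedge \<phi> \<psi>) U = wedge (boundary \<phi>) \<psi> U + wedge (alternate \<phi>) (boundary \<psi>) U"
proof -
  have "boundary \<phi> = (\<lambda>U. contract p \<phi> U + delta \<phi> U)" "boundary \<psi> = (\<lambda>U. contract p \<psi> U + delta \<psi> U)"
    by (simp_all add: fun_eq_iff boundary_def)
  then show ?thesis
    by (simp add: boundary_def contract_wedge delta_wedge wedge_add_left wedge_add_right)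
qed

lemma wedge_ext_left: "wedge (apex_mult \<phi>) \<psi> U = apex_mult (wedge \<phi> \<psi>) U"
  by (simp add: apex_mult_def wedge_assoc)

lemma wedge_ext_right: "wedge \<phi> (apex_mult \<psi>) U = apex_mult (wedge (alternate \<phi>) \<psi>) U"
proof -
  have "wedge \<phi> (apex_mult \<psi>) U = wedge (wedge \<phi> (unit_vec {p})) \<psi> U" by (simp add: apex_mult_def wedge_assoc)
  also have "wedge \<phi> (unit_vec {p}) = apex_mult (alternate \<phi>)"
    by (simp add: fun_eq_iff apex_mult_def wedge_unit_vec_right)
  finally show ?thesis by (simp add: wedge_ext_left)
qed

text \<open>Since \<open>delta\<close> is an antiderivation and \<open>e\<^sub>p \<and> e\<^sub>p = 0\<close>.\<close>

lemma theta_wedge: "theta (wedge \<phi> \<psi>) U = wedge (theta \<phi>) (theta \<psi>) U"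
proof -
  have th: "theta \<phi> = (\<lambda>U. \<phi> U + apex_mult (delta \<phi>) U)" "theta \<psi> = (\<lambda>U. \<psi> U + apex_mult (delta \<psi>) U)"
    by (simp_all add: fun_eq_iff theta_def)
  have "wedge (apex_mult (delta \<phi>)) (apex_mult (delta \<psi>)) U = apex_mult (wedge (delta \<phi>) (apex_mult (delta \<psi>))) U"
    by (rule wedge_ext_left)
  also have "wedge (delta \<phi>) (apex_mult (delta \<psi>)) = apex_mult (wedge (alternate (delta \<phi>)) (delta \<psi>))"
    by (simp add: fun_eq_iff wedge_ext_right)
  also have "apex_mult (apex_mult (wedge (alternate (delta \<phi>)) (delta \<psi>))) U = 0" by (rule apex_mult_ext)
  finally have z: "wedge (apex_mult (delta \<phi>)) (apex_mult (delta \<psi>)) U = 0" .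
  have d: "delta (wedge \<phi> \<psi>) = (\<lambda>U. wedge (delta \<phi>) \<psi> U + wedge (alternate \<phi>) (delta \<psi>) U)"
    by (simp add: fun_eq_iff delta_wedge)
  show ?thesis
    unfolding th wedge_add_left wedge_add_right z
    unfolding wedge_ext_left wedge_ext_right
    by (simp add: theta_def d apex_mult_add)
qed

lemma delta_contract: "delta (contract p \<phi>) U = - contract p (delta \<phi>) U"
proof -
  have "contract p (delta \<phi>) U = (\<Sum>i\<in>V. contract p (contract i \<phi>) U)"
    unfolding delta_eq by (rule contract_sum)
  then show ?thesis
    unfolding delta_def by (simp add: contract_contract[of _ p] sum_negf)
qed

lemma delta_delta: "delta (delta \<phi>) U = 0"
proof -
  have "delta (delta \<phi>) U = (\<Sum>i\<in>V. \<Sum>j\<in>V. contract i (contract j \<phi>) U)"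
    unfolding delta_eq contract_sum ..
  then show ?thesis
    using antisymmetric_sum_zero[of V "\<lambda>i j. contract i (contract j \<phi>) U"]
      finite_V contract_contract contract_contract_same by metis
qed

lemma contract_theta:
  assumes U: "finite U" shows "contract p (theta \<phi>) U = theta (boundary \<phi>) U"
proof -
  have th: "theta \<phi> = (\<lambda>U. \<phi> U + apex_mult (delta \<phi>) U)" by (simp add: fun_eq_iff theta_def)
  have "delta (boundary \<phi>) = (\<lambda>U. - contract p (delta \<phi>) U)"
  proof -
    have "boundary \<phi> = (\<lambda>U. contract p \<phi> U + delta \<phi> U)" by (simp add: fun_eq_iff boundary_def)
    then show ?thesis by (simp add: delta_add delta_contract delta_delta)
  qed
  then have "theta (boundary \<phi>) U = boundary \<phi> U - apex_mult (contract p (delta \<phi>)) U"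
    by (simp add: theta_def apex_mult_def wedge_uminus_right)
  moreover have "contract p (apex_mult (delta \<phi>)) U = delta \<phi> U - apex_mult (contract p (delta \<phi>)) U"
    unfolding apex_mult_def contract_wedge_unit_vec[OF U] by simp
  ultimately show ?thesis unfolding th contract_add by (simp add: boundary_def)
qed

lemma boundary_boundary: "boundary (boundary \<phi>) U = 0"
proof -
  have "boundary (boundary \<phi>) U = (\<Sum>i\<in>insert p V. \<Sum>j\<in>insert p V. contract i (contract j \<phi>) U)"
    unfolding boundary_eq contract_sum ..
  then show ?thesis
    using antisymmetric_sum_zero[of "insert p V" "\<lambda>i j. contract i (contract j \<phi>) U"]
      finite_V contract_contract contract_contract_same by (metis finite_insert)
qed

lemma supportedD: "supported \<phi> \<Longrightarrow> U \<notin> \<Delta> \<Longrightarrow> \<phi> U = 0"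
  by (simp add: supported_def)

lemma supported_eqI:
  "supported \<phi> \<Longrightarrow> supported \<psi> \<Longrightarrow> (\<And>U. U \<in> \<Delta> \<Longrightarrow> \<phi> U = \<psi> U) \<Longrightarrow> \<phi> = \<psi>"
  unfolding supported_def fun_eq_iff by metis

lemma supported_restrict [simp]: "supported (restrict \<phi>)"
  by (simp add: supported_def restrict_def)

lemma restrict_supported: "supported \<phi> \<Longrightarrow> restrict \<phi> = \<phi>"
  by (auto simp: supported_def restrict_def fun_eq_iff)

lemma supported_boundary: "supported \<phi> \<Longrightarrow> supported (boundary \<phi>)"
proof -
  assume \<phi>: "supported \<phi>"
  have "contract i \<phi> U = 0" if "U \<notin> \<Delta>" for U i
    using supportedD[OF \<phi>, of "insert i U"] subface[of "insert i U" U] that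
    by (cases "insert i U \<in> \<Delta>") (auto simp: contract_def)
  then show ?thesis by (simp add: supported_def boundary_eq_sum)
qed

lemma supported_ext_delta: assumes \<phi>: "supported \<phi>" shows "supported (apex_mult (delta \<phi>))"
  unfolding supported_def
proof (intro allI impI)
  fix U assume U: "U \<notin> \<Delta>"
  show "apex_mult (delta \<phi>) U = 0"
  proof (cases "p \<in> U")
    case True
    have "contract i \<phi> (U - {p}) = 0" for i
      using supportedD[OF \<phi>, of "insert i (U - {p})"] subface[of "insert i (U - {p})" "U - {p}"]
        cone[of "U - {p}"] U True
      by (cases "insert i (U - {p}) \<in> \<Delta>") (auto simp: contract_def insert_absorb)
    then show ?thesis by (simp add: apex_mult_def wedge_unit_vec_left delta_def)
  qed (simp add: apex_mult_def wedge_unit_vec_left)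
qed

lemma supported_theta: "supported \<phi> \<Longrightarrow> supported (theta \<phi>)"
  and supported_theta_inv: "supported \<phi> \<Longrightarrow> supported (theta_inv \<phi>)"
  using supported_ext_delta[of \<phi>] by (simp_all add: supported_def theta_def theta_inv_def)

lemma supported_normal_form: "supported (normal_form \<phi>)"
  unfolding normal_form_def by (rule supported_theta_inv) simp

lemma theta_inject:
  assumes "supported \<phi>" "supported \<psi>" "theta \<phi> = theta \<psi>" shows "\<phi> = \<psi>"
  by (rule supported_eqI[OF assms(1,2)]) (metis assms(3) finite_face theta_inv_theta)

lemma theta_normal_form: "theta (normal_form \<phi>) = restrict (theta \<phi>)"
proof (rule supported_eqI[OF supported_theta[OF supported_normal_form] supported_restrict])
  show "theta (normal_form \<phi>) U = restrict (theta \<phi>) U" if "U \<in> \<Delta>" for U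
    using that by (simp add: normal_form_def theta_theta_inv finite_face)
qed

lemma normal_form_supported: "supported \<phi> \<Longrightarrow> normal_form \<phi> = \<phi>"
  by (rule theta_inject) (simp_all add: supported_normal_form theta_normal_form restrict_supported supported_theta)

text \<open>Under \<open>theta\<close> the boundary becomes the contraction with the apex. It is compatible with the restriction to the
  faces, because \<open>U\<close> is a face if and only if \<open>insert p U\<close> is one.\<close>

lemma boundary_normal_form: "boundary (normal_form \<phi>) = normal_form (boundary \<phi>)"
proof (rule theta_inject[OF supported_boundary[OF supported_normal_form] supported_normal_form])
  show "theta (boundary (normal_form \<phi>)) = theta (normal_form (boundary \<phi>))"
  proof (rule supported_eqI)
    fix U assume U: "U \<in> \<Delta>"
    have "contract p (restrict (theta \<phi>)) U = contract p (theta \<phi>) U"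
      using cone[OF U] by (simp add: contract_def restrict_def)
    then show "theta (boundary (normal_form \<phi>)) U = theta (normal_form (boundary \<phi>)) U"
      using U by (simp add: contract_theta[symmetric] finite_face theta_normal_form restrict_def[of "theta (boundary \<phi>)"])
  qed (simp_all add: supported_theta supported_boundary supported_normal_form)
qed

text \<open>The product of the quotient of the exterior algebra by the kernel of \<open>normal_form\<close>.\<close>

definition star :: "(nat set \<Rightarrow> 'r::comm_ring_1) \<Rightarrow> (nat set \<Rightarrow> 'r) \<Rightarrow> nat set \<Rightarrow> 'r" where
  "star \<phi> \<psi> = normal_form (wedge \<phi> \<psi>)"

lemma theta_star: "theta (star \<phi> \<psi>) = restrict (wedge (theta \<phi>) (theta \<psi>))"
proof -
  have "theta (wedge \<phi> \<psi>) = wedge (theta \<phi>) (theta \<psi>)" by (simp add: fun_eq_iff theta_wedge)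
  then show ?thesis by (simp add: star_def theta_normal_form)
qed

lemma supported_star: "supported (star \<phi> \<psi>)"
  by (simp add: star_def supported_normal_form)

lemma restrict_wedge:
  "restrict (wedge (restrict \<phi>) \<psi>) = restrict (wedge \<phi> \<psi>)" "restrict (wedge \<phi> (restrict \<psi>)) = restrict (wedge \<phi> \<psi>)"
proof -
  have "wedge (restrict \<phi>) \<psi> U = wedge \<phi> \<psi> U" "wedge \<phi> (restrict \<psi>) U = wedge \<phi> \<psi> U" if "U \<in> \<Delta>" for U
    using subface[OF that] by (auto intro!: wedge_cong simp: restrict_def)
  then show "restrict (wedge (restrict \<phi>) \<psi>) = restrict (wedge \<phi> \<psi>)" "restrict (wedge \<phi> (restrict \<psi>)) = restrict (wedge \<phi> \<psi>)"
    by (simp_all add: fun_eq_iff restrict_def)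
qed

lemma star_assoc: "star (star \<phi> \<psi>) \<chi> = star \<phi> (star \<psi> \<chi>)"
proof (rule theta_inject[OF supported_star supported_star])
  have "wedge (wedge (theta \<phi>) (theta \<psi>)) (theta \<chi>) = wedge (theta \<phi>) (wedge (theta \<psi>) (theta \<chi>))"
    by (simp add: fun_eq_iff wedge_assoc)
  then show "theta (star (star \<phi> \<psi>) \<chi>) = theta (star \<phi> (star \<psi> \<chi>))"
    by (simp add: theta_star restrict_wedge)
qed

lemma star_add_left: "star (\<lambda>U. \<phi> U + \<phi>' U) \<psi> U = star \<phi> \<psi> U + star \<phi>' \<psi> U"
  and star_add_right: "star \<phi> (\<lambda>U. \<psi> U + \<psi>' U) U = star \<phi> \<psi> U + star \<phi> \<psi>' U"
  and star_smult_left: "star (\<lambda>U. q * \<phi> U) \<psi> U = q * star \<phi> \<psi> U"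
  and star_smult_right: "star \<phi> (\<lambda>U. q * \<psi> U) U = q * star \<phi> \<psi> U"
proof -
  have "wedge (\<lambda>U. \<phi> U + \<phi>' U) \<psi> = (\<lambda>U. wedge \<phi> \<psi> U + wedge \<phi>' \<psi> U)"
    "wedge \<phi> (\<lambda>U. \<psi> U + \<psi>' U) = (\<lambda>U. wedge \<phi> \<psi> U + wedge \<phi> \<psi>' U)"
    "wedge (\<lambda>U. q * \<phi> U) \<psi> = (\<lambda>U. q * wedge \<phi> \<psi> U)" "wedge \<phi> (\<lambda>U. q * \<psi> U) = (\<lambda>U. q * wedge \<phi> \<psi> U)"
    by (simp_all add: fun_eq_iff wedge_add_left wedge_add_right wedge_smult_left wedge_smult_right)
  then show "star (\<lambda>U. \<phi> U + \<phi>' U) \<psi> U = star \<phi> \<psi> U + star \<phi>' \<psi> U"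
    "star \<phi> (\<lambda>U. \<psi> U + \<psi>' U) U = star \<phi> \<psi> U + star \<phi> \<psi>' U"
    "star (\<lambda>U. q * \<phi> U) \<psi> U = q * star \<phi> \<psi> U" "star \<phi> (\<lambda>U. q * \<psi> U) U = q * star \<phi> \<psi> U"
    by (simp_all add: star_def normal_form_add normal_form_smult)
qed

definition of_degree :: "nat \<Rightarrow> (nat set \<Rightarrow> 'r::comm_ring_1) \<Rightarrow> bool" where
  "of_degree i \<phi> \<longleftrightarrow> supported \<phi> \<and> (\<forall>U. \<phi> U \<noteq> 0 \<longrightarrow> card U = i)"

lemma star_commute:
  assumes "of_degree i \<phi>" "of_degree j \<psi>" shows "star \<phi> \<psi> U = (- 1) ^ (i * j) * star \<psi> \<phi> U"
proof -
  have "wedge \<phi> \<psi> = (\<lambda>U. (- 1) ^ (i * j) * wedge \<psi> \<phi> U)"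
    using assms by (auto simp: fun_eq_iff of_degree_def intro!: wedge_commute)
  then show ?thesis by (simp add: star_def normal_form_smult)
qed

lemma boundary_star:
  assumes "of_degree i \<phi>"
  shows "boundary (star \<phi> \<psi>) U = star (boundary \<phi>) \<psi> U + (- 1) ^ i * star \<phi> (boundary \<psi>) U"
proof -
  have "alternate \<phi> = (\<lambda>U. (- 1) ^ i * \<phi> U)"
    using assms by (force simp: fun_eq_iff alternate_def of_degree_def)
  then have "boundary (wedge \<phi> \<psi>) = (\<lambda>U. wedge (boundary \<phi>) \<psi> U + (- 1) ^ i * wedge \<phi> (boundary \<psi>) U)"
    by (intro HOL.ext) (simp only: boundary_wedge wedge_smult_left)
  then show ?thesis by (simp add: star_def boundary_normal_form normal_form_add normal_form_smult)
qed

lemma boundary_unit_wedge: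
  assumes j: "j \<in> insert p V" and U: "finite U"
  shows "boundary (wedge (unit_vec {j}) \<psi>) U = \<psi> U - wedge (unit_vec {j}) (boundary \<psi>) U"
proof -
  have "boundary (wedge (unit_vec {j}) \<psi>) U
      = (\<Sum>i\<in>insert p V. (if i = j then \<psi> U else 0) - wedge (unit_vec {j}) (contract i \<psi>) U)"
    unfolding boundary_eq_sum by (simp add: contract_wedge_unit_vec[OF U])
  also have "\<dots> = \<psi> U - wedge (unit_vec {j}) (boundary \<psi>) U"
    unfolding sum_subtractf boundary_eq_sum wedge_sum_right using j finite_V by (simp add: sum.delta)
  finally show ?thesis .
qed

text \<open>Only the nonfaces contribute corrections, and only at faces that contain the apex.\<close>

lemma normal_form_formula:
  assumes U: "U \<in> \<Delta>"
  shows "normal_form \<chi> U = \<chi> U + (if p \<in> U then (- 1) ^ crossings {p} (U - {p}) *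
    (\<Sum>i\<in>V. if i \<in> U \<or> insert i (U - {p}) \<in> \<Delta> then 0 else (- 1) ^ below i (U - {p}) * \<chi> (insert i (U - {p}))) else 0)"
proof (cases "p \<in> U")
  case False
  then have "apex_mult \<phi> U = 0" for \<phi> :: "nat set \<Rightarrow> 'a" by (simp add: apex_mult_def wedge_unit_vec_left)
  then show ?thesis using False U by (simp add: normal_form_def theta_inv_def theta_def restrict_def)
next
  case True
  let ?W = "U - {p}" and ?s = "(- 1) ^ crossings {p} (U - {p}) :: 'a"
  have e: "apex_mult \<phi> U = ?s * \<phi> ?W" for \<phi>
    using True finite_face[OF U] by (simp add: apex_mult_def wedge_unit_vec_left)
  have "normal_form \<chi> U = \<chi> U + ?s * (\<Sum>i\<in>V. contract i \<chi> ?W - contract i (restrict (theta \<chi>)) ?W)"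
    using U by (simp add: normal_form_def theta_inv_def restrict_def[of _ U] theta_def[of _ U] e delta_def
      sum_subtractf right_diff_distrib)
  also have "(\<Sum>i\<in>V. contract i \<chi> ?W - contract i (restrict (theta \<chi>)) ?W) =
      (\<Sum>i\<in>V. if i \<in> U \<or> insert i ?W \<in> \<Delta> then 0 else (- 1) ^ below i ?W * \<chi> (insert i ?W))"
  proof (intro sum.cong refl)
    fix i assume "i \<in> V"
    then have ip: "i \<noteq> p" using p_notin_V by blast
    then have "theta \<chi> (insert i ?W) = \<chi> (insert i ?W)"
      by (simp add: theta_def apex_mult_def wedge_unit_vec_left)
    then show "contract i \<chi> ?W - contract i (restrict (theta \<chi>)) ?W =
        (if i \<in> U \<or> insert i ?W \<in> \<Delta> then 0 else (- 1) ^ below i ?W * \<chi> (insert i ?W))"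
      using ip by (simp add: contract_def restrict_def)
  qed
  finally show ?thesis using True by simp
qed

end

section \<open>The ideal of a cone and its resolution\<close>

lemma keys_sign_mult: "keys ((- 1) ^ k * (q :: 'k::field mpoly)) = keys q"
  by (cases "even k") simp_all

lemma keys_sum_obtain:
  assumes "m \<in> keys (sum g A)" obtains a where "a \<in> A" "m \<in> keys (g a)"
  using keys_sum[of g A] assms by blast

lemma keys_mult_obtain:
  assumes "m \<in> keys (q * r)"
  obtains a b where "a \<in> keys q" "b \<in> keys r" "m = a + b"
  using keys_mult[of q r] assms by blast

lemma wedge_keys:
  fixes \<phi> \<psi> :: "nat set \<Rightarrow> 'k::field mpoly"
  assumes "m \<in> keys (wedge \<phi> \<psi> U)"
  obtains S a b where "finite U" "S \<subseteq> U" "a \<in> keys (\<phi> S)" "b \<in> keys (\<psi> (U - S))" "m = a + b"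
proof -
  have fin: "finite U" using assms wedge_infinite[of U \<phi> \<psi>] by fastforce
  obtain S where S: "S \<in> Pow U" "m \<in> keys ((- 1) ^ crossings S (U - S) * \<phi> S * \<psi> (U - S))"
    using assms unfolding wedge_def by (rule keys_sum_obtain)
  obtain a b where ab: "a \<in> keys ((- 1) ^ crossings S (U - S) * \<phi> S)"
    "b \<in> keys (\<psi> (U - S))" "m = a + b"
    using S(2) by (rule keys_mult_obtain)
  then show ?thesis using that[of S a b] fin S(1) by (simp add: keys_sign_mult)
qed

lemma single_one_neq_0 [simp]: "single a (1 :: 'k::field) \<noteq> 0"
  by (metis lookup_single_eq lookup_zero one_neq_zero)

context cone_complex
begin

definition \<Gamma> :: "nat set set" where "\<Gamma> = {F \<in> \<Delta>. p \<notin> F}"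

text \<open>The generator of a vertex \<open>i\<close> is the product of the variables \<open>y\<^sub>F\<close>, numbered \<open>2 * set_encode F\<close>, for the
  faces \<open>F\<close> of the base with \<open>i \<notin> F\<close>, and, unless \<open>i\<close> is the apex, of a variable of its own, numbered \<open>2 * i + 1\<close>.
  So the generator of the apex divides the least common multiple for a set of base vertices exactly
  if that set is not a face.\<close>

definition label :: "nat \<Rightarrow> nat set" where
  "label i = (if i = p then {} else {2 * i + 1}) \<union> {2 * set_encode F | F. F \<in> \<Gamma> \<and> i \<notin> F}"

definition labels :: "nat set \<Rightarrow> nat set" where "labels S = (\<Union>i\<in>S. label i)"

lemma finite_label: "finite (label i)"
proof -
  have "{2 * set_encode F | F. F \<in> \<Gamma> \<and> i \<notin> F} \<subseteq> (\<lambda>F. 2 * set_encode F) ` \<Delta>" by (auto simp: \<Gamma>_def)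
  then show ?thesis unfolding label_def using finite_complex finite_subset by fastforce
qed

lemma finite_labels: "finite S \<Longrightarrow> finite (labels S)"
  by (simp add: labels_def finite_label)

lemma labels_Un: "labels (S \<union> T) = labels S \<union> labels T"
  by (simp add: labels_def)

lemma labels_mono: "S \<subseteq> T \<Longrightarrow> labels S \<subseteq> labels T"
  by (auto simp: labels_def)

lemma apex_label_below_nonface:
  assumes "T \<subseteq> V" "T \<notin> \<Delta>" shows "label p \<subseteq> labels T"
proof
  fix x assume "x \<in> label p"
  then obtain F where F: "x = 2 * set_encode F" "F \<in> \<Gamma>" by (auto simp: label_def)
  then have "\<not> T \<subseteq> F" using assms(2) subface[of F T] by (auto simp: \<Gamma>_def)
  then obtain i where "i \<in> T" "i \<notin> F" by blast
  with F show "x \<in> labels T" by (auto simp: labels_def label_def)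
qed

lemma odd_label: "2 * j + 1 \<in> label k \<longleftrightarrow> j = k \<and> k \<noteq> p"
  by (auto simp: label_def) presburger+

text \<open>This makes the resolution minimal. A base vertex has its own variable; for the apex, the variable of the
  face \<open>U\<close> does not occur in the labels of the vertices of \<open>U\<close>.\<close>

lemma label_not_below:
  assumes S: "insert i U \<in> \<Delta>" "i \<notin> U" shows "\<not> label i \<subseteq> labels U"
proof
  assume sub: "label i \<subseteq> labels U"
  show False
  proof (cases "i = p")
    case False
    then have "2 * i + 1 \<in> labels U" using sub odd_label[of i i] by blast
    then show False using odd_label S(2) by (auto simp: labels_def)
  next
    case True
    have U: "U \<in> \<Gamma>" using S True subface[of "insert i U" U] by (auto simp: \<Gamma>_def)
    then have "2 * set_encode U \<in> label p" by (auto simp: label_def \<Gamma>_def)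
    then obtain j where j: "j \<in> U" "2 * set_encode U \<in> label j" using sub True by (auto simp: labels_def)
    have "2 * set_encode U \<noteq> 2 * j + 1" by presburger
    then obtain F where F: "F \<in> \<Gamma>" "j \<notin> F" "set_encode F = set_encode U"
      using j(2) by (auto simp: label_def split: if_splits)
    have "finite F" "finite U" using F(1) U finite_face by (auto simp: \<Gamma>_def)
    then have "F = U" using F(3) inj_on_set_encode by (simp add: inj_on_def)
    then show False using j F by simp
  qed
qed

context
  fixes n :: nat
  assumes n: "\<And>i. i \<in> insert p V \<Longrightarrow> label i \<subseteq> {..<n}"
begin

definition face_monomial :: "nat set \<Rightarrow> 'k::field mpoly" where
  "face_monomial S = single (squarefree_monomial (labels S)) 1"

lemma labels_bound: "S \<in> \<Delta> \<Longrightarrow> labels S \<subseteq> {..<n}"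
  using face_vertices n unfolding labels_def by blast

lemma face_monomial_polyring: "S \<in> \<Delta> \<Longrightarrow> face_monomial S \<in> polyring n"
  unfolding face_monomial_def using labels_bound
  by (intro polyring_single) (simp add: keys_squarefree_monomial finite_labels finite_face)

text \<open>A function on the faces with values in \<open>polyring n\<close> is admissible if its value at \<open>S\<close> is divisible by the least common multiple
  of the generators of \<open>S\<close>. For squarefree monomials this is an inclusion of supports.\<close>

definition admissible :: "(nat set \<Rightarrow> 'k::field mpoly) \<Rightarrow> bool" where
  "admissible \<phi> \<longleftrightarrow> (\<forall>U. \<forall>m\<in>keys (\<phi> U).
    U \<in> \<Delta> \<and> keys m \<subseteq> {..<n} \<and> labels U \<subseteq> keys m)"

definition homogeneous_fun :: "(nat \<Rightarrow> int) \<Rightarrow> (nat set \<Rightarrow> 'k::field mpoly) \<Rightarrow> bool" where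
  "homogeneous_fun a \<phi> \<longleftrightarrow> (\<forall>U. \<forall>m\<in>keys (\<phi> U). \<forall>j. int (lookup m j) = a j)"

lemma admissible_supported: "admissible \<phi> \<Longrightarrow> supported \<phi>"
  unfolding admissible_def supported_def by (metis ex_in_conv keys_eq_empty)

lemma admissibleD:
  "admissible \<phi> \<Longrightarrow> m \<in> keys (\<phi> U) \<Longrightarrow>
    U \<in> \<Delta> \<and> keys m \<subseteq> {..<n} \<and> labels U \<subseteq> keys m"
  by (simp add: admissible_def)

lemma boundary_keys:
  assumes "m \<in> keys (boundary \<phi> U)"
  obtains i where "i \<in> insert p V" "i \<notin> U" "m \<in> keys (\<phi> (insert i U) :: 'k::field mpoly)"
proof -
  obtain i where i: "i \<in> insert p V" "m \<in> keys (contract i \<phi> U)"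
    using assms unfolding boundary_eq_sum by (rule keys_sum_obtain)
  then have "i \<notin> U" "m \<in> keys (\<phi> (insert i U))"
    by (auto simp: contract_def keys_sign_mult split: if_splits)
  with i(1) show ?thesis by (rule that)
qed

lemma admissible_boundary: "admissible \<phi> \<Longrightarrow> admissible (boundary \<phi>)"
  unfolding admissible_def[of "boundary \<phi>"]
proof (intro allI ballI)
  fix U m assume \<phi>: "admissible \<phi>" and "m \<in> keys (boundary \<phi> U)"
  then obtain i where i: "m \<in> keys (\<phi> (insert i U))" using boundary_keys by metis
  show "U \<in> \<Delta> \<and> keys m \<subseteq> {..<n} \<and> labels U \<subseteq> keys m"
    using admissibleD[OF \<phi> i] subface[of "insert i U" U] labels_mono[of U "insert i U"] by blast
qed

lemma normal_form_keys:
  fixes \<chi> :: "nat set \<Rightarrow> 'k::field mpoly"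
  assumes m: "m \<in> keys (normal_form \<chi> U)"
  obtains "U \<in> \<Delta>" "m \<in> keys (\<chi> U)" |
    i where "U \<in> \<Delta>" "p \<in> U" "i \<in> V" "i \<notin> U" "insert i (U - {p}) \<notin> \<Delta>" "m \<in> keys (\<chi> (insert i (U - {p})))"
proof -
  have U: "U \<in> \<Delta>" using m supportedD[OF supported_normal_form, of U \<chi>] by fastforce
  let ?f = "\<lambda>i. if i \<in> U \<or> insert i (U - {p}) \<in> \<Delta> then 0
    else (- 1) ^ below i (U - {p}) * \<chi> (insert i (U - {p}))"
  have "m \<in> keys (\<chi> U) \<or> p \<in> U \<and> m \<in> keys ((- 1) ^ crossings {p} (U - {p}) * (\<Sum>i\<in>V. ?f i))"
    using m keys_add[of "\<chi> U" "(- 1) ^ crossings {p} (U - {p}) * (\<Sum>i\<in>V. ?f i)"]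
    unfolding normal_form_formula[OF U] by (cases "p \<in> U") auto
  then consider "m \<in> keys (\<chi> U)" | "p \<in> U" "m \<in> keys (\<Sum>i\<in>V. ?f i)"
    unfolding keys_sign_mult by blast
  then show ?thesis
  proof cases
    case 1
    with U show ?thesis by (rule that(1))
  next
    case 2
    from 2(2) obtain i where i: "i \<in> V" "m \<in> keys (?f i)" by (rule keys_sum_obtain)
    then have "i \<notin> U \<and> insert i (U - {p}) \<notin> \<Delta> \<and> m \<in> keys (\<chi> (insert i (U - {p})))"
      by (simp add: keys_sign_mult split: if_splits)
    with U 2(1) i(1) show ?thesis by (intro that(2)) auto
  qed
qed

text \<open>The corrections at \<open>U\<close> come from nonfaces \<open>T\<close>, and then \<open>labels T\<close> contains \<open>label p\<close>, hence \<open>labels U\<close>.\<close>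

lemma admissible_normal_form:
  fixes \<chi> :: "nat set \<Rightarrow> 'k::field mpoly"
  assumes \<chi>: "\<And>T m. m \<in> keys (\<chi> T) \<Longrightarrow>
    T \<subseteq> insert p V \<and> keys m \<subseteq> {..<n} \<and> labels T \<subseteq> keys m"
  shows "admissible (normal_form \<chi>)"
  unfolding admissible_def
proof (intro allI ballI)
  fix U m assume "m \<in> keys (normal_form \<chi> U)"
  then show "U \<in> \<Delta> \<and> keys m \<subseteq> {..<n} \<and> labels U \<subseteq> keys m"
  proof (cases rule: normal_form_keys)
    case 1
    then show ?thesis using \<chi> by blast
  next
    case (2 i)
    let ?T = "insert i (U - {p})"
    note T = \<chi>[OF 2(6)]
    have "?T \<subseteq> V" using T p_notin_V 2 by blast
    then have "label p \<subseteq> labels ?T" using apex_label_below_nonface 2 by blast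
    moreover have "labels U \<subseteq> labels ?T \<union> label p" using 2 by (auto simp: labels_def)
    ultimately show ?thesis using T 2(1) by blast
  qed
qed

lemma homogeneous_normal_form: "homogeneous_fun a \<chi> \<Longrightarrow> homogeneous_fun a (normal_form \<chi>)"
  unfolding homogeneous_fun_def[of a "normal_form \<chi>"]
proof (intro allI ballI)
  fix U m j assume \<chi>: "homogeneous_fun a \<chi>" and "m \<in> keys (normal_form \<chi> U)"
  from this(2) show "int (lookup m j) = a j"
    by (cases rule: normal_form_keys) (use \<chi> in \<open>auto simp: homogeneous_fun_def\<close>)
qed

lemma degree_normal_form:
  fixes \<chi> :: "nat set \<Rightarrow> 'k::field mpoly"
  assumes "\<And>U. finite U \<Longrightarrow> \<chi> U \<noteq> 0 \<Longrightarrow> card U = i" shows "of_degree i (normal_form \<chi>)"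
  unfolding of_degree_def
proof (intro conjI allI impI supported_normal_form)
  fix U assume "normal_form \<chi> U \<noteq> 0"
  then obtain m where "m \<in> keys (normal_form \<chi> U)" by (metis ex_in_conv keys_eq_empty)
  then show "card U = i"
  proof (cases rule: normal_form_keys)
    case 1
    then show ?thesis using assms[of U] finite_face by fastforce
  next
    case (2 l)
    have U: "finite U" using 2(1) finite_face by blast
    then have "card (insert l (U - {p})) = card U" using 2 card_Suc_Diff1[OF U 2(2)] by simp
    moreover have "card (insert l (U - {p})) = i" using 2(6) U by (intro assms) auto
    ultimately show ?thesis by simp
  qed
qed

lemma admissible_star: "admissible \<phi> \<Longrightarrow> admissible \<psi> \<Longrightarrow> admissible (star \<phi> \<psi>)"
  unfolding star_def
proof (rule admissible_normal_form)
  fix T m assume \<phi>: "admissible \<phi>" and \<psi>: "admissible \<psi>" and "m \<in> keys (wedge \<phi> \<psi> T)"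
  then obtain S a b where S: "S \<subseteq> T" "a \<in> keys (\<phi> S)" "b \<in> keys (\<psi> (T - S))" "m = a + b"
    using wedge_keys by metis
  note A = admissibleD[OF \<phi> S(2)] and B = admissibleD[OF \<psi> S(3)]
  have "labels T = labels S \<union> labels (T - S)" using S(1) labels_Un[of S "T - S"] by (simp add: Un_absorb1)
  moreover have "T \<subseteq> insert p V" using face_vertices A B S(1) by blast
  ultimately show "T \<subseteq> insert p V \<and> keys m \<subseteq> {..<n} \<and> labels T \<subseteq> keys m"
    using A B unfolding S(4) keys_monomial_add by blast
qed

lemma homogeneous_star:
  "homogeneous_fun a \<phi> \<Longrightarrow> homogeneous_fun b \<psi> \<Longrightarrow> homogeneous_fun (\<lambda>j. a j + b j) (star \<phi> \<psi>)"
  unfolding star_def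
proof (rule homogeneous_normal_form)
  assume \<phi>: "homogeneous_fun a \<phi>" and \<psi>: "homogeneous_fun b \<psi>"
  show "homogeneous_fun (\<lambda>j. a j + b j) (wedge \<phi> \<psi>)"
    unfolding homogeneous_fun_def
  proof (intro allI ballI)
    fix U m j assume "m \<in> keys (wedge \<phi> \<psi> U)"
    then obtain S c e where "c \<in> keys (\<phi> S)" "e \<in> keys (\<psi> (U - S))" "m = c + e"
      using wedge_keys by metis
    then show "int (lookup m j) = a j + b j"
      using \<phi> \<psi> by (simp add: homogeneous_fun_def lookup_add)
  qed
qed

lemma degree_star:
  fixes \<phi> \<psi> :: "nat set \<Rightarrow> 'k::field mpoly"
  shows "of_degree i \<phi> \<Longrightarrow> of_degree j \<psi> \<Longrightarrow> of_degree (i + j) (star \<phi> \<psi>)"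
  unfolding star_def
proof (rule degree_normal_form)
  fix U assume \<phi>: "of_degree i \<phi>" and \<psi>: "of_degree j \<psi>" and U: "finite U" "wedge \<phi> \<psi> U \<noteq> 0"
  obtain S where S: "S \<subseteq> U" "\<phi> S \<noteq> 0" "\<psi> (U - S) \<noteq> 0"
    using U(2) by (rule wedge_nonzero_obtain)
  then have "card S = i" "card (U - S) = j" using \<phi> \<psi> by (auto simp: of_degree_def)
  then show "card U = i + j"
    using card_Un_disjoint[of S "U - S"] S(1) U(1) finite_subset[OF S(1)] by (auto simp: Un_absorb1)
qed

lemma degree_boundary:
  fixes \<phi> :: "nat set \<Rightarrow> 'k::field mpoly"
  assumes \<phi>: "of_degree (Suc i) \<phi>" shows "of_degree i (boundary \<phi>)"
  unfolding of_degree_def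
proof (intro conjI allI impI)
  show s: "supported (boundary \<phi>)" using \<phi> by (simp add: of_degree_def supported_boundary)
  fix U assume U: "boundary \<phi> U \<noteq> 0"
  then obtain m where "m \<in> keys (boundary \<phi> U)" by (metis ex_in_conv keys_eq_empty)
  then obtain l where l: "l \<notin> U" "m \<in> keys (\<phi> (insert l U))" using boundary_keys by metis
  have "\<phi> (insert l U) \<noteq> 0" using l(2) by auto
  then have "card (insert l U) = Suc i" using \<phi> unfolding of_degree_def by blast
  moreover have "finite U" using U supportedD[OF s] finite_face by blast
  ultimately show "card U = i" using l(1) by simp
qed

lemma homogeneous_boundary: "homogeneous_fun a \<phi> \<Longrightarrow> homogeneous_fun a (boundary \<phi>)"
  unfolding homogeneous_fun_def[of a "boundary \<phi>"]
proof (intro allI ballI)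
  fix U m j assume \<phi>: "homogeneous_fun a \<phi>" and "m \<in> keys (boundary \<phi> U)"
  then obtain i where "m \<in> keys (\<phi> (insert i U))" using boundary_keys by metis
  then show "int (lookup m j) = a j" using \<phi> by (simp add: homogeneous_fun_def)
qed

text \<open>A cycle of positive degree is a boundary: in the multidegree of a monomial \<open>m\<close> that occurs in it, some vertex
  \<open>i\<close> has a generator dividing \<open>m\<close>, and multiplication by \<open>e\<^sub>i\<close> is a contracting homotopy there.\<close>

lemma boundary_exact:
  fixes \<phi> :: "nat set \<Rightarrow> 'k::field mpoly"
  assumes adm: "admissible \<phi>" and deg: "of_degree (Suc i) \<phi>" and cyc: "\<And>U. boundary \<phi> U = 0"
  shows "\<exists>\<psi>. admissible \<psi> \<and> of_degree (Suc (Suc i)) \<psi> \<and> boundary \<psi> = \<phi>"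
proof -
  define M where "M = (\<Union>S\<in>\<Delta>. keys (\<phi> S))"
  have finM: "finite M" by (simp add: M_def finite_complex)
  define part where "part m U = single m (lookup (\<phi> U) m)" for m U
  have sup: "supported \<phi>" by (rule admissible_supported[OF adm])
  have supp: "supported (part m)" for m
    using sup by (simp add: supported_def part_def)
  have part_nz: "m \<in> keys (\<phi> U) \<and> m' = m" if "m' \<in> keys (part m U)" for m m' U
    using that by (auto simp: part_def in_keys_iff split: if_splits)
  have part_sum: "(\<Sum>m\<in>M. part m U) = \<phi> U" for U
  proof -
    have "keys (\<phi> U) \<subseteq> M"
    proof (cases "U \<in> \<Delta>")
      case False
      then show ?thesis using supportedD[OF sup] by simp
    qed (auto simp: M_def)
    then show ?thesis using poly_mapping_sum_singles[OF finM, of "\<phi> U"] by (simp add: part_def)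
  qed
  have part_bd: "boundary (part m) U = 0" for m U
  proof -
    have "contract l (part m) U = single m (lookup (contract l \<phi> U) m)" for l
      by (cases "even (below l U)") (simp_all add: contract_def part_def single_uminus)
    then have "boundary (part m) U = (\<Sum>l\<in>insert p V. single m (lookup (contract l \<phi> U) m))"
      unfolding boundary_eq_sum by simp
    also have "\<dots> = single m (lookup (boundary \<phi> U) m)"
      unfolding boundary_eq_sum lookup_sum
      by (rule poly_mapping_eqI) (simp add: lookup_sum lookup_single when_def)
    finally show ?thesis using cyc[of U] by simp
  qed
  have ex: "\<exists>j. j \<in> insert p V \<and> label j \<subseteq> keys m \<and> keys m \<subseteq> {..<n}" if m: "m \<in> M" for m
  proof -
    obtain S where S: "S \<in> \<Delta>" "m \<in> keys (\<phi> S)" using m by (auto simp: M_def)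
    have "\<phi> S \<noteq> 0" using S(2) by auto
    then have "card S = Suc i" using deg unfolding of_degree_def by blast
    then obtain j where j: "j \<in> S" by fastforce
    have "label j \<subseteq> labels S" using j by (auto simp: labels_def)
    also have "labels S \<subseteq> keys m" using admissibleD[OF adm S(2)] by (elim conjE)
    finally have "label j \<subseteq> keys m" .
    moreover have "j \<in> insert p V" by (rule subsetD[OF face_vertices[OF S(1)] j])
    ultimately show ?thesis using admissibleD[OF adm S(2)] by (intro exI[of _ j]) simp
  qed
  define v where "v m = (SOME j. j \<in> insert p V \<and> label j \<subseteq> keys m \<and> keys m \<subseteq> {..<n})" for m :: "nat \<Rightarrow>\<^sub>0 nat"
  have v: "v m \<in> insert p V \<and> label (v m) \<subseteq> keys m \<and> keys m \<subseteq> {..<n}" if "m \<in> M" for m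
    unfolding v_def by (rule someI_ex[OF ex[OF that]])
  define \<chi> where "\<chi> m = wedge (unit_vec {v m}) (part m)" for m
  have \<chi>: "\<chi> m T \<noteq> 0 \<Longrightarrow> finite T \<and> v m \<in> T \<and> part m (T - {v m}) \<noteq> 0" for m T
    by (auto simp: \<chi>_def wedge_unit_vec_left split: if_splits)
  have \<chi>k: "m' = m \<and> finite T \<and> v m \<in> T \<and> m \<in> keys (\<phi> (T - {v m}))"
    if "m' \<in> keys (\<chi> m T)" for m m' T
    using that part_nz[of m' m "T - {v m}"] by (auto simp: \<chi>_def wedge_unit_vec_left keys_sign_mult split: if_splits)
  define \<psi> where "\<psi> U = (\<Sum>m\<in>M. normal_form (\<chi> m) U)" for U
  have a: "admissible (normal_form (\<chi> m))" if m: "m \<in> M" for m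
  proof (rule admissible_normal_form)
    fix T m' assume "m' \<in> keys (\<chi> m T)"
    note T = \<chi>k[OF this]
    note A = admissibleD[OF adm, of m "T - {v m}"]
    have "labels T = labels (T - {v m}) \<union> label (v m)" using T by (auto simp: labels_def)
    moreover have "T \<subseteq> insert p V" using face_vertices[of "T - {v m}"] A T v[OF m] by blast
    ultimately show "T \<subseteq> insert p V \<and> keys m' \<subseteq> {..<n} \<and> labels T \<subseteq> keys m'"
      using A T v[OF m] by auto
  qed
  have d: "of_degree (Suc (Suc i)) (normal_form (\<chi> m))" for m
  proof (rule degree_normal_form)
    fix U assume U: "finite U" "\<chi> m U \<noteq> 0"
    have "\<phi> (U - {v m}) \<noteq> 0" using \<chi>[OF U(2)] by (auto simp: part_def)
    then have "card (U - {v m}) = Suc i" using deg unfolding of_degree_def by blast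
    then show "card U = Suc (Suc i)" using \<chi>[OF U(2)] card_Suc_Diff1[OF U(1), of "v m"] by simp
  qed
  have "admissible \<psi>"
    unfolding admissible_def \<psi>_def using a by (metis (no_types, lifting) admissibleD keys_sum_obtain)
  moreover have "of_degree (Suc (Suc i)) \<psi>"
    unfolding of_degree_def
  proof (intro conjI allI impI)
    show "supported \<psi>"
      using supportedD[OF supported_normal_form] by (auto simp: supported_def \<psi>_def intro!: sum.neutral)
    fix U assume "\<psi> U \<noteq> 0"
    then obtain m where "normal_form (\<chi> m) U \<noteq> 0" unfolding \<psi>_def by (meson sum.not_neutral_contains_not_neutral)
    then show "card U = Suc (Suc i)" using d[of m] unfolding of_degree_def by blast
  qed
  moreover have "boundary \<psi> = \<phi>"
  proof (rule HOL.ext)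
    fix U
    have "boundary (normal_form (\<chi> m)) = part m" if "m \<in> M" for m
    proof -
      have "normal_form (boundary (\<chi> m)) = normal_form (part m)"
      proof (rule supported_eqI[OF supported_normal_form supported_normal_form])
        have bc: "boundary (\<chi> m) S = part m S" if "finite S" for S
          using boundary_unit_wedge[of "v m" S "part m"] v[OF \<open>m \<in> M\<close>] that part_bd
          by (simp add: \<chi>_def wedge_unit_vec_left)
        fix U assume U: "U \<in> \<Delta>"
        have f: "finite U" using U finite_face by blast
        show "normal_form (boundary (\<chi> m)) U = normal_form (part m) U"
          unfolding normal_form_formula[OF U] using f by (simp add: bc cong: if_cong sum.cong)
      qed
      then show ?thesis by (simp add: boundary_normal_form normal_form_supported[OF supp])
    qed
    then show "boundary \<psi> U = \<phi> U"
      unfolding \<psi>_def boundary_sum using part_sum[of U] by simp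
  qed
  ultimately show ?thesis by blast
qed

text \<open>Multiplying the coordinate at each face \<open>S\<close> by the monomial of \<open>S\<close> identifies the free module on the faces with the
  module of admissible functions. There the operations of the exterior algebra apply as they are, and their
  identities carry over to the free module.\<close>

definition E0 :: "(nat, 'k::field) fvec set" where
  "E0 = {v. keys v \<subseteq> set_encode ` \<Delta> \<and> (\<forall>b. lookup v b \<in> polyring n)}"

definition Phi :: "(nat, 'k::field) fvec \<Rightarrow> nat set \<Rightarrow> 'k mpoly" where
  "Phi v S = (if S \<in> \<Delta> then face_monomial S * lookup v (set_encode S) else 0)"

definition of_fun :: "(nat set \<Rightarrow> 'k::field mpoly) \<Rightarrow> (nat, 'k) fvec" where
  "of_fun \<phi> = (SOME v. v \<in> E0 \<and> Phi v = \<phi>)"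

lemma encode_face_eq: "S \<in> \<Delta> \<Longrightarrow> T \<in> \<Delta> \<Longrightarrow> set_encode S = set_encode T \<longleftrightarrow> S = T"
  by (metis finite_face set_encode_inverse)

lemma keys_monomial_mult:
  fixes q :: "'k::field mpoly"
  shows "m \<in> keys (single a 1 * q) \<longleftrightarrow> (\<exists>k\<in>keys q. m = a + k)"
proof (cases "\<exists>k. m = a + k")
  case True
  then obtain k where k: "m = a + k" by blast
  then show ?thesis by (auto simp: in_keys_iff lookup_single_times_add)
next
  case False
  then show ?thesis by (auto simp: in_keys_iff lookup_single_times_zero)
qed

lemma Phi_keys: "m \<in> keys (Phi v S) \<longleftrightarrow> S \<in> \<Delta> \<and>
    (\<exists>k\<in>keys (lookup v (set_encode S)). m = squarefree_monomial (labels S) + k)"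
  by (simp add: Phi_def face_monomial_def keys_monomial_mult)

lemma Phi_add: "Phi (v + w) = (\<lambda>S. Phi v S + Phi w S)"
  and Phi_smult: "Phi (smult q v) = (\<lambda>S. q * Phi v S)"
  and Phi_0: "Phi 0 = (\<lambda>S. 0)"
  by (simp_all add: fun_eq_iff Phi_def lookup_add algebra_simps)

lemma Phi_inject:
  assumes "v \<in> E0" "w \<in> E0" "Phi v = Phi w" shows "v = w"
proof (rule poly_mapping_eqI)
  fix b
  show "lookup v b = lookup w b"
  proof (cases "b \<in> set_encode ` \<Delta>")
    case True
    then obtain S where "S \<in> \<Delta>" "b = set_encode S" by blast
    then show ?thesis
      using fun_cong[OF assms(3), of S] by (simp add: Phi_def face_monomial_def single_one_mult_cancel)
  next
    case False
    then have "b \<notin> keys v" "b \<notin> keys w" using assms(1,2) by (auto simp: E0_def)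
    then show ?thesis by (simp add: in_keys_iff)
  qed
qed

lemma Phi_admissible: "v \<in> E0 \<Longrightarrow> admissible (Phi v)"
  unfolding admissible_def
proof (intro allI ballI)
  fix U m assume v: "v \<in> E0" and "m \<in> keys (Phi v U)"
  then obtain k where k: "U \<in> \<Delta>" "k \<in> keys (lookup v (set_encode U))"
    "m = squarefree_monomial (labels U) + k" by (auto simp: Phi_keys)
  have "keys k \<subseteq> {..<n}" using v k(2) by (auto simp: E0_def polyring_def)
  then show "U \<in> \<Delta> \<and> keys m \<subseteq> {..<n} \<and> labels U \<subseteq> keys m"
    using k(1) labels_bound[OF k(1)] finite_labels[OF finite_face[OF k(1)]]
    unfolding k(3) keys_monomial_add by (simp add: keys_squarefree_monomial)
qed

lemma Phi_surj: assumes \<phi>: "admissible \<phi>" shows "\<exists>v\<in>E0. Phi v = \<phi>"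
proof -
  have "\<exists>q. \<phi> S = face_monomial S * q \<and> q \<in> polyring n" for S
  proof -
    have "\<exists>k. m = squarefree_monomial (labels S) + k" if "m \<in> keys (\<phi> S)" for m
    proof -
      have "finite (labels S)" "labels S \<subseteq> keys m"
        using admissibleD[OF \<phi> that] finite_labels finite_face by blast+
      then have "m = squarefree_monomial (labels S) + (m - squarefree_monomial (labels S))"
        by (intro poly_mapping_eqI) (auto simp: lookup_add lookup_minus lookup_squarefree_monomial in_keys_iff)
      then show ?thesis by blast
    qed
    then obtain q where q: "\<phi> S = face_monomial S * q" "\<And>n. \<phi> S \<in> polyring n \<Longrightarrow> q \<in> polyring n"
      using monomial_divides_sum[of "\<phi> S" "squarefree_monomial (labels S)"] unfolding face_monomial_def by blast
    have "\<phi> S \<in> polyring n" using admissibleD[OF \<phi>] by (auto simp: polyring_def)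
    with q show ?thesis by blast
  qed
  then obtain q where q: "\<And>S. \<phi> S = face_monomial S * q S" "\<And>S. q S \<in> polyring n" by metis
  define v where "v = (\<Sum>S\<in>\<Delta>. single (set_encode S) (q S))"
  have lk: "lookup v (set_encode T) = q T" if T: "T \<in> \<Delta>" for T
  proof -
    have "lookup v (set_encode T) = (\<Sum>S\<in>\<Delta>. if S = T then q S else 0)"
      unfolding v_def lookup_sum by (intro sum.cong refl) (simp add: lookup_single encode_face_eq T when_def)
    then show ?thesis using T finite_complex by simp
  qed
  have "keys v \<subseteq> set_encode ` \<Delta>"
    unfolding v_def by (auto elim!: keys_sum_obtain split: if_splits)
  moreover have "lookup v b \<in> polyring n" for b
    unfolding v_def lookup_sum by (intro polyring_sum) (auto simp: lookup_single when_def q(2))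
  ultimately have "v \<in> E0" by (simp add: E0_def)
  moreover have "Phi v = \<phi>"
    using lk q(1) supportedD[OF admissible_supported[OF \<phi>]] by (auto simp: fun_eq_iff Phi_def)
  ultimately show ?thesis by blast
qed

lemma of_fun: assumes "admissible \<phi>" shows "of_fun \<phi> \<in> E0" "Phi (of_fun \<phi>) = \<phi>"
proof -
  have "\<exists>v. v \<in> E0 \<and> Phi v = \<phi>" using Phi_surj[OF assms] by blast
  from someI_ex[OF this] show "of_fun \<phi> \<in> E0" "Phi (of_fun \<phi>) = \<phi>" by (simp_all add: of_fun_def)
qed

text \<open>The simplicial resolution supported on \<open>\<Delta>\<close>, with the vertices labelled by the monomials of the sets
  \<open>label i\<close>.\<close>

definition cone_resolution :: "(nat, 'k::field) graded_free_complex" where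
  "cone_resolution = \<lparr>basis = set_encode ` \<Delta>, hdeg = \<lambda>b. card (set_decode b), gen0 = 0,
    bdry = \<lambda>v. of_fun (boundary (Phi v)), mdeg = \<lambda>b j. if j \<in> labels (set_decode b) then 1 else 0\<rparr>"

definition cone_mult :: "(nat, 'k::field) fvec \<Rightarrow> (nat, 'k) fvec \<Rightarrow> (nat, 'k) fvec" where
  "cone_mult v w = of_fun (star (Phi v) (Phi w))"

definition cone_ideal :: "'k::field mpoly set" where
  "cone_ideal = ideal_generated n ((\<lambda>i. face_monomial {i}) ` insert p V)"

lemma cone_resolution_simps [simp]:
  "basis cone_resolution = set_encode ` \<Delta>" "hdeg cone_resolution b = card (set_decode b)"
  "gen0 cone_resolution = 0" "bdry cone_resolution v = of_fun (boundary (Phi v))"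
  "mdeg cone_resolution b j = (if j \<in> labels (set_decode b) then 1 else 0)"
  by (simp_all add: cone_resolution_def)

lemma elems_E0 [simp]: "elems n cone_resolution = E0"
  by (simp add: elems_def E0_def)

lemma decode_encode: "S \<in> \<Delta> \<Longrightarrow> set_decode (set_encode S) = S"
  by (simp add: set_encode_inverse finite_face)

lemma component_Phi: "v \<in> component n cone_resolution i \<longleftrightarrow> v \<in> E0 \<and> of_degree i (Phi v)"
proof (cases "v \<in> E0")
  case True
  have nz: "Phi v S \<noteq> 0 \<longleftrightarrow> S \<in> \<Delta> \<and> set_encode S \<in> keys v" for S
    using single_one_mult_cancel[of "squarefree_monomial (labels S)" "lookup v (set_encode S)" 0]
    by (auto simp: Phi_def face_monomial_def in_keys_iff)
  have "(\<forall>b\<in>keys v. card (set_decode b) = i) \<longleftrightarrow> (\<forall>S. Phi v S \<noteq> 0 \<longrightarrow> card S = i)"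
  proof
    assume "\<forall>b\<in>keys v. card (set_decode b) = i"
    then show "\<forall>S. Phi v S \<noteq> 0 \<longrightarrow> card S = i" using nz decode_encode by metis
  next
    assume *: "\<forall>S. Phi v S \<noteq> 0 \<longrightarrow> card S = i"
    show "\<forall>b\<in>keys v. card (set_decode b) = i"
    proof
      fix b assume b: "b \<in> keys v"
      then obtain S where "S \<in> \<Delta>" "b = set_encode S" using True by (auto simp: E0_def)
      then show "card (set_decode b) = i" using * nz[of S] b by (simp add: decode_encode)
    qed
  qed
  then show ?thesis
    using True admissible_supported[OF Phi_admissible[OF True]] by (simp add: component_def of_degree_def)
qed (simp add: component_def)

lemma homogeneous_Phi: "v \<in> homogeneous n cone_resolution a \<longleftrightarrow> v \<in> E0 \<and> homogeneous_fun a (Phi v)"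
proof (cases "v \<in> E0")
  case True
  have "(\<forall>b\<in>keys v. \<forall>m\<in>keys (lookup v b). \<forall>j.
      int (lookup m j) + (if j \<in> labels (set_decode b) then 1 else 0) = a j) \<longleftrightarrow> homogeneous_fun a (Phi v)"
    (is "?L \<longleftrightarrow> _")
  proof
    assume L: ?L
    show "homogeneous_fun a (Phi v)"
      unfolding homogeneous_fun_def
    proof (intro allI ballI)
      fix S m j assume "m \<in> keys (Phi v S)"
      then obtain k where k: "S \<in> \<Delta>" "k \<in> keys (lookup v (set_encode S))"
        "m = squarefree_monomial (labels S) + k" by (auto simp: Phi_keys)
      moreover have "set_encode S \<in> keys v" using k(2) by (auto simp: in_keys_iff)
      ultimately have "int (lookup k j) + (if j \<in> labels S then 1 else 0) = a j"
        using L decode_encode[OF k(1)] by metis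
      then show "int (lookup m j) = a j"
        unfolding k(3) lookup_add using finite_labels[OF finite_face[OF k(1)]]
        by (auto simp: lookup_squarefree_monomial split: if_splits)
    qed
  next
    assume R: "homogeneous_fun a (Phi v)"
    show ?L
    proof (intro ballI allI)
      fix b m j assume b: "b \<in> keys v" and m: "m \<in> keys (lookup v b)"
      obtain S where S: "S \<in> \<Delta>" "b = set_encode S" using b True by (auto simp: E0_def)
      have "squarefree_monomial (labels S) + m \<in> keys (Phi v S)"
        using m S by (auto simp: Phi_keys)
      then have "int (lookup (squarefree_monomial (labels S) + m) j) = a j"
        using R unfolding homogeneous_fun_def by blast
      then show "int (lookup m j) + (if j \<in> labels (set_decode b) then 1 else 0) = a j"
        unfolding lookup_add S(2) decode_encode[OF S(1)] using finite_labels[OF finite_face[OF S(1)]]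
        by (auto simp: lookup_squarefree_monomial split: if_splits)
    qed
  qed
  then show ?thesis using True by (simp add: homogeneous_def)
qed (simp add: homogeneous_def)

lemma Phi_bdry:
  assumes "v \<in> E0"
  shows "bdry cone_resolution v \<in> E0" "Phi (bdry cone_resolution v) = boundary (Phi v)"
  using of_fun[OF admissible_boundary[OF Phi_admissible[OF assms]]] by simp_all

lemma Phi_mult:
  assumes "v \<in> E0" "w \<in> E0"
  shows "cone_mult v w \<in> E0" "Phi (cone_mult v w) = star (Phi v) (Phi w)"
  using of_fun[OF admissible_star[OF Phi_admissible[OF assms(1)] Phi_admissible[OF assms(2)]]]
  by (simp_all add: cone_mult_def)

lemma E0_closed: "v \<in> E0 \<Longrightarrow> w \<in> E0 \<Longrightarrow> v + w \<in> E0" "q \<in> polyring n \<Longrightarrow> v \<in> E0 \<Longrightarrow> smult q v \<in> E0"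
  using elems_add[of v n "cone_resolution :: (nat, 'a) graded_free_complex" w]
    elems_smult[of q n v "cone_resolution :: (nat, 'a) graded_free_complex"] by simp_all

lemma E0_0: "0 \<in> E0"
  by (simp add: E0_def)

lemma cone_linear_bdry: "linear_bdry n (cone_resolution :: (nat, 'k::field) graded_free_complex)"
  unfolding linear_bdry_iff linear_on_def elems_E0
proof (intro conjI ballI)
  let ?F = "cone_resolution :: (nat, 'k) graded_free_complex"
  fix v w :: "(nat, 'k) fvec" assume v: "v \<in> E0" and w: "w \<in> E0"
  note bd = Phi_bdry[OF v] Phi_bdry[OF w] Phi_bdry[OF E0_closed(1)[OF v w]]
  have "Phi (bdry ?F (v + w)) = Phi (bdry ?F v + bdry ?F w)"
    unfolding Phi_add bd by (simp add: fun_eq_iff boundary_add)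
  then show "bdry ?F (v + w) = bdry ?F v + bdry ?F w"
    by (rule Phi_inject[OF bd(5) E0_closed(1)[OF bd(1,3)]])
next
  let ?F = "cone_resolution :: (nat, 'k) graded_free_complex"
  fix q :: "'k mpoly" and v :: "(nat, 'k) fvec" assume q: "q \<in> polyring n" and v: "v \<in> E0"
  note bd = Phi_bdry[OF v] Phi_bdry[OF E0_closed(2)[OF q v]]
  have "Phi (bdry ?F (smult q v)) = Phi (smult q (bdry ?F v))"
    unfolding Phi_smult bd by (simp add: fun_eq_iff boundary_smult)
  then show "bdry ?F (smult q v) = smult q (bdry ?F v)"
    by (rule Phi_inject[OF bd(3) E0_closed(2)[OF q bd(1)]])
qed

lemma face_monomial_empty: "face_monomial {} = 1"
  by (simp add: face_monomial_def labels_def squarefree_monomial_def)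

lemma single_0_E0: "q \<in> polyring n \<Longrightarrow> single 0 q \<in> E0"
  using empty_face by (auto simp: E0_def lookup_single when_def image_iff intro!: bexI[of _ "{}"] split: if_splits)

lemma Phi_single_0: "Phi (single 0 q) = (\<lambda>U. q * unit_vec {} U)"
proof (rule HOL.ext)
  fix U
  have "U \<in> \<Delta> \<Longrightarrow> set_encode U = 0 \<longleftrightarrow> U = {}" using encode_face_eq[of U "{}"] empty_face by simp
  then show "Phi (single 0 q) U = q * unit_vec {} U"
    using empty_face by (auto simp: Phi_def unit_vec_def lookup_single when_def face_monomial_empty)
qed

lemma boundary_degree_0: assumes "of_degree 0 \<phi>" shows "boundary (\<phi> :: nat set \<Rightarrow> 'k::field mpoly) U = 0"
proof (rule ccontr)
  assume nz: "boundary \<phi> U \<noteq> 0"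
  then obtain m where "m \<in> keys (boundary \<phi> U)" by (metis ex_in_conv keys_eq_empty)
  then obtain i where "m \<in> keys (\<phi> (insert i U))" using boundary_keys by metis
  then have "\<phi> (insert i U) \<noteq> 0" by auto
  then have "card (insert i U) = 0" "insert i U \<in> \<Delta>"
    using assms unfolding of_degree_def supported_def by blast+
  then show False using finite_face by fastforce
qed

lemma bdry_degree_1:
  assumes v: "v \<in> component n cone_resolution 1"
  shows "bdry cone_resolution v =
    single 0 (\<Sum>j\<in>insert p V. lookup v (set_encode {j}) * face_monomial {j})" (is "_ = single 0 ?q")
proof (rule Phi_inject)
  have E: "v \<in> E0" and deg: "of_degree (Suc 0) (Phi v)" using v by (simp_all add: component_Phi)
  show "bdry cone_resolution v \<in> E0" by (rule Phi_bdry[OF E])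
  have "?q \<in> polyring n"
    using E vertex by (intro polyring_sum polyring_mult face_monomial_polyring) (auto simp: E0_def)
  then show "single 0 ?q \<in> E0" by (rule single_0_E0)
  show "Phi (bdry cone_resolution v) = Phi (single 0 ?q)"
    unfolding Phi_bdry[OF E] Phi_single_0
  proof (rule HOL.ext)
    fix U
    show "boundary (Phi v) U = ?q * unit_vec {} U"
    proof (cases "U = {}")
      case True
      have "contract j (Phi v) {} = lookup v (set_encode {j}) * face_monomial {j}" if "j \<in> insert p V" for j
        using vertex[OF that] by (simp add: contract_def below_def Phi_def mult.commute)
      then show ?thesis unfolding boundary_eq_sum True by (simp add: unit_vec_def)
    next
      case False
      have "boundary (Phi v) U = 0"
      proof (rule ccontr)
        assume nz: "boundary (Phi v) U \<noteq> 0"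
        then have "card U = 0" "U \<in> \<Delta>"
          using degree_boundary[OF deg] unfolding of_degree_def supported_def by blast+
        then show False using False finite_face by auto
      qed
      then show ?thesis using False by (simp add: unit_vec_def)
    qed
  qed
qed

lemma inj_face_monomial: "inj_on (\<lambda>i. face_monomial {i} :: 'k::field mpoly) (insert p V)"
proof (rule inj_onI)
  fix i j assume "(face_monomial {i} :: 'k mpoly) = face_monomial {j}"
  then have "squarefree_monomial (labels {i}) = squarefree_monomial (labels {j})"
    unfolding face_monomial_def by (metis (no_types) keys_single one_neq_zero singleton_inject)
  then have "labels {i} = labels {j}"
    using keys_squarefree_monomial[OF finite_labels] by (metis finite.emptyI finite_insert)
  then have "label i = label j" by (simp add: labels_def)
  then show "i = j" using odd_label[of i i] odd_label[of j j] odd_label[of i j] odd_label[of j i] by metis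
qed

lemma cone_ideal_iff:
  fixes q :: "'k::field mpoly"
  shows "q \<in> cone_ideal \<longleftrightarrow>
    (\<exists>c. (\<forall>j\<in>insert p V. c j \<in> polyring n) \<and> q = (\<Sum>j\<in>insert p V. c j * face_monomial {j}))"
proof
  let ?G = "(\<lambda>i. face_monomial {i} :: 'k mpoly) ` insert p V"
  assume "q \<in> cone_ideal"
  then obtain A c where A: "finite A" "A \<subseteq> ?G" "\<forall>g\<in>A. c g \<in> polyring n" "q = (\<Sum>g\<in>A. c g * g)"
    unfolding cone_ideal_def ideal_generated_def by auto
  have "q = (\<Sum>g\<in>?G. (if g \<in> A then c g else 0) * g)"
    unfolding A(4) using A(2) finite_V by (intro sum.mono_neutral_cong_left) auto
  also have "\<dots> = (\<Sum>j\<in>insert p V. (if face_monomial {j} \<in> A then c (face_monomial {j}) else 0) * face_monomial {j})"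
    by (subst sum.reindex[OF inj_face_monomial]) simp
  finally show "\<exists>c. (\<forall>j\<in>insert p V. c j \<in> polyring n) \<and> q = (\<Sum>j\<in>insert p V. c j * face_monomial {j})"
    using A(3) by (intro exI[of _ "\<lambda>j. if face_monomial {j} \<in> A then c (face_monomial {j}) else 0"]) simp
next
  let ?G = "(\<lambda>i. face_monomial {i} :: 'k mpoly) ` insert p V"
  assume "\<exists>c. (\<forall>j\<in>insert p V. c j \<in> polyring n) \<and> q = (\<Sum>j\<in>insert p V. c j * face_monomial {j})"
  then obtain c where c: "\<And>j. j \<in> insert p V \<Longrightarrow> c j \<in> polyring n" "q = (\<Sum>j\<in>insert p V. c j * face_monomial {j})" by blast
  define d where "d g = c (inv_into (insert p V) (\<lambda>i. face_monomial {i}) g)" for g :: "'k mpoly"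
  have d: "d (face_monomial {j}) = c j" if "j \<in> insert p V" for j
  proof -
    have "inj_on (\<lambda>i. face_monomial {i} :: 'k mpoly) (insert p V)" by (rule inj_face_monomial)
    from inv_into_f_f[OF this that] show ?thesis by (simp add: d_def)
  qed
  have "q = (\<Sum>g\<in>?G. d g * g)"
    unfolding c(2) by (subst sum.reindex[OF inj_face_monomial]) (simp add: d)
  moreover have "\<forall>g\<in>?G. d g \<in> polyring n" using c(1) d by auto
  ultimately show "q \<in> cone_ideal"
    unfolding cone_ideal_def ideal_generated_def mem_Collect_eq using finite_V by (intro exI[of _ ?G] exI[of _ d]) auto
qed

lemma cone_free_resolution:
  "free_resolution n cone_ideal (cone_resolution :: (nat, 'k::field) graded_free_complex)"
  unfolding free_resolution_def
proof (intro conjI ballI allI cone_linear_bdry)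
  let ?F = "cone_resolution :: (nat, 'k) graded_free_complex"
  show "{b \<in> basis ?F. hdeg ?F b = 0} = {gen0 ?F}"
  proof -
    have "b = 0" if b: "b \<in> set_encode ` \<Delta>" "card (set_decode b) = 0" for b
    proof -
      obtain S where "S \<in> \<Delta>" "b = set_encode S" using b(1) by blast
      then show ?thesis using b(2) finite_face by (simp add: decode_encode)
    qed
    moreover have "0 \<in> set_encode ` \<Delta>" using empty_face by (metis image_eqI set_encode_empty)
    ultimately show ?thesis by auto
  qed
  show "bdry ?F v = 0" if v: "v \<in> component n ?F 0" for v
  proof (rule Phi_inject[OF _ E0_0])
    have E: "v \<in> E0" "of_degree 0 (Phi v)" using v by (simp_all add: component_Phi)
    show "bdry ?F v \<in> E0" by (rule Phi_bdry[OF E(1)])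
    show "Phi (bdry ?F v) = Phi 0"
      unfolding Phi_bdry[OF E(1)] Phi_0 using boundary_degree_0[OF E(2)] by (simp add: fun_eq_iff)
  qed
  show "bdry ?F v \<in> component n ?F i" if v: "v \<in> component n ?F (Suc i)" for v i
  proof -
    have E: "v \<in> E0" "of_degree (Suc i) (Phi v)" using v by (simp_all only: component_Phi)
    show ?thesis
      unfolding component_Phi Phi_bdry(2)[OF E(1)] using Phi_bdry(1)[OF E(1)] degree_boundary[OF E(2)] by blast
  qed
  show "{v \<in> component n ?F (Suc i). bdry ?F v = 0} = bdry ?F ` component n ?F (Suc (Suc i))" for i
  proof (intro subset_antisym subsetI)
    fix v assume "v \<in> {v \<in> component n ?F (Suc i). bdry ?F v = 0}"
    then have E: "v \<in> E0" "of_degree (Suc i) (Phi v)" and z: "bdry ?F v = 0" by (simp_all only: component_Phi mem_Collect_eq)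
    have "boundary (Phi v) U = 0" for U
      using Phi_bdry(2)[OF E(1)] z Phi_0 by (metis)
    then obtain \<psi> where \<psi>: "admissible \<psi>" "of_degree (Suc (Suc i)) \<psi>" "boundary \<psi> = Phi v"
      using boundary_exact[OF Phi_admissible[OF E(1)] E(2)] by blast
    obtain w where w: "w \<in> E0" "Phi w = \<psi>" using Phi_surj[OF \<psi>(1)] by blast
    have "Phi (bdry ?F w) = Phi v" unfolding Phi_bdry(2)[OF w(1)] w(2) by (rule \<psi>(3))
    then have "bdry ?F w = v" by (rule Phi_inject[OF Phi_bdry(1)[OF w(1)] E(1)])
    moreover have "w \<in> component n ?F (Suc (Suc i))" using w \<psi>(2) by (simp only: component_Phi)
    ultimately show "v \<in> bdry ?F ` component n ?F (Suc (Suc i))" by (metis image_eqI)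
  next
    fix v assume "v \<in> bdry ?F ` component n ?F (Suc (Suc i))"
    then obtain w where w: "w \<in> E0" "of_degree (Suc (Suc i)) (Phi w)" "v = bdry ?F w"
      by (auto simp only: component_Phi)
    note b = Phi_bdry[OF w(1)]
    have "Phi (bdry ?F v) = Phi 0"
      unfolding w(3) Phi_bdry(2)[OF b(1)] b(2) Phi_0 by (simp only: boundary_boundary fun_eq_iff simp_thms)
    then have "bdry ?F v = 0" unfolding w(3) by (rule Phi_inject[OF Phi_bdry(1)[OF b(1)] E0_0])
    moreover have "v \<in> component n ?F (Suc i)"
      unfolding component_Phi w(3) b(2) using b(1) degree_boundary[OF w(2)] by (rule conjI)
    ultimately show "v \<in> {v \<in> component n ?F (Suc i). bdry ?F v = 0}" by (simp only: mem_Collect_eq simp_thms)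
  qed
  show "bdry ?F ` component n ?F 1 = single (gen0 ?F) ` cone_ideal"
  proof (intro subset_antisym subsetI)
    fix x assume "x \<in> bdry ?F ` component n ?F 1"
    then obtain v where v: "v \<in> component n ?F 1" "x = bdry ?F v" by blast
    then have "v \<in> E0" by (simp only: component_Phi)
    then have "\<forall>j. lookup v (set_encode {j}) \<in> polyring n" by (simp add: E0_def)
    then have "(\<Sum>j\<in>insert p V. lookup v (set_encode {j}) * face_monomial {j}) \<in> cone_ideal"
      unfolding cone_ideal_iff by (intro exI[of _ "\<lambda>j. lookup v (set_encode {j})"]) simp
    then show "x \<in> single (gen0 ?F) ` cone_ideal"
      unfolding v(2) bdry_degree_1[OF v(1)] by simp
  next
    fix x :: "(nat, 'k) fvec" assume "x \<in> single (gen0 ?F) ` cone_ideal"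
    then obtain q where q: "q \<in> cone_ideal" "x = single 0 q" by auto
    from q(1) obtain c where cp: "\<forall>j\<in>insert p V. c j \<in> polyring n" and cq: "q = (\<Sum>j\<in>insert p V. c j * face_monomial {j})"
      unfolding cone_ideal_iff by (elim exE conjE)
    define v where "v = (\<Sum>j\<in>insert p V. single (set_encode {j}) (c j))"
    have v: "v \<in> component n ?F 1"
      unfolding v_def
    proof (intro component_sum component_single)
      fix j assume j: "j \<in> insert p V"
      show "set_encode {j} \<in> basis ?F" unfolding cone_resolution_simps by (rule imageI[OF vertex[OF j]])
      show "hdeg ?F (set_encode {j}) = 1" unfolding cone_resolution_simps decode_encode[OF vertex[OF j]] by simp
      show "c j \<in> polyring n" using cp j by blast
    qed
    have "lookup v (set_encode {j}) = c j" if j: "j \<in> insert p V" for j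
    proof -
      have "lookup v (set_encode {j}) = (\<Sum>i\<in>insert p V. if i = j then c i else 0)"
        unfolding v_def lookup_sum
      proof (intro sum.cong refl)
        fix i assume "i \<in> insert p V"
        then have "set_encode {i} = set_encode {j} \<longleftrightarrow> i = j"
          using encode_face_eq[OF vertex vertex, of i j] j by blast
        then show "lookup (single (set_encode {i}) (c i)) (set_encode {j}) = (if i = j then c i else 0)"
          by (simp only: lookup_single when_def)
      qed
      then show ?thesis using j finite_V by simp
    qed
    then have "bdry ?F v = x" unfolding bdry_degree_1[OF v] q(2) cq by (simp only: cong: sum.cong)
    with v show "x \<in> bdry ?F ` component n ?F 1" by blast
  qed
qed

lemma cone_minimal:
  "minimal_graded_free_resolution n cone_ideal (cone_resolution :: (nat, 'k::field) graded_free_complex)"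
  unfolding minimal_graded_free_resolution_def graded_free_resolution_def
proof (intro conjI ballI allI impI cone_free_resolution)
  let ?F = "cone_resolution :: (nat, 'k) graded_free_complex"
  show "mdeg ?F b j = 0" if b: "b \<in> basis ?F" "n \<le> j" for b j
  proof -
    obtain S where "S \<in> \<Delta>" "b = set_encode S" using b(1) by auto
    then have "j \<notin> labels (set_decode b)" using labels_bound[of S] b(2) by (auto simp: decode_encode)
    then show ?thesis by simp
  qed
  show "mdeg ?F (gen0 ?F) j = 0" for j by (simp add: labels_def)
  show "bdry ?F v \<in> homogeneous n ?F a" if v: "v \<in> homogeneous n ?F a" for v a
  proof -
    have E: "v \<in> E0" "homogeneous_fun a (Phi v)" using v by (simp_all only: homogeneous_Phi)
    show ?thesis
      unfolding homogeneous_Phi Phi_bdry(2)[OF E(1)] using Phi_bdry(1)[OF E(1)] homogeneous_boundary[OF E(2)] by (rule conjI)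
  qed
  show "lookup (lookup (bdry ?F v) b) 0 = 0" if "v \<in> elems n ?F" for v b
  proof (rule ccontr)
    assume nz: "lookup (lookup (bdry ?F v) b) 0 \<noteq> 0"
    have v: "v \<in> E0" using that by (simp only: elems_E0)
    note bd = Phi_bdry[OF v]
    have "b \<in> keys (bdry ?F v)" using nz by (metis in_keys_iff lookup_zero)
    then obtain U where U: "U \<in> \<Delta>" "b = set_encode U" using bd(1) unfolding E0_def by blast
    have "0 \<in> keys (lookup (bdry ?F v) (set_encode U))"
      using nz unfolding U(2) in_keys_iff .
    then have "squarefree_monomial (labels U) \<in> keys (Phi (bdry ?F v) U)"
      unfolding Phi_keys using U(1) by (metis add.right_neutral)
    then have "squarefree_monomial (labels U) \<in> keys (boundary (Phi v) U)" unfolding bd(2) .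
    then obtain i where i: "i \<notin> U" "squarefree_monomial (labels U) \<in> keys (Phi v (insert i U))"
      using boundary_keys by metis
    have "labels (insert i U) \<subseteq> labels U" "insert i U \<in> \<Delta>"
      using admissibleD[OF Phi_admissible[OF v] i(2)]
      by (simp_all add: keys_squarefree_monomial finite_labels finite_face[OF U(1)])
    then show False using label_not_below[of i U] i(1) by (auto simp: labels_def)
  qed
qed

lemma star_unit: "star (unit_vec {}) (unit_vec {}) = (unit_vec {} :: nat set \<Rightarrow> 'k::field mpoly)"
proof -
  have "wedge (unit_vec {}) (unit_vec {}) = (unit_vec {} :: nat set \<Rightarrow> 'k mpoly)"
    by (auto simp: fun_eq_iff wedge_unit_vec_left unit_vec_def)
  moreover have "supported (unit_vec {} :: nat set \<Rightarrow> 'k mpoly)"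
    using empty_face by (auto simp: supported_def unit_vec_def)
  ultimately show ?thesis by (simp add: star_def normal_form_supported)
qed

lemma cone_dga: "dga_structure n (cone_resolution :: (nat, 'k::field) graded_free_complex) cone_mult"
proof -
  let ?F = "cone_resolution :: (nat, 'k) graded_free_complex"
  have bil: "bilinear_mult n ?F cone_mult"
    unfolding bilinear_mult_def elems_E0
  proof (intro conjI ballI)
    fix a b c :: "(nat, 'k) fvec" assume E: "a \<in> E0" "b \<in> E0" "c \<in> E0"
    show "cone_mult a b \<in> E0" by (rule Phi_mult[OF E(1,2)])
    note ab = E0_closed(1)[OF E(1,2)]
    show "cone_mult (a + b) c = cone_mult a c + cone_mult b c"
    proof (rule Phi_inject)
      show "Phi (cone_mult (a + b) c) = Phi (cone_mult a c + cone_mult b c)"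
        unfolding Phi_mult(2)[OF ab E(3)] Phi_add Phi_mult(2)[OF E(1,3)] Phi_mult(2)[OF E(2,3)]
        by (rule HOL.ext) (rule star_add_left)
    qed (intro Phi_mult E0_closed E)+
    show "cone_mult c (a + b) = cone_mult c a + cone_mult c b"
    proof (rule Phi_inject)
      show "Phi (cone_mult c (a + b)) = Phi (cone_mult c a + cone_mult c b)"
        unfolding Phi_mult(2)[OF E(3) ab] Phi_add Phi_mult(2)[OF E(3,1)] Phi_mult(2)[OF E(3,2)]
        by (rule HOL.ext) (rule star_add_right)
    qed (intro Phi_mult E0_closed E)+
  next
    fix q :: "'k mpoly" and a b :: "(nat, 'k) fvec" assume q: "q \<in> polyring n" and E: "a \<in> E0" "b \<in> E0"
    note m = Phi_mult[OF E]
    show "cone_mult (smult q a) b = smult q (cone_mult a b)"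
    proof (rule Phi_inject)
      show "Phi (cone_mult (smult q a) b) = Phi (smult q (cone_mult a b))"
        unfolding Phi_mult(2)[OF E0_closed(2)[OF q E(1)] E(2)] Phi_smult m(2)
        by (rule HOL.ext) (rule star_smult_left)
    qed (intro Phi_mult E0_closed E q)+
    show "cone_mult a (smult q b) = smult q (cone_mult a b)"
    proof (rule Phi_inject)
      show "Phi (cone_mult a (smult q b)) = Phi (smult q (cone_mult a b))"
        unfolding Phi_mult(2)[OF E(1) E0_closed(2)[OF q E(2)]] Phi_smult m(2)
        by (rule HOL.ext) (rule star_smult_right)
    qed (intro Phi_mult E0_closed E q)+
  qed
  have hom: "cone_mult a b \<in> homogeneous n ?F (\<lambda>j. d j + e j)"
    if a: "a \<in> homogeneous n ?F d" and b: "b \<in> homogeneous n ?F e" for a b d e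
  proof -
    have E: "a \<in> E0" "homogeneous_fun d (Phi a)" "b \<in> E0" "homogeneous_fun e (Phi b)"
      using a b by (simp_all only: homogeneous_Phi)
    show ?thesis
      unfolding homogeneous_Phi Phi_mult(2)[OF E(1,3)]
      using Phi_mult(1)[OF E(1,3)] homogeneous_star[OF E(2,4)] by (rule conjI)
  qed
  have gen: "cone_mult (single (gen0 ?F) q) (single (gen0 ?F) r) = single (gen0 ?F) (q * r)"
    if q: "q \<in> polyring n" and r: "r \<in> polyring n" for q r
  proof -
    note E = single_0_E0[OF q] single_0_E0[OF r]
    have "cone_mult (single 0 q) (single 0 r) = single 0 (q * r)"
    proof (rule Phi_inject[OF Phi_mult(1)[OF E] single_0_E0[OF polyring_mult[OF q r]]])
      show "Phi (cone_mult (single 0 q) (single 0 r)) = Phi (single 0 (q * r))"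
        unfolding Phi_mult(2)[OF E] Phi_single_0
        by (rule HOL.ext) (simp only: star_smult_left star_smult_right star_unit mult.assoc)
    qed
    then show ?thesis by simp
  qed
  have comp: "bdry ?F (cone_mult a b) = cone_mult (bdry ?F a) b + smult ((- 1) ^ i) (cone_mult a (bdry ?F b)) \<and>
        cone_mult a b \<in> component n ?F (i + j) \<and> cone_mult a b = smult ((- 1) ^ (i * j)) (cone_mult b a)"
    if a: "a \<in> component n ?F i" and b: "b \<in> component n ?F j" for a b i j
  proof (intro conjI)
    have E: "a \<in> E0" "b \<in> E0" and deg: "of_degree i (Phi a)" "of_degree j (Phi b)"
      using a b by (simp_all only: component_Phi)
    note m = Phi_mult[OF E] and ba = Phi_bdry[OF E(1)] and bb = Phi_bdry[OF E(2)]
    show "bdry ?F (cone_mult a b) = cone_mult (bdry ?F a) b + smult ((- 1) ^ i) (cone_mult a (bdry ?F b))"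
    proof (rule Phi_inject[OF Phi_bdry(1)[OF m(1)]])
      show "cone_mult (bdry ?F a) b + smult ((- 1) ^ i) (cone_mult a (bdry ?F b)) \<in> E0"
        by (intro E0_closed Phi_mult E ba(1) bb(1) polyring_neg_one_power)
      show "Phi (bdry ?F (cone_mult a b)) = Phi (cone_mult (bdry ?F a) b + smult ((- 1) ^ i) (cone_mult a (bdry ?F b)))"
        unfolding Phi_bdry(2)[OF m(1)] m(2) Phi_add Phi_smult Phi_mult(2)[OF ba(1) E(2)] Phi_mult(2)[OF E(1) bb(1)] ba(2) bb(2)
        by (rule HOL.ext) (rule boundary_star[OF deg(1)])
    qed
    show "cone_mult a b \<in> component n ?F (i + j)"
      unfolding component_Phi m(2) using m(1) degree_star[OF deg] by (rule conjI)
    show "cone_mult a b = smult ((- 1) ^ (i * j)) (cone_mult b a)"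
    proof (rule Phi_inject[OF m(1) E0_closed(2)[OF polyring_neg_one_power Phi_mult(1)[OF E(2,1)]]])
      show "Phi (cone_mult a b) = Phi (smult ((- 1) ^ (i * j)) (cone_mult b a))"
        unfolding m(2) Phi_smult Phi_mult(2)[OF E(2,1)] by (rule HOL.ext) (rule star_commute[OF deg])
    qed
  qed
  have assoc: "cone_mult (cone_mult a b) c = cone_mult a (cone_mult b c)"
    if E: "a \<in> E0" "b \<in> E0" "c \<in> E0" for a b c :: "(nat, 'k) fvec"
  proof -
    note ab = Phi_mult[OF E(1,2)] and bc = Phi_mult[OF E(2,3)]
    have "Phi (cone_mult (cone_mult a b) c) = Phi (cone_mult a (cone_mult b c))"
      unfolding Phi_mult(2)[OF ab(1) E(3)] Phi_mult(2)[OF E(1) bc(1)] ab(2) bc(2) by (rule star_assoc)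
    then show ?thesis by (rule Phi_inject[OF Phi_mult(1)[OF ab(1) E(3)] Phi_mult(1)[OF E(1) bc(1)]])
  qed
  show ?thesis
    unfolding dga_structure_def elems_E0
    by (intro conjI allI ballI bil hom gen assoc conjunct1[OF comp] conjunct1[OF conjunct2[OF comp]]
        conjunct2[OF conjunct2[OF comp]])
qed

lemma cone_ideal_squarefree: "squarefree_monomial_ideal n (cone_ideal :: 'k::field mpoly set)"
  unfolding squarefree_monomial_ideal_def
proof (intro exI conjI)
  show "(cone_ideal :: 'k mpoly set) = ideal_generated n ((\<lambda>i. face_monomial {i}) ` insert p V)" by (rule cone_ideal_def)
  show "(\<lambda>i. face_monomial {i} :: 'k mpoly) ` insert p V \<subseteq> squarefree_monomials n"
  proof (rule image_subsetI)
    fix i assume i: "i \<in> insert p V"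
    have f: "finite (labels {i})" by (simp add: finite_labels)
    show "(face_monomial {i} :: 'k mpoly) \<in> squarefree_monomials n"
      unfolding squarefree_monomials_def face_monomial_def mem_Collect_eq
      using labels_bound[OF vertex[OF i]] f
      by (intro exI[of _ "squarefree_monomial (labels {i})"])
        (simp add: keys_squarefree_monomial lookup_squarefree_monomial)
  qed
qed

lemma cone_ideal_nonzero: "(cone_ideal :: 'k::field mpoly set) \<noteq> {0}"
proof -
  have "(\<Sum>j\<in>insert p V. (if j = p then 1 else 0) * face_monomial {j}) = (face_monomial {p} :: 'k mpoly)"
    using finite_V by (simp add: if_distrib[of "\<lambda>c. c * _"] cong: if_cong)
  then have "(face_monomial {p} :: 'k mpoly) \<in> cone_ideal"
    unfolding cone_ideal_iff by (intro exI[of _ "\<lambda>j. if j = p then 1 else 0"]) simp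
  moreover have "(face_monomial {p} :: 'k mpoly) \<noteq> 0"
    by (simp add: face_monomial_def)
  ultimately show ?thesis by blast
qed

lemma cone_betti: "betti n (cone_ideal :: 'k::field mpoly set) i = f_vector \<Delta> i"
proof -
  let ?F = "cone_resolution :: (nat, 'k) graded_free_complex"
  have "{b \<in> basis ?F. hdeg ?F b = i} = set_encode ` {S \<in> \<Delta>. card S = i}"
    by (auto simp: decode_encode)
  moreover have "inj_on set_encode {S \<in> \<Delta>. card S = i}"
    by (rule inj_onI) (simp add: encode_face_eq)
  ultimately have "card {b \<in> basis ?F. hdeg ?F b = i} = f_vector \<Delta> i"
    by (simp add: f_vector_def card_image)
  moreover have "betti n (cone_ideal :: 'k mpoly set) i = card {b \<in> basis ?F. hdeg ?F b = i}"
  proof (rule betti_eq_card[OF cone_free_resolution])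
    show "minimal_complex n ?F" by (rule minimal_complex[OF cone_ideal_squarefree cone_minimal])
    show "finite {b \<in> basis ?F. hdeg ?F b = i}" using finite_complex by simp
  qed
  ultimately show ?thesis by (simp only:)
qed

end

lemma label_bound_exists: "\<exists>n. \<forall>i\<in>insert p V. label i \<subseteq> {..<n}"
proof -
  have "finite (\<Union>i\<in>insert p V. label i)" using finite_V finite_label by simp
  then obtain n where "\<forall>x\<in>\<Union>i\<in>insert p V. label i. x < n" using finite_nat_set_iff_bounded by blast
  then show ?thesis by (intro exI[of _ n]) blast
qed

end

theorem dga_resolution_of_cone:
  assumes "simplicial_complex (\<Delta> :: nat set set)" "is_cone \<Delta>"
  shows "\<exists>n. \<exists>I :: 'k::field mpoly set. squarefree_monomial_ideal n I \<and> I \<noteq> {0} \<and>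
    minimal_resolution_is_DGA n I \<and> (\<forall>i. betti n I i = f_vector \<Delta> i)"
proof -
  obtain p where p: "{p} \<in> \<Delta>" "\<And>W. W \<in> \<Delta> \<Longrightarrow> W \<union> {p} \<in> \<Delta>"
    using assms(2) unfolding is_cone_def by blast
  interpret cone_complex \<Delta> p
    by standard (use assms(1) p in simp_all)
  obtain n where n: "\<And>i. i \<in> insert p V \<Longrightarrow> label i \<subseteq> {..<n}" using label_bound_exists by blast
  have "minimal_resolution_is_DGA n (cone_ideal n :: 'k mpoly set)"
    unfolding minimal_resolution_is_DGA_def using cone_minimal[OF n] cone_dga[OF n] by blast
  then show ?thesis
    using cone_ideal_squarefree[OF n] cone_ideal_nonzero[OF n] cone_betti[OF n] by blast
qed

section \<open>Betti numbers of DGA resolutions and f-vectors of cones\<close>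

theorem theorem4p1:
  fixes f :: "nat \<Rightarrow> nat"
  assumes "f 0 = 1" and "finite {i. f i \<noteq> 0}"
  shows "(\<exists>n. \<exists>I :: 'k::field mpoly set.
            squarefree_monomial_ideal n I \<and> I \<noteq> {0} \<and>
            minimal_resolution_is_DGA n I \<and> (\<forall>i. betti n I i = f i))
         \<longleftrightarrow>
         (\<exists>\<Delta> :: nat set set.
            simplicial_complex \<Delta> \<and> is_cone \<Delta> \<and> (\<forall>i. f_vector \<Delta> i = f i))"
proof
  assume "\<exists>n. \<exists>I :: 'k mpoly set. squarefree_monomial_ideal n I \<and> I \<noteq> {0} \<and>
    minimal_resolution_is_DGA n I \<and> (\<forall>i. betti n I i = f i)"
  then obtain n and I :: "'k mpoly set" where I: "squarefree_monomial_ideal n I" "I \<noteq> {0}"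
    "minimal_resolution_is_DGA n I" "\<And>i. betti n I i = f i" by blast
  show "\<exists>\<Delta> :: nat set set. simplicial_complex \<Delta> \<and> is_cone \<Delta> \<and> (\<forall>i. f_vector \<Delta> i = f i)"
    using betti_numbers_of_dga_resolution[OF I(1-3)] I(4) by simp
next
  assume "\<exists>\<Delta> :: nat set set. simplicial_complex \<Delta> \<and> is_cone \<Delta> \<and> (\<forall>i. f_vector \<Delta> i = f i)"
  then obtain \<Delta> :: "nat set set" where \<Delta>: "simplicial_complex \<Delta>" "is_cone \<Delta>" "\<And>i. f_vector \<Delta> i = f i" by blast
  show "\<exists>n. \<exists>I :: 'k mpoly set. squarefree_monomial_ideal n I \<and> I \<noteq> {0} \<and>
    minimal_resolution_is_DGA n I \<and> (\<forall>i. betti n I i = f i)"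
    using dga_resolution_of_cone[OF \<Delta>(1,2), where 'k = 'k] \<Delta>(3) by simp
qed

end
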